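(* Let $s>0$, $N\ge1$ and $0\le\theta_L<\theta_R$, and set $\theta_0=\theta_L$, $\theta_{N+1}=\theta_R$. The invariant measure of the hidden parameter model on $[0,\infty)^{\{1,\dots,N\}}$ with generator \begin{align*} \mathcal{L}f(\theta)&=\int_0^1\frac{du}{u}(1-u)^{2s-1}\big(f(\theta-u\theta_1\delta_1+u\theta_L\delta_1)-f(\theta)\big)\\ &\quad+\sum_{i=1}^{N-1}\int_0^1\frac{du}{u}(1-u)^{2s-1}\big(f(\theta-u\theta_i\delta_i+u\theta_{i+1}\delta_i)+f(\theta-u\theta_{i+1}\delta_{i+1}+u\theta_i\delta_{i+1})-2f(\theta)\big)\\ &\quad+\int_0^1\frac{du}{u}(1-u)^{2s-1}\big(f(\theta-u\theta_N\delta_N+u\theta_R\delta_N)-f(\theta)\big) \end{align*} is the probability measure $$\Lambda^N(d\theta_1,\dots,d\theta_N)=C\prod_{i=1}^{N+1}(\theta_i-\theta_{i-1})^{2s-1}\,\mathbf{1}(\theta_L\le\theta_1\le\dots\le\theta_N\le\theta_R)\,d\theta_1\cdots d\theta_N,$$ $$C=\frac{1}{(\theta_R-\theta_L)^{2s(N+1)-1}}\,\frac{\Gamma(2s(N+1))}{\Gamma(2s)^{N+1}}.$$ As a consequence, the invariant measure of the boundary driven continuous harmonic model with parameter $s$ on $[0,\infty)^{\{1,\dots,N\}}$ defined by the generator \begin{align*} Lf(\zeta)&=\int_0^1\frac{du}{u}(1-u)^{2s-1}\big(f(\zeta-u\zeta_1\delta_1)-f(\zeta)\big)+\int_0^\infty\frac{du}{u}e^{-u}\big(f(\zeta+u\theta_L\delta_1)-f(\zeta)\big)\\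 &\quad+\sum_{i=1}^{N-1}\int_0^1\frac{du}{u}(1-u)^{2s-1}\big(f(\zeta-u\zeta_i\delta_i+u\zeta_i\delta_{i+1})+f(\zeta-u\zeta_{i+1}\delta_{i+1}+u\zeta_{i+1}\delta_i)-2f(\zeta)\big)\\ &\quad+\int_0^1\frac{du}{u}(1-u)^{2s-1}\big(f(\zeta-u\zeta_N\delta_N)-f(\zeta)\big)+\int_0^\infty\frac{du}{u}e^{-u}\big(f(\zeta+u\theta_R\delta_N)-f(\zeta)\big) \end{align*} is the mixture of products of Gamma distributions $\int\big(\bigotimes_{i=1}^N\nu_{\theta_i}\big)\Lambda^N(d\theta_1,\dots,d\theta_N)$ with mixing measure $\Lambda^N$.
   Context: $\delta_i$ is the configuration with value $1$ at $i$ and $0$ elsewhere. For $\theta>0$, $\nu_\theta(dx)=\frac{x^{2s-1}}{\Gamma(2s)\theta^{2s}}e^{-x/\theta}dx$ on $[0,\infty)$ (Gamma distribution with shape $2s$ and scale $\theta$). *)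

theory Defs
  imports "HOL-Probability.Probability"
begin

section \<open>Feller semigroups on the orthant\<close>

text \<open>
  Configurations on the sites \<open>{1..N}\<close> are extensional functions in \<open>{1..N} \<rightarrow>\<^sub>E {0..}\<close>.
  All values outside \<open>{1..N}\<close> agree, so the product topology of \<^typ>\<open>nat \<Rightarrow> real\<close> induces
  on this set the Euclidean topology of the \<open>N\<close>-dimensional orthant.
\<close>

definition config_space :: "nat \<Rightarrow> (nat \<Rightarrow> real) measure" where
  "config_space N = PiM {1..N} (\<lambda>_. restrict_space borel {0..})"

abbreviation configs :: "nat \<Rightarrow> (nat \<Rightarrow> real) set" where
  "configs N \<equiv> PiE {1..N} (\<lambda>_. {0..})"

definition C0 :: "nat \<Rightarrow> ((nat \<Rightarrow> real) \<Rightarrow> real) set" where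
  "C0 N = {f. continuous_on (configs N) f \<and>
     (\<forall>e>0. \<exists>R. \<forall>x\<in>configs N. (\<exists>i\<in>{1..N}. x i > R) \<longrightarrow> \<bar>f x\<bar> < e)}"

text \<open>
  Compactly supported functions that are continuously differentiable up to the boundary of the
  orthant; derivatives at a boundary point are one-sided, by \<open>at _ within {0..}\<close>.
\<close>

definition C1c :: "nat \<Rightarrow> ((nat \<Rightarrow> real) \<Rightarrow> real) set" where
  "C1c N = {f. continuous_on (configs N) f \<and>
     (\<exists>D. \<forall>i\<in>{1..N}. continuous_on (configs N) (D i) \<and>
        (\<forall>x\<in>configs N. ((\<lambda>r. f (x(i := r))) has_real_derivative D i x) (at (x i) within {0..}))) \<and>
     (\<exists>R. \<forall>x\<in>configs N. (\<exists>i\<in>{1..N}. x i > R) \<longrightarrow> f x = 0)}"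

definition markov_semigroup ::
    "nat \<Rightarrow> (real \<Rightarrow> (nat \<Rightarrow> real) \<Rightarrow> (nat \<Rightarrow> real) measure) \<Rightarrow> bool" where
  "markov_semigroup N P \<longleftrightarrow>
     (\<forall>t\<ge>0. P t \<in> config_space N \<rightarrow>\<^sub>M prob_algebra (config_space N)) \<and>
     (\<forall>x\<in>configs N. P 0 x = return (config_space N) x) \<and>
     (\<forall>t\<ge>0. \<forall>r\<ge>0. \<forall>x\<in>configs N. P (t + r) x = P t x \<bind> P r)"

definition feller_semigroup ::
    "nat \<Rightarrow> (real \<Rightarrow> (nat \<Rightarrow> real) \<Rightarrow> (nat \<Rightarrow> real) measure) \<Rightarrow> bool" where
  "feller_semigroup N P \<longleftrightarrow> markov_semigroup N P \<and>
     (\<forall>f\<in>C0 N. (\<forall>t\<ge>0. (\<lambda>x. \<integral>y. f y \<partial>P t x) \<in> C0 N) \<and>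
        uniform_limit (configs N) (\<lambda>t x. \<integral>y. f y \<partial>P t x) f (at_right 0))"

text \<open>The graph of the infinitesimal generator of the semigroup acting on \<^const>\<open>C0\<close>.\<close>

definition inf_generator ::
    "nat \<Rightarrow> (real \<Rightarrow> (nat \<Rightarrow> real) \<Rightarrow> (nat \<Rightarrow> real) measure) \<Rightarrow>
     (((nat \<Rightarrow> real) \<Rightarrow> real) \<times> ((nat \<Rightarrow> real) \<Rightarrow> real)) set" where
  "inf_generator N P = {(f, g). f \<in> C0 N \<and> g \<in> C0 N \<and>
     uniform_limit (configs N) (\<lambda>t x. ((\<integral>y. f y \<partial>P t x) - f x) / t) g (at_right 0)}"

text \<open>
  The explicit integral formulas for the generators below make sense for functions in
  \<^const>\<open>C1c\<close>: as the measures \<open>du/u\<close> are infinite near 0, some regularity is needed.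
  A process has generator \<open>L\<close> if its infinitesimal generator is given by \<open>L\<close> on these functions.
\<close>

definition feller_with_generator ::
    "nat \<Rightarrow> (((nat \<Rightarrow> real) \<Rightarrow> real) \<Rightarrow> (nat \<Rightarrow> real) \<Rightarrow> real) \<Rightarrow>
     (real \<Rightarrow> (nat \<Rightarrow> real) \<Rightarrow> (nat \<Rightarrow> real) measure) \<Rightarrow> bool" where
  "feller_with_generator N L P \<longleftrightarrow>
     feller_semigroup N P \<and> (\<forall>f\<in>C1c N. (f, L f) \<in> inf_generator N P)"

definition invariant_measure ::
    "nat \<Rightarrow> (real \<Rightarrow> (nat \<Rightarrow> real) \<Rightarrow> (nat \<Rightarrow> real) measure) \<Rightarrow> (nat \<Rightarrow> real) measure \<Rightarrow> bool" where
  "invariant_measure N P \<mu> \<longleftrightarrow>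
     \<mu> \<in> space (prob_algebra (config_space N)) \<and> (\<forall>t\<ge>0. \<mu> \<bind> P t = \<mu>)"


section \<open>The two models\<close>

definition hidden_generator ::
    "real \<Rightarrow> nat \<Rightarrow> real \<Rightarrow> real \<Rightarrow> ((nat \<Rightarrow> real) \<Rightarrow> real) \<Rightarrow> (nat \<Rightarrow> real) \<Rightarrow> real" where
  "hidden_generator s N \<theta>L \<theta>R f \<theta> =
     (LBINT u:{0<..<1}. (1 - u) powr (2 * s - 1) / u *
        (f (\<theta>(1 := \<theta> 1 - u * \<theta> 1 + u * \<theta>L)) - f \<theta>))
   + (\<Sum>i=1..<N. LBINT u:{0<..<1}. (1 - u) powr (2 * s - 1) / u *
        (f (\<theta>(i := \<theta> i - u * \<theta> i + u * \<theta> (i+1)))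
       + f (\<theta>(i+1 := \<theta> (i+1) - u * \<theta> (i+1) + u * \<theta> i)) - 2 * f \<theta>))
   + (LBINT u:{0<..<1}. (1 - u) powr (2 * s - 1) / u *
        (f (\<theta>(N := \<theta> N - u * \<theta> N + u * \<theta>R)) - f \<theta>))"

definition harmonic_generator ::
    "real \<Rightarrow> nat \<Rightarrow> real \<Rightarrow> real \<Rightarrow> ((nat \<Rightarrow> real) \<Rightarrow> real) \<Rightarrow> (nat \<Rightarrow> real) \<Rightarrow> real" where
  "harmonic_generator s N \<theta>L \<theta>R f \<zeta> =
     (LBINT u:{0<..<1}. (1 - u) powr (2 * s - 1) / u * (f (\<zeta>(1 := \<zeta> 1 - u * \<zeta> 1)) - f \<zeta>))
   + (LBINT u:{0<..}. exp (- u) / u * (f (\<zeta>(1 := \<zeta> 1 + u * \<theta>L)) - f \<zeta>))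
   + (\<Sum>i=1..<N. LBINT u:{0<..<1}. (1 - u) powr (2 * s - 1) / u *
        (f (\<zeta>(i := \<zeta> i - u * \<zeta> i, i+1 := \<zeta> (i+1) + u * \<zeta> i))
       + f (\<zeta>(i+1 := \<zeta> (i+1) - u * \<zeta> (i+1), i := \<zeta> i + u * \<zeta> (i+1))) - 2 * f \<zeta>))
   + (LBINT u:{0<..<1}. (1 - u) powr (2 * s - 1) / u * (f (\<zeta>(N := \<zeta> N - u * \<zeta> N)) - f \<zeta>))
   + (LBINT u:{0<..}. exp (- u) / u * (f (\<zeta>(N := \<zeta> N + u * \<theta>R)) - f \<zeta>))"


section \<open>The mixing measure and the mixture\<close>

definition Lambda_const :: "real \<Rightarrow> nat \<Rightarrow> real \<Rightarrow> real \<Rightarrow> real" where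
  "Lambda_const s N \<theta>L \<theta>R =
     1 / (\<theta>R - \<theta>L) powr (2 * s * real (N+1) - 1) * (Gamma (2 * s * real (N+1)) / Gamma (2 * s) ^ (N+1))"

definition Lambda :: "real \<Rightarrow> nat \<Rightarrow> real \<Rightarrow> real \<Rightarrow> (nat \<Rightarrow> real) measure" where
  "Lambda s N \<theta>L \<theta>R =
     density (PiM {1..N} (\<lambda>_. restrict_space lborel {0..}))
       (\<lambda>\<theta>. let \<theta>' = \<theta>(0 := \<theta>L, N+1 := \<theta>R) in
          ennreal (Lambda_const s N \<theta>L \<theta>R *
            (\<Prod>i=1..N+1. (\<theta>' i - \<theta>' (i-1)) powr (2 * s - 1)) *
            of_bool (\<forall>i\<in>{1..N+1}. \<theta>' (i-1) \<le> \<theta>' i)))"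

text \<open>
  Only \<open>\<theta> > 0\<close> is meaningful; for \<open>\<theta> = 0\<close> the formula gives the zero measure. This value is
  irrelevant in \<open>gamma_mixture\<close>, since \<^const>\<open>Lambda\<close> has a Lebesgue density.
\<close>

definition gamma_measure :: "real \<Rightarrow> real \<Rightarrow> real measure" where
  "gamma_measure s \<theta> =
     density (restrict_space lborel {0..})
       (\<lambda>x. ennreal (x powr (2 * s - 1) / (Gamma (2 * s) * \<theta> powr (2 * s)) * exp (- x / \<theta>)))"

definition gamma_mixture :: "real \<Rightarrow> nat \<Rightarrow> real \<Rightarrow> real \<Rightarrow> (nat \<Rightarrow> real) measure" where
  "gamma_mixture s N \<theta>L \<theta>R =
     Lambda s N \<theta>L \<theta>R \<bind> (\<lambda>\<theta>. PiM {1..N} (\<lambda>i. gamma_measure s (\<theta> i)))"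

end

theory Submission
  imports Defs
begin

text \<open>
  Both models are dual to the hidden parameter model with zero boundary values. Put
  \<open>q z = (1 + z) powr (- 2s)\<close> for the hidden model, \<open>q z = exp (- z)\<close> for the harmonic one, and
  \<open>k l x = \<Prod> q (l\<^sub>i x\<^sub>i)\<close>. Then \<open>L (k l) x = H (k x) l - V l * k l x\<close>, where \<open>H\<close> is the hidden generator
  with zero boundary values and \<open>V l = ln (1 + l\<^sub>1 \<theta>\<^sub>L) + ln (1 + l\<^sub>N \<theta>\<^sub>R) \<ge> 0\<close>. Hence the transform
  \<open>\<psi> l = \<integral> k l d\<mu>\<close> of an invariant measure solves \<open>H \<psi> = V \<psi>\<close> with \<open>\<psi> 0 = 1\<close>; a maximum principle for
  \<open>H\<close> makes the solution unique, and \<open>\<psi>\<close> determines \<open>\<mu>\<close>. For the mixing measure the equation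
  reduces, site by site, to an integral that is odd under \<open>y \<mapsto> A B / y\<close>, where
  \<open>y = 1 + l\<^sub>i x\<^sub>i\<close> lies between \<open>A\<close> and \<open>B\<close>; the Gamma mixture has the same transform.

  Nothing is known about a core of the generator, so \<open>\<integral> L f d\<mu> = 0\<close> for test functions does not
  immediately give invariance of \<open>\<mu>\<close>. Instead, all resolvent averages of \<open>\<mu>\<close> along the semigroup
  solve \<open>\<kappa> (\<psi>' - \<psi>) = H \<psi>' - V \<psi>'\<close>, whose only solution is \<open>\<psi>' = \<psi>\<close>, again by the maximum principle.
\<close>

section \<open>Integrals against the jump rate\<close>

lemma nn_integral_FTC_Ioo:
  fixes f F :: "real \<Rightarrow> real"
  assumes "a < b"
    and F: "\<And>x. a < x \<Longrightarrow> x < b \<Longrightarrow> (F has_real_derivative f x) (at x)"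
    and f: "\<And>x. a < x \<Longrightarrow> x < b \<Longrightarrow> isCont f x" "\<And>x. a < x \<Longrightarrow> x < b \<Longrightarrow> 0 \<le> f x"
    and A: "(F \<longlongrightarrow> A) (at_right a)" and B: "(F \<longlongrightarrow> B) (at_left b)"
  shows "(\<integral>\<^sup>+x\<in>{a<..<b}. ennreal (f x) \<partial>lborel) = ennreal (B - A)"
proof -
  have 1: "set_integrable lborel (einterval (ereal a) (ereal b)) f"
    and 2: "(LBINT x=ereal a..ereal b. f x) = B - A"
    using assms by (intro interval_integral_FTC_nonneg[where F = F and A = A and B = B];
        auto simp: ereal_tendsto_simps1)+
  have i: "integrable lborel (\<lambda>x. indicator {a<..<b} x *\<^sub>R f x)"
    using 1 by (simp add: set_integrable_def einterval_eq)
  have "(\<integral>\<^sup>+x\<in>{a<..<b}. ennreal (f x) \<partial>lborel) = (\<integral>\<^sup>+x. ennreal (indicator {a<..<b} x *\<^sub>R f x) \<partial>lborel)"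
    by (intro nn_integral_cong) (auto split: split_indicator)
  also have "\<dots> = ennreal (\<integral>x. indicator {a<..<b} x *\<^sub>R f x \<partial>lborel)"
    using f(2) by (intro nn_integral_eq_integral i) (auto split: split_indicator)
  also have "\<dots> = ennreal (B - A)"
    using 2 \<open>a < b\<close> by (simp add: interval_lebesgue_integral_def set_lebesgue_integral_def einterval_eq)
  finally show ?thesis .
qed

lemma nn_integral_one_minus_powr:
  fixes a :: real assumes "0 < a"
  shows "(\<integral>\<^sup>+u\<in>{0<..<1}. ennreal ((1 - u) powr (a - 1)) \<partial>lborel) = ennreal (1 / a)"
proof -
  have "((\<lambda>u. - ((1 - u) powr a / a)) \<longlongrightarrow> - ((1 - 1) powr a / a)) (at_left 1)"
    using assms by (intro tendsto_intros) (auto simp: eventually_at_filter)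
  moreover have "((\<lambda>u. - ((1 - u) powr a / a)) \<longlongrightarrow> - ((1 - 0) powr a / a)) (at_right 0)"
    using assms by (intro tendsto_intros) (auto simp: eventually_at_filter)
  ultimately show ?thesis
    using assms
    by (subst nn_integral_FTC_Ioo[where F = "\<lambda>u. - ((1 - u) powr a / a)" and A = "-1/a" and B = 0])
       (auto intro!: derivative_eq_intros continuous_intros simp: powr_diff)
qed

lemma
  fixes a :: real assumes "0 < a"
  shows set_integrable_one_minus_powr: "set_integrable lborel {0<..<1} (\<lambda>u. (1 - u) powr (a - 1))"
    and set_integral_one_minus_powr: "(LBINT u:{0<..<1}. (1 - u) powr (a - 1)) = 1 / a"
proof -
  have "has_bochner_integral lborel (\<lambda>u. indicator {0<..<1} u *\<^sub>R (1 - u) powr (a - 1)) (1 / a)"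
  proof (rule has_bochner_integral_nn_integral)
    have "(\<integral>\<^sup>+u. ennreal (indicator {0<..<1} u *\<^sub>R (1 - u) powr (a - 1)) \<partial>lborel) =
       (\<integral>\<^sup>+u\<in>{0<..<1}. ennreal ((1 - u) powr (a - 1)) \<partial>lborel)"
      by (intro nn_integral_cong) (auto split: split_indicator)
    then show "(\<integral>\<^sup>+u. ennreal (indicator {0<..<1} u *\<^sub>R (1 - u) powr (a - 1)) \<partial>lborel) = ennreal (1 / a)"
      using nn_integral_one_minus_powr[OF assms] by simp
  qed (use assms in auto)
  then show "set_integrable lborel {0<..<1} (\<lambda>u. (1 - u) powr (a - 1))"
    "(LBINT u:{0<..<1}. (1 - u) powr (a - 1)) = 1 / a"
    by (auto simp: set_integrable_def set_lebesgue_integral_def has_bochner_integral_iff)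
qed

lemma set_integrable_rate:
  fixes a K :: real
  assumes "0 < a" and g: "g \<in> borel_measurable (restrict_space borel {0<..<1})"
    and K: "\<And>u. 0 < u \<Longrightarrow> u < 1 \<Longrightarrow> \<bar>g u\<bar> \<le> K * u"
  shows "set_integrable lborel {0<..<1} (\<lambda>u. (1 - u) powr (a - 1) / u * g u)"
    and "\<bar>LBINT u:{0<..<1}. (1 - u) powr (a - 1) / u * g u\<bar> \<le> K / a"
proof -
  have bd: "\<bar>(1 - u) powr (a - 1) / u * g u\<bar> \<le> K * (1 - u) powr (a - 1)" if "0 < u" "u < 1" for u
  proof -
    have "\<bar>(1 - u) powr (a - 1) / u * g u\<bar> = (1 - u) powr (a - 1) / u * \<bar>g u\<bar>"
      using that by (simp add: abs_mult)
    also have "\<dots> \<le> (1 - u) powr (a - 1) / u * (K * u)"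
      using that K[OF that] by (intro mult_left_mono) auto
    finally show ?thesis using that by (simp add: field_simps)
  qed
  have m: "(\<lambda>u. indicator {0<..<1} u *\<^sub>R ((1 - u) powr (a - 1) / u * g u)) \<in> borel_measurable lborel"
  proof -
    have "(\<lambda>u. (1 - u) powr (a - 1) / u * g u) \<in> borel_measurable (restrict_space borel {0<..<1})"
      by (intro borel_measurable_times g measurable_restrict_space1) simp
    then show ?thesis
      by (subst (asm) borel_measurable_restrict_space_iff) auto
  qed
  have i: "set_integrable lborel {0<..<1} (\<lambda>u. K * (1 - u) powr (a - 1))"
    using set_integrable_one_minus_powr[OF \<open>0 < a\<close>] by (intro set_integrable_mult_right)
  show 1: "set_integrable lborel {0<..<1} (\<lambda>u. (1 - u) powr (a - 1) / u * g u)"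
    unfolding set_integrable_def
    by (rule Bochner_Integration.integrable_bound[OF i[unfolded set_integrable_def] m])
       (use bd in \<open>auto split: split_indicator simp: intro!: order_trans[OF _ abs_ge_self]\<close>)
  have "\<bar>LBINT u:{0<..<1}. (1 - u) powr (a - 1) / u * g u\<bar>
      \<le> (LBINT u:{0<..<1}. \<bar>(1 - u) powr (a - 1) / u * g u\<bar>)"
    using set_integral_norm_bound[OF 1] by simp
  also have "\<dots> \<le> (LBINT u:{0<..<1}. K * (1 - u) powr (a - 1))"
    using bd by (intro set_integral_mono set_integrable_abs 1 i) auto
  also have "\<dots> = K / a"
    using set_integral_one_minus_powr[OF \<open>0 < a\<close>] by simp
  finally show "\<bar>LBINT u:{0<..<1}. (1 - u) powr (a - 1) / u * g u\<bar> \<le> K / a" .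
qed

lemma nn_integral_log_kernel:
  fixes a A B :: real assumes "0 < a" "0 < A" "0 < B"
  shows "(\<integral>\<^sup>+u\<in>{0<..<1}. ennreal ((1 - u) powr (a - 1) / u * \<bar>((1 - u) * A + u * B) powr - a - A powr - a\<bar>) \<partial>lborel)
    = ennreal (A powr - a * \<bar>ln A - ln B\<bar>)"
proof -
  define I where "I = {min A B..max A B}"
  define k where "k = (\<lambda>u b. if 0 < u \<and> u < 1 \<and> b \<in> I then a * (1 - u) powr (a - 1) * ((1 - u) * A + u * b) powr (- a - 1) else 0)"
  have pos: "0 < (1 - u) * A + u * b" if "0 < u" "u < 1" "0 < b" for u b
    using that assms by (intro add_pos_pos mult_pos_pos) auto
  have Ipos: "0 < b" if "b \<in> I" for b
    using that assms unfolding I_def by (auto simp: min_def split: if_splits)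
  have k0: "0 \<le> k u b" for u b
    using assms by (simp add: k_def)
  have inner: "ennreal ((1 - u) powr (a - 1) / u * \<bar>((1 - u) * A + u * B) powr - a - A powr - a\<bar>)
      = (\<integral>\<^sup>+b. ennreal (k u b) \<partial>lborel)" if u: "0 < u" "u < 1" for u
  proof -
    define F where "F = (\<lambda>b. - ((1 - u) powr (a - 1) / u * ((1 - u) * A + u * b) powr - a))"
    have le: "min A B \<le> max A B" by simp
    have "(\<integral>\<^sup>+b. ennreal (k u b) \<partial>lborel) = (\<integral>\<^sup>+b. ennreal (k u b) * indicator {min A B..max A B} b \<partial>lborel)"
      by (intro nn_integral_cong) (auto simp: k_def I_def split: split_indicator)
    also have "\<dots> = ennreal (F (max A B) - F (min A B))"
    proof (rule nn_integral_FTC_Icc[OF _ _ k0 le])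
      show "(\<lambda>b. k u b) \<in> borel_measurable borel" unfolding k_def I_def by measurable
      fix b assume b: "b \<in> {min A B..max A B}"
      then have "0 < (1 - u) * A + u * b" using u pos Ipos unfolding I_def by blast
      then show "(F has_real_derivative k u b) (at b)"
        unfolding F_def k_def using u b
        by (intro DERIV_cong[OF DERIV_minus[OF DERIV_cmult[OF DERIV_fun_powr[where m = u]]]])
          (auto intro!: derivative_eq_intros simp: I_def)
    qed
    also have "F (max A B) - F (min A B) = (1 - u) powr (a - 1) / u * (((1 - u) * A + u * min A B) powr - a - ((1 - u) * A + u * max A B) powr - a)"
      by (simp add: F_def algebra_simps)
    also have "((1 - u) * A + u * min A B) powr - a - ((1 - u) * A + u * max A B) powr - a
       = \<bar>((1 - u) * A + u * B) powr - a - A powr - a\<bar>"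
    proof (cases "A \<le> B")
      case True
      have "A \<le> (1 - u) * A + u * B" using True u by (simp add: algebra_simps)
      then have "((1 - u) * A + u * B) powr - a \<le> A powr - a"
        using assms by (intro powr_mono2') auto
      then show ?thesis using True by (simp add: min_def max_def algebra_simps)
    next
      case False
      have "(1 - u) * A + u * B \<le> A" using False u by (simp add: algebra_simps)
      then have "((1 - u) * A + u * B) powr - a \<ge> A powr - a"
        using assms u pos[of u B] by (intro powr_mono2') auto
      then show ?thesis using False by (simp add: min_def max_def algebra_simps)
    qed
    finally show ?thesis by simp
  qed
  have outer: "(\<integral>\<^sup>+u. ennreal (k u b) \<partial>lborel) = ennreal (A powr - a / b) * indicator I b" for b
  proof (cases "b \<in> I")
    case True
    then have b: "0 < b" by (rule Ipos)
    define F where "F = (\<lambda>u. - ((1 - u) powr a * ((1 - u) * A + u * b) powr - a / b))"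
    have "(\<integral>\<^sup>+u. ennreal (k u b) \<partial>lborel) = (\<integral>\<^sup>+u\<in>{0<..<1}. ennreal (k u b) \<partial>lborel)"
      by (intro nn_integral_cong) (auto simp: k_def split: split_indicator)
    also have "\<dots> = (\<integral>\<^sup>+u\<in>{0<..<1}. ennreal (a * (1 - u) powr (a - 1) * ((1 - u) * A + u * b) powr (- a - 1)) \<partial>lborel)"
      using True by (intro nn_integral_cong) (auto simp: k_def split: split_indicator)
    also have "\<dots> = ennreal (0 - - (A powr - a / b))"
    proof (rule nn_integral_FTC_Ioo[where F = F])
      fix u :: real assume u: "0 < u" "u < 1"
      note p = pos[OF u b]
      have "(F has_real_derivative (a * (1 - u) powr (a - 1) * ((1 - u) * A + u * b) powr - a / b
          + (1 - u) powr a * (a * ((1 - u) * A + u * b) powr (- a - 1) * (b - A)) / b)) (at u)"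
        unfolding F_def using u p b
        by (intro DERIV_cong[OF DERIV_minus[OF DERIV_cdivide[OF
              DERIV_mult[OF DERIV_fun_powr[where m = "-1"] DERIV_fun_powr[where m = "b - A"]]]]])
          (auto intro!: derivative_eq_intros simp: diff_divide_distrib mult_ac)
      also have "(a * (1 - u) powr (a - 1) * ((1 - u) * A + u * b) powr - a / b
          + (1 - u) powr a * (a * ((1 - u) * A + u * b) powr (- a - 1) * (b - A)) / b)
        = a * (1 - u) powr (a - 1) * ((1 - u) * A + u * b) powr (- a - 1) * (((1 - u) * A + u * b) + (1 - u) * (b - A)) / b"
      proof -
        have 1: "((1 - u) * A + u * b) powr - a = ((1 - u) * A + u * b) powr (- a - 1) * ((1 - u) * A + u * b)"
          using powr_mult_base[of "(1 - u) * A + u * b" "- a - 1"] p by (simp add: mult.commute)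
        have 2: "(1 - u) powr a = (1 - u) powr (a - 1) * (1 - u)"
          using powr_mult_base[of "1 - u" "a - 1"] u by (simp add: mult.commute)
        show ?thesis unfolding 1 2 by algebra
      qed
      also have "\<dots> = a * (1 - u) powr (a - 1) * ((1 - u) * A + u * b) powr (- a - 1)"
        using b by (simp add: algebra_simps)
      finally show "(F has_real_derivative a * (1 - u) powr (a - 1) * ((1 - u) * A + u * b) powr (- a - 1)) (at u)" .
      show "isCont (\<lambda>u. a * (1 - u) powr (a - 1) * ((1 - u) * A + u * b) powr (- a - 1)) u"
        using u p by (intro continuous_intros) auto
    next
      have "(F \<longlongrightarrow> - ((1 - 1) powr a * ((1 - 1) * A + 1 * b) powr - a / b)) (at_left 1)"
        unfolding F_def using b assms by (intro tendsto_intros) (auto simp: eventually_at_filter)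
      then show "(F \<longlongrightarrow> 0) (at_left 1)" using assms by simp
      have "(F \<longlongrightarrow> - ((1 - 0) powr a * ((1 - 0) * A + 0 * b) powr - a / b)) (at_right 0)"
        unfolding F_def using b assms by (intro tendsto_intros) (auto simp: eventually_at_filter)
      then show "(F \<longlongrightarrow> - (A powr - a / b)) (at_right 0)" by simp
    qed (use assms in auto)
    finally show ?thesis using True by simp
  next
    case False
    then show ?thesis by (simp add: k_def)
  qed
  have "(\<integral>\<^sup>+u\<in>{0<..<1}. ennreal ((1 - u) powr (a - 1) / u * \<bar>((1 - u) * A + u * B) powr - a - A powr - a\<bar>) \<partial>lborel)
     = (\<integral>\<^sup>+u. \<integral>\<^sup>+b. ennreal (k u b) \<partial>lborel \<partial>lborel)"
  proof (intro nn_integral_cong)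
    fix u :: real
    show "ennreal ((1 - u) powr (a - 1) / u * \<bar>((1 - u) * A + u * B) powr - a - A powr - a\<bar>) * indicator {0<..<1} u
      = (\<integral>\<^sup>+b. ennreal (k u b) \<partial>lborel)"
    proof (cases "0 < u \<and> u < 1")
      case False
      then have "k u b = 0" for b by (auto simp: k_def)
      with False show ?thesis by simp
    qed (use inner in simp)
  qed
  also have "\<dots> = (\<integral>\<^sup>+b. \<integral>\<^sup>+u. ennreal (k u b) \<partial>lborel \<partial>lborel)"
  proof (rule lborel_pair.Fubini'[symmetric])
    have "(\<lambda>x. k (fst x) (snd x)) \<in> borel_measurable (borel \<Otimes>\<^sub>M borel)"
      unfolding k_def I_def by measurable
    then show "(\<lambda>(x, y). ennreal (k x y)) \<in> borel_measurable (lborel \<Otimes>\<^sub>M lborel)"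
      by (simp add: case_prod_beta')
  qed
  also have "\<dots> = (\<integral>\<^sup>+b. ennreal (A powr - a / \<bar>b\<bar>) * indicator {min A B..max A B} b \<partial>lborel)"
    unfolding outer using Ipos by (intro nn_integral_cong) (auto simp: I_def abs_of_pos split: split_indicator)
  also have "\<dots> = ennreal (A powr - a * ln (max A B) - A powr - a * ln (min A B))"
    by (rule nn_integral_FTC_Icc[where F = "\<lambda>b. A powr - a * ln b"])
       (use assms Ipos in \<open>auto simp: I_def abs_of_pos intro!: derivative_eq_intros divide_nonneg_pos\<close>)
  also have "A powr - a * ln (max A B) - A powr - a * ln (min A B) = A powr - a * \<bar>ln A - ln B\<bar>"
    using assms by (auto simp: max_def min_def algebra_simps abs_if)
  finally show ?thesis .
qed

lemma
  fixes a A B :: real assumes a: "0 < a" and A: "0 < A" and B: "0 < B"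
  shows set_integrable_log_kernel: "set_integrable lborel {0<..<1}
      (\<lambda>u. (1 - u) powr (a - 1) / u * \<bar>((1 - u) * A + u * B) powr - a - A powr - a\<bar>)"
    and set_integral_abs_log_kernel: "(LBINT u:{0<..<1}.
      (1 - u) powr (a - 1) / u * \<bar>((1 - u) * A + u * B) powr - a - A powr - a\<bar>) = A powr - a * \<bar>ln A - ln B\<bar>"
    and set_integral_log_kernel: "(LBINT u:{0<..<1}.
      (1 - u) powr (a - 1) / u * (((1 - u) * A + u * B) powr - a - A powr - a)) = A powr - a * (ln A - ln B)"
proof -
  let ?g = "\<lambda>u. (1 - u) powr (a - 1) / u * \<bar>((1 - u) * A + u * B) powr - a - A powr - a\<bar>"
  have "has_bochner_integral lborel (\<lambda>u. indicator {0<..<1} u *\<^sub>R ?g u) (A powr - a * \<bar>ln A - ln B\<bar>)"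
  proof (rule has_bochner_integral_nn_integral)
    have "(\<integral>\<^sup>+u. ennreal (indicator {0<..<1} u *\<^sub>R ?g u) \<partial>lborel) = (\<integral>\<^sup>+u\<in>{0<..<1}. ennreal (?g u) \<partial>lborel)"
      by (intro nn_integral_cong) (auto split: split_indicator)
    then show "(\<integral>\<^sup>+u. ennreal (indicator {0<..<1} u *\<^sub>R ?g u) \<partial>lborel) = ennreal (A powr - a * \<bar>ln A - ln B\<bar>)"
      using nn_integral_log_kernel[OF a A B] by simp
  qed (auto split: split_indicator)
  then show 1: "set_integrable lborel {0<..<1} ?g" and 2: "(LBINT u:{0<..<1}. ?g u) = A powr - a * \<bar>ln A - ln B\<bar>"
    by (auto simp: set_integrable_def set_lebesgue_integral_def has_bochner_integral_iff)
  show "(LBINT u:{0<..<1}. (1 - u) powr (a - 1) / u * (((1 - u) * A + u * B) powr - a - A powr - a)) = A powr - a * (ln A - ln B)"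
  proof (cases "A \<le> B")
    case True
    have "(LBINT u:{0<..<1}. (1 - u) powr (a - 1) / u * (((1 - u) * A + u * B) powr - a - A powr - a))
      = (LBINT u:{0<..<1}. - ?g u)"
    proof (intro set_lebesgue_integral_cong allI impI)
      fix u :: real assume "u \<in> {0<..<1}"
      then have "A \<le> (1 - u) * A + u * B" using True by (simp add: algebra_simps)
      then have "((1 - u) * A + u * B) powr - a \<le> A powr - a" using a A by (intro powr_mono2') auto
      then show "(1 - u) powr (a - 1) / u * (((1 - u) * A + u * B) powr - a - A powr - a) = - ?g u"
        by (simp add: algebra_simps)
    qed simp
    also have "\<dots> = - (A powr - a * \<bar>ln A - ln B\<bar>)"
      using 2 by (simp add: set_lebesgue_integral_def)
    finally show ?thesis using True A B by (simp add: algebra_simps)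
  next
    case False
    have "(LBINT u:{0<..<1}. (1 - u) powr (a - 1) / u * (((1 - u) * A + u * B) powr - a - A powr - a))
      = (LBINT u:{0<..<1}. ?g u)"
    proof (intro set_lebesgue_integral_cong allI impI)
      fix u :: real assume u: "u \<in> {0<..<1}"
      then have "(1 - u) * A + u * B \<le> A" using False by (simp add: algebra_simps)
      moreover have "0 < (1 - u) * A + u * B" using u A B by (intro add_pos_pos) auto
      ultimately have "((1 - u) * A + u * B) powr - a \<ge> A powr - a" using a by (intro powr_mono2') auto
      then show "(1 - u) powr (a - 1) / u * (((1 - u) * A + u * B) powr - a - A powr - a) = ?g u"
        by (simp add: algebra_simps)
    qed simp
    then show ?thesis using 2 False A B by simp
  qed
qed

lemma
  fixes z :: real assumes "0 \<le> z"
  shows set_integrable_frullani: "set_integrable lborel {0<..} (\<lambda>u. exp (- u) / u * (exp (- (z * u)) - 1))"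
    and set_integral_frullani: "(LBINT u:{0<..}. exp (- u) / u * (exp (- (z * u)) - 1)) = - ln (1 + z)"
proof -
  define k where "k = (\<lambda>u b. if 0 < u \<and> 0 \<le> b \<and> b \<le> z then exp (- (u * (1 + b))) else 0 :: real)"
  let ?g = "\<lambda>u. exp (- u) / u * (1 - exp (- (z * u)))"
  have "(\<integral>\<^sup>+u. ennreal (indicator {0<..} u *\<^sub>R ?g u) \<partial>lborel) = (\<integral>\<^sup>+u. \<integral>\<^sup>+b. ennreal (k u b) \<partial>lborel \<partial>lborel)"
  proof (intro nn_integral_cong)
    fix u :: real
    show "ennreal (indicator {0<..} u *\<^sub>R ?g u) = (\<integral>\<^sup>+b. ennreal (k u b) \<partial>lborel)"
    proof (cases "0 < u")
      case True
      have "(\<integral>\<^sup>+b. ennreal (k u b) \<partial>lborel) = (\<integral>\<^sup>+b. ennreal (exp (- (u * (1 + b)))) * indicator {0..z} b \<partial>lborel)"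
        using True by (intro nn_integral_cong) (auto simp: k_def split: split_indicator)
      also have "\<dots> = ennreal (- (exp (- (u * (1 + z))) / u) - - (exp (- (u * (1 + 0))) / u))"
        by (rule nn_integral_FTC_Icc) (use True assms in \<open>auto intro!: derivative_eq_intros\<close>)
      also have "- (exp (- (u * (1 + z))) / u) - - (exp (- (u * (1 + 0))) / u) = ?g u"
        using True by (simp add: field_simps exp_add[symmetric])
      finally show ?thesis using True by simp
    qed (simp add: k_def)
  qed
  also have "\<dots> = (\<integral>\<^sup>+b. \<integral>\<^sup>+u. ennreal (k u b) \<partial>lborel \<partial>lborel)"
  proof (rule lborel_pair.Fubini'[symmetric])
    have "(\<lambda>x. k (fst x) (snd x)) \<in> borel_measurable (borel \<Otimes>\<^sub>M borel)"
      unfolding k_def by measurable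
    then show "(\<lambda>(x, y). ennreal (k x y)) \<in> borel_measurable (lborel \<Otimes>\<^sub>M lborel)"
      by (simp add: case_prod_beta')
  qed
  also have "\<dots> = (\<integral>\<^sup>+b. ennreal (1 / \<bar>1 + b\<bar>) * indicator {0..z} b \<partial>lborel)"
  proof (intro nn_integral_cong)
    fix b :: real
    show "(\<integral>\<^sup>+u. ennreal (k u b) \<partial>lborel) = ennreal (1 / \<bar>1 + b\<bar>) * indicator {0..z} b"
    proof (cases "0 \<le> b \<and> b \<le> z")
      case True
      have "(\<integral>\<^sup>+u. ennreal (k u b) \<partial>lborel) = (\<integral>\<^sup>+u. ennreal (exp (- (u * (1 + b)))) * indicator {0..} u \<partial>lborel)"
        using True by (intro nn_integral_cong_AE AE_mp[OF AE_lborel_singleton[of 0] AE_I2])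
          (auto simp: k_def split: split_indicator)
      also have "\<dots> = ennreal (0 - - (exp (- (0 * (1 + b))) / (1 + b)))"
      proof (rule nn_integral_FTC_atLeast)
        have "((\<lambda>x. - (exp (- (x * (1 + b))) / (1 + b))) \<longlongrightarrow> - (0 / (1 + b))) at_top"
          using True by (intro tendsto_intros filterlim_compose[OF exp_at_bot]
              filterlim_compose[OF filterlim_uminus_at_bot_at_top] filterlim_at_top_mult_tendsto_pos[OF tendsto_const] filterlim_ident) auto
        then show "((\<lambda>x. - (exp (- (x * (1 + b))) / (1 + b))) \<longlongrightarrow> 0) at_top" by simp
        show "((\<lambda>x. - (exp (- (x * (1 + b))) / (1 + b))) has_real_derivative exp (- (u * (1 + b)))) (at u)" for u
        proof -
          have "((\<lambda>x. - (exp (- (x * d)) / d)) has_real_derivative exp (- (u * d))) (at u)" if "0 < d" for d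
            using that by (auto intro!: derivative_eq_intros)
          from this[of "1 + b"] show ?thesis using True by simp
        qed
      qed (use True in auto)
      finally show ?thesis using True by simp
    next
      case False
      then have "k u b = 0" for u by (auto simp: k_def)
      with False show ?thesis by (simp add: indicator_def)
    qed
  qed
  also have "\<dots> = ennreal (ln (1 + z) - ln (1 + 0))"
    by (rule nn_integral_FTC_Icc[where F = "\<lambda>b. ln (1 + b)"]) (use assms in \<open>auto intro!: derivative_eq_intros\<close>)
  finally have "(\<integral>\<^sup>+u. ennreal (indicator {0<..} u *\<^sub>R ?g u) \<partial>lborel) = ennreal (ln (1 + z))" by simp
  then have "has_bochner_integral lborel (\<lambda>u. indicator {0<..} u *\<^sub>R ?g u) (ln (1 + z))"
    using assms by (intro has_bochner_integral_nn_integral) (auto split: split_indicator)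
  then have "has_bochner_integral lborel (\<lambda>u. - (indicator {0<..} u *\<^sub>R ?g u)) (- ln (1 + z))"
    by (rule has_bochner_integral_minus)
  moreover have "(\<lambda>u. - (indicator {0<..} u *\<^sub>R ?g u)) = (\<lambda>u. indicator {0<..} u *\<^sub>R (exp (- u) / u * (exp (- (z * u)) - 1)))"
    by (auto simp: fun_eq_iff algebra_simps split: split_indicator)
  ultimately have "has_bochner_integral lborel (\<lambda>u. indicator {0<..} u *\<^sub>R (exp (- u) / u * (exp (- (z * u)) - 1))) (- ln (1 + z))"
    by (simp only:)
  then show "set_integrable lborel {0<..} (\<lambda>u. exp (- u) / u * (exp (- (z * u)) - 1))"
    "(LBINT u:{0<..}. exp (- u) / u * (exp (- (z * u)) - 1)) = - ln (1 + z)"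
    by (auto simp: set_integrable_def set_lebesgue_integral_def has_bochner_integral_iff)
qed

lemma set_integral_log_antisymmetric:
  fixes a l r c :: real assumes "0 \<le> l" "0 < c"
  shows "(LBINT x:{l<..<r}. (x - l) powr (a - 1) * (r - x) powr (a - 1) * (1 + c * x) powr - a *
      (2 * ln (1 + c * x) - ln (1 + c * l) - ln (1 + c * r))) = 0"
proof (cases "l < r")
  case True
  define A where "A = 1 + c * l"
  define B where "B = 1 + c * r"
  define f where "f = (\<lambda>x. (x - l) powr (a - 1) * (r - x) powr (a - 1) * (1 + c * x) powr - a *
      (2 * ln (1 + c * x) - ln A - ln B))"
  define g where "g = (\<lambda>x. (A * B / (1 + c * x) - 1) / c)"
  have A: "0 < A" and B: "0 < B" using assms True by (auto simp: A_def B_def intro!: add_pos_nonneg)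
  have pos: "0 < 1 + c * x" if "l < x" for x using that assms by (intro add_pos_nonneg) auto
  have gg: "1 + c * g x = A * B / (1 + c * x)" for x
    using assms by (simp add: g_def)
  have gl: "g x - l = A * (r - x) / (1 + c * x)" and gr: "r - g x = B * (x - l) / (1 + c * x)"
    if "l < x" for x
  proof -
    have "c * (g x - l) = A * B / (1 + c * x) - A"
      using gg[of x] by (simp add: A_def algebra_simps)
    also have "\<dots> = A * (B - (1 + c * x)) / (1 + c * x)"
      using pos[OF that] by (simp add: right_diff_distrib diff_divide_distrib)
    also have "\<dots> = c * (A * (r - x) / (1 + c * x))"
      by (simp add: B_def right_diff_distrib mult_ac)
    finally show "g x - l = A * (r - x) / (1 + c * x)"
      using assms by (metis mult_left_cancel less_irrefl)
    have "c * (r - g x) = B - A * B / (1 + c * x)"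
      using gg[of x] by (simp add: B_def algebra_simps)
    also have "\<dots> = B * ((1 + c * x) - A) / (1 + c * x)"
      using pos[OF that] by (simp add: right_diff_distrib diff_divide_distrib)
    also have "\<dots> = c * (B * (x - l) / (1 + c * x))"
      by (simp add: A_def right_diff_distrib mult_ac)
    finally show "r - g x = B * (x - l) / (1 + c * x)"
      using assms by (metis mult_left_cancel less_irrefl)
  qed
  have g_in: "g x \<in> {l<..<r}" if "x \<in> {l<..<r}" for x
  proof -
    have "0 < A * (r - x) / (1 + c * x)" "0 < B * (x - l) / (1 + c * x)"
      using that pos[of x] A B by auto
    then show ?thesis using gl[of x] gr[of x] that by auto
  qed
  have inv: "g (g x) = x" if "l < x" for x
  proof -
    have "g (g x) = (A * B / (A * B / (1 + c * x)) - 1) / c"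
      by (subst g_def) (simp only: gg)
    also have "\<dots> = x" using A B pos[OF that] assms by (simp add: field_simps)
    finally show ?thesis .
  qed
  have im: "g ` {l<..<r} = {l<..<r}"
    using g_in inv by (auto simp: image_iff) (metis greaterThanLessThan_iff)
  have inj: "inj_on g {l<..<r}" by (rule inj_onI) (metis inv greaterThanLessThan_iff)
  have anti: "\<bar>- (A * B * c / (1 + c * x)\<^sup>2 / c)\<bar> * f (g x) = - f x" if x: "x \<in> {l<..<r}" for x
  proof -
    define y where "y = 1 + c * x"
    have y: "0 < y" using pos[of x] x by (simp add: y_def)
    have xs: "0 < x - l" "0 < r - x" using x by auto
    have "f (g x) = (A * (r - x) / y) powr (a - 1) * (B * (x - l) / y) powr (a - 1) * (A * B / y) powr - a *
      (2 * ln (A * B / y) - ln A - ln B)"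
      using x by (simp add: f_def gl gr gg y_def)
    also have "2 * ln (A * B / y) - ln A - ln B = - (2 * ln y - ln A - ln B)"
      using A B y by (simp add: ln_mult ln_div)
    also have "(A * (r - x) / y) powr (a - 1) * (B * (x - l) / y) powr (a - 1) * (A * B / y) powr - a
        = ((x - l) powr (a - 1) * (r - x) powr (a - 1) * y powr - a) * (y\<^sup>2 / (A * B))"
    proof -
      have "(A * q / y) powr (a - 1) * (B * p / y) powr (a - 1) * (A * B / y) powr - a
        = (p powr (a - 1) * q powr (a - 1) * y powr - a) * (y\<^sup>2 / (A * B))" if "0 < p" "0 < q" for p q
        using A B y that
        by (simp add: powr_mult powr_divide powr_diff powr_minus field_simps power2_eq_square)
      from this[OF xs] show ?thesis .
    qed
    finally have "f (g x) = (x - l) powr (a - 1) * (r - x) powr (a - 1) * y powr - a * (y\<^sup>2 / (A * B)) *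
        - (2 * ln y - ln A - ln B)" .
    also have "\<dots> = - (y\<^sup>2 / (A * B)) * f x"
      unfolding f_def y_def[symmetric] by (simp only: mult_ac mult_minus_left mult_minus_right)
    finally have "f (g x) = - (y\<^sup>2 / (A * B)) * f x" .
    moreover have "\<bar>- (A * B * c / y\<^sup>2 / c)\<bar> = A * B / y\<^sup>2"
      using A B assms by simp
    ultimately show ?thesis using A B y by (simp add: y_def[symmetric])
  qed
  have "(LBINT x:{l<..<r}. f x) = 0"
  proof (cases "set_integrable lborel {l<..<r} f")
    case int: True
    then have abs: "f absolutely_integrable_on {l<..<r}"
      unfolding set_integrable_def by (subst integrable_completion) auto
    have eq: "(LBINT x:{l<..<r}. f x) = integral {l<..<r} f"
      by (rule set_borel_integral_eq_integral(2)[OF int])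
    have "integral {l<..<r} (\<lambda>x. \<bar>- (A * B * c / (1 + c * x)\<^sup>2 / c)\<bar> * f (g x)) = integral {l<..<r} f"
    proof (rule conjunct2[OF iffD2[OF has_absolute_integral_change_of_variables_1'[where g = g]]])
      show "(g has_real_derivative - (A * B * c / (1 + c * x)\<^sup>2 / c)) (at x within {l<..<r})"
        if "x \<in> {l<..<r}" for x
        unfolding g_def using pos[of x] that assms
        by (auto intro!: derivative_eq_intros simp: power2_eq_square)
    qed (use abs inj in \<open>auto simp: im\<close>)
    also have "integral {l<..<r} (\<lambda>x. \<bar>- (A * B * c / (1 + c * x)\<^sup>2 / c)\<bar> * f (g x)) = integral {l<..<r} (\<lambda>x. - f x)"
      by (rule integral_cong) (rule anti)
    finally show ?thesis using eq by simp
  next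
    case False
    then show ?thesis by (simp add: set_lebesgue_integral_def set_integrable_def not_integrable_integral_eq)
  qed
  then show ?thesis by (simp add: f_def A_def B_def)
qed (simp add: set_lebesgue_integral_def)

section \<open>A maximum principle for the hidden generator\<close>

definition jump_integral :: "real \<Rightarrow> ((nat \<Rightarrow> real) \<Rightarrow> real) \<Rightarrow> (nat \<Rightarrow> real) \<Rightarrow> nat \<Rightarrow> real \<Rightarrow> real" where
  "jump_integral a f x i v =
     (LBINT u:{0<..<1}. (1 - u) powr (a - 1) / u * (f (x(i := x i - u * x i + u * v)) - f x))"

definition jump_integrable :: "real \<Rightarrow> ((nat \<Rightarrow> real) \<Rightarrow> real) \<Rightarrow> (nat \<Rightarrow> real) \<Rightarrow> nat \<Rightarrow> real \<Rightarrow> bool" where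
  "jump_integrable a f x i v \<longleftrightarrow> set_integrable lborel {0<..<1}
     (\<lambda>u. (1 - u) powr (a - 1) / u * (f (x(i := x i - u * x i + u * v)) - f x))"

definition boundary :: "nat \<Rightarrow> real \<Rightarrow> real \<Rightarrow> (nat \<Rightarrow> real) \<Rightarrow> nat \<Rightarrow> real" where
  "boundary N l r x = x(0 := l, N + 1 := r)"

abbreviation jumps_integrable ::
    "real \<Rightarrow> nat \<Rightarrow> real \<Rightarrow> real \<Rightarrow> ((nat \<Rightarrow> real) \<Rightarrow> real) \<Rightarrow> (nat \<Rightarrow> real) \<Rightarrow> bool" where
  "jumps_integrable a N l r f x \<equiv> (\<forall>i\<in>{1..N}.
     jump_integrable a f x i (boundary N l r x (i - 1)) \<and> jump_integrable a f x i (boundary N l r x (i + 1)))"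

lemma hidden_generator_eq_sum:
  assumes N: "1 \<le> N" and int: "jumps_integrable (2 * s) N l r f x"
  shows "hidden_generator s N l r f x = (\<Sum>i=1..N. jump_integral (2 * s) f x i (boundary N l r x (i - 1))
     + jump_integral (2 * s) f x i (boundary N l r x (i + 1)))"
proof -
  let ?J = "jump_integral (2 * s) f x" and ?b = "boundary N l r x"
  have bulk: "(LBINT u:{0<..<1}. (1 - u) powr (2 * s - 1) / u *
        (f (x(i := x i - u * x i + u * x (i+1))) + f (x(i+1 := x (i+1) - u * x (i+1) + u * x i)) - 2 * f x))
      = ?J (i + 1) (?b i) + ?J i (?b (i + 1))" if "i \<in> {1..<N}" for i
  proof -
    have 1: "jump_integrable (2 * s) f x i (x (i + 1))" "jump_integrable (2 * s) f x (i + 1) (x i)"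
      using bspec[OF int, of i] bspec[OF int, of "i + 1"] that by (auto simp: boundary_def)
    show ?thesis
      using set_integral_add(2)[OF 1[unfolded jump_integrable_def]] that
      by (simp add: jump_integral_def boundary_def algebra_simps)
  qed
  have "hidden_generator s N l r f x
      = ?J 1 (?b 0) + (\<Sum>i=1..<N. ?J (i + 1) (?b i) + ?J i (?b (i + 1))) + ?J N (?b (N + 1))"
    unfolding hidden_generator_def using bulk
    by (simp add: jump_integral_def boundary_def)
  also have "\<dots> = (?J 1 (?b 0) + (\<Sum>i=1..<N. ?J (i + 1) (?b i))) + ((\<Sum>i=1..<N. ?J i (?b (i + 1))) + ?J N (?b (N + 1)))"
    by (simp add: sum.distrib)
  also have "(\<Sum>i=1..<N. ?J i (?b (i + 1))) + ?J N (?b (N + 1)) = (\<Sum>i=1..N. ?J i (?b (i + 1)))"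
    using N by (simp add: sum.last_plus add.commute)
  also have "?J 1 (?b 0) + (\<Sum>i=1..<N. ?J (i + 1) (?b i)) = (\<Sum>i=1..N. ?J i (?b (i - 1)))"
    using N sum.shift_bounds_Suc_ivl[of "\<lambda>i. ?J i (?b (i - 1))" 1 N]
    by (simp add: sum.atLeast_Suc_atMost atLeastLessThanSuc_atLeastAtMost)
  finally show ?thesis by (simp add: sum.distrib)
qed

lemma sum_weighted_laplacian:
  fixes x :: "nat \<Rightarrow> real"
  shows "(\<Sum>i=1..N. real i * (real N + 1 - real i) *
      (boundary N 0 0 x (i - 1) + boundary N 0 0 x (i + 1) - 2 * x i)) = - 2 * (\<Sum>i=1..N. x i)"
proof -
  define w where "w = (\<lambda>i. real i * (real N + 1 - real i))"
  let ?b = "boundary N 0 0 x"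
  have b0: "?b 0 = 0" "?b (Suc N) = 0" and bi: "i \<in> {1..N} \<Longrightarrow> ?b i = x i" for i
    by (auto simp: boundary_def)
  have w0: "w 0 = 0" "w (Suc N) = 0" by (auto simp: w_def)
  have "(\<Sum>i=1..N. w i * ?b (i - 1)) = (\<Sum>k<N. w (Suc k) * ?b k)"
    by (simp add: sum.atLeast1_atMost_eq)
  also have "\<dots> = (\<Sum>k<Suc N. w (Suc k) * ?b k)" by (simp add: w0)
  also have "\<dots> = (\<Sum>k<N. w (Suc (Suc k)) * ?b (Suc k))" by (subst sum.lessThan_Suc_shift) (simp add: b0)
  also have "\<dots> = (\<Sum>i=1..N. w (i + 1) * ?b i)" by (simp add: sum.atLeast1_atMost_eq)
  finally have 1: "(\<Sum>i=1..N. w i * ?b (i - 1)) = (\<Sum>i=1..N. w (i + 1) * x i)" by (simp add: bi)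
  have "(\<Sum>i=1..N. w i * ?b (i + 1)) = (\<Sum>k<N. w (Suc k) * ?b (Suc (Suc k)))"
    by (simp add: sum.atLeast1_atMost_eq)
  also have "\<dots> = (\<Sum>k<Suc N. w k * ?b (Suc k))" by (subst sum.lessThan_Suc_shift) (simp add: w0)
  also have "\<dots> = (\<Sum>k<N. w k * ?b (Suc k))" by (simp add: b0)
  also have "\<dots> = (\<Sum>i=1..N. w (i - 1) * ?b i)" by (simp add: sum.atLeast1_atMost_eq)
  finally have 2: "(\<Sum>i=1..N. w i * ?b (i + 1)) = (\<Sum>i=1..N. w (i - 1) * x i)" by (simp add: bi)
  have "(\<Sum>i=1..N. w i * (?b (i - 1) + ?b (i + 1) - 2 * x i)) =
     (\<Sum>i=1..N. w i * ?b (i - 1)) + (\<Sum>i=1..N. w i * ?b (i + 1)) - (\<Sum>i=1..N. 2 * w i * x i)"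
    by (simp add: sum.distrib[symmetric] sum_subtractf[symmetric] algebra_simps)
  also have "\<dots> = (\<Sum>i=1..N. (w (i + 1) + w (i - 1) - 2 * w i) * x i)"
    unfolding 1 2 by (simp add: sum.distrib[symmetric] sum_subtractf[symmetric] algebra_simps)
  also have "\<dots> = (\<Sum>i=1..N. - 2 * x i)"
  proof (rule sum.cong[OF refl])
    fix i assume "i \<in> {1..N}"
    then have "w (i + 1) + w (i - 1) - 2 * w i = - 2"
      by (cases i) (auto simp: w_def algebra_simps)
    then show "(w (i + 1) + w (i - 1) - 2 * w i) * x i = - 2 * x i" by simp
  qed
  finally show ?thesis by (simp add: w_def sum_distrib_left)
qed

lemma neg_ln_one_minus_le:
  fixes u b :: real assumes "0 < u" "u < 1" "0 < b" "b \<le> 1"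
  shows "- ln (1 - u) \<le> u * (1 - u) powr - b / b"
proof -
  have "b * - ln (1 - u) = ln ((1 - u) powr - b)" using assms by (simp add: ln_powr)
  also have "\<dots> \<le> (1 - u) powr - b - 1" using assms by (intro ln_le_minus_one) auto
  also have "\<dots> \<le> u * (1 - u) powr - b"
  proof -
    have "(1 - u) * (1 - u) powr - b = (1 - u) powr (1 - b)"
      using powr_mult_base[of "1 - u" "- b"] assms by simp
    also have "\<dots> \<le> 1" using assms by (intro powr_le1) auto
    finally show ?thesis by (simp add: algebra_simps)
  qed
  finally show ?thesis using assms by (simp add: field_simps)
qed

lemma compact_PiE_Icc:
  fixes a b :: real
  shows "compact (PiE I (\<lambda>_. {a..b}) :: ('i \<Rightarrow> real) set)"
proof -
  have "PiE I (\<lambda>_. {a..b}) = PiE UNIV (\<lambda>i. if i \<in> I then {a..b} else {undefined})"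
    by (auto simp: PiE_iff extensional_def split: if_splits)
  moreover have "compactin (product_topology (\<lambda>i. euclidean) UNIV) (PiE UNIV (\<lambda>i. if i \<in> I then {a..b} else {undefined :: real}))"
    by (subst compactin_PiE) auto
  ultimately show ?thesis
    by (simp add: euclidean_product_topology)
qed

lemma continuous_on_coordinate [continuous_intros]: "continuous_on S (\<lambda>x. x i)"
  by (rule continuous_on_product_coordinates[THEN continuous_on_subset]) simp

lemma continuous_on_update:
  assumes "continuous_on S g"
  shows "continuous_on S (\<lambda>u. x(i := g u))"
proof (rule continuous_on_coordinatewise_then_product)
  fix j show "continuous_on S (\<lambda>u. (x(i := g u)) j)"
    using assms by (cases "j = i") auto
qed

lemma jump_config:
  assumes "x \<in> configs N" "i \<in> {1..N}" "0 \<le> v" "0 < u" "u < 1"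
  shows "x(i := x i - u * x i + u * v) \<in> configs N"
proof -
  have "0 \<le> x i" using assms by (auto simp: PiE_iff)
  then have "0 \<le> (1 - u) * x i + u * v" using assms by simp
  then show ?thesis using assms by (auto simp: PiE_iff extensional_def algebra_simps)
qed

lemma borel_measurable_jump:
  fixes D :: "(nat \<Rightarrow> real) \<Rightarrow> real"
  assumes "continuous_on (configs N) D" "x \<in> configs N" "i \<in> {1..N}" "0 \<le> v"
  shows "(\<lambda>u. D (x(i := x i - u * x i + u * v)) - D x) \<in> borel_measurable (restrict_space borel {0<..<1})"
proof (rule borel_measurable_continuous_on_restrict)
  show "continuous_on {0<..<1} (\<lambda>u. D (x(i := x i - u * x i + u * v)) - D x)"
  proof (intro continuous_on_diff continuous_on_const)
    show "continuous_on {0<..<1} (\<lambda>u. D (x(i := x i - u * x i + u * v)))"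
    proof (rule continuous_on_compose2[OF assms(1)])
      show "continuous_on {0<..<1} (\<lambda>u. x(i := x i - u * x i + u * v))"
        by (intro continuous_on_update continuous_intros)
      show "(\<lambda>u. x(i := x i - u * x i + u * v)) ` {0<..<1} \<subseteq> configs N"
        using jump_config[OF assms(2-4)] by (intro image_subsetI) auto
    qed
  qed
qed

text \<open>
  The maximum of \<open>D - \<eta> W + \<epsilon> \<Sum> ln x\<^sub>i\<close> is attained in the interior; \<open>W\<close> is strictly superharmonic
  away from the origin, and the logarithms cost only \<open>O(\<epsilon>)\<close>.
\<close>

lemma hidden_maximum_principle:
  fixes D :: "(nat \<Rightarrow> real) \<Rightarrow> real"
  assumes s: "0 < s" and N: "1 \<le> N"
    and cont: "continuous_on (configs N) D" and D0: "D (\<lambda>i\<in>{1..N}. 0) = 0"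
    and lip: "\<And>x i v. x \<in> configs N \<Longrightarrow> \<forall>j\<in>{1..N}. 0 < x j \<Longrightarrow> i \<in> {1..N} \<Longrightarrow> 0 \<le> v \<Longrightarrow>
      \<exists>K. \<forall>u\<in>{0<..<1}. \<bar>D (x(i := x i - u * x i + u * v)) - D x\<bar> \<le> K * u"
    and gen: "\<And>x. x \<in> configs N \<Longrightarrow> \<forall>j\<in>{1..N}. 0 < x j \<Longrightarrow> 0 < D x \<Longrightarrow> 0 \<le> hidden_generator s N 0 0 D x"
    and x0: "x0 \<in> configs N" "\<forall>j\<in>{1..N}. 0 < x0 j"
  shows "D x0 \<le> 0"
proof (rule ccontr)
  assume "\<not> D x0 \<le> 0"
  define d where "d = D x0"
  have d: "0 < d" using \<open>\<not> D x0 \<le> 0\<close> by (simp add: d_def)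
  define a where "a = 2 * s"
  have a: "0 < a" using s by (simp add: a_def)
  define M where "M = (\<Sum>j=1..N. x0 j)"
  define box where "box = (PiE {1..N} (\<lambda>_. {0..M}) :: (nat \<Rightarrow> real) set)"
  have x0M: "x0 j \<le> M" if "j \<in> {1..N}" for j
    unfolding M_def using x0 that by (intro member_le_sum) (auto intro: less_imp_le)
  have M: "0 < M" using x0M[of 1] x0 N by force
  have box: "compact box" "box \<subseteq> configs N"
    unfolding box_def by (rule compact_PiE_Icc) (auto simp: PiE_iff)
  have x0box: "x0 \<in> box" using x0 x0M by (auto simp: box_def PiE_iff less_imp_le)
  define w where "w = (\<lambda>i. real i * (real N + 1 - real i))"
  have w: "0 \<le> w i" if "i \<in> {1..N}" for i using that by (simp add: w_def)
  define W where "W = (\<lambda>x. \<Sum>i=1..N. w i * x i)"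
  have W: "0 \<le> W x" if "x \<in> box" for x
    unfolding W_def using that w by (intro sum_nonneg mult_nonneg_nonneg) (auto simp: box_def PiE_iff)
  have Wc: "continuous_on S W" for S unfolding W_def by (intro continuous_intros)
  define \<eta> where "\<eta> = d / (4 * (W x0 + 1))"
  have \<eta>: "0 < \<eta>" "\<eta> * W x0 \<le> d / 4"
    using d W[OF x0box] by (auto simp: \<eta>_def field_simps)
  obtain r where r: "0 < r" "\<And>x. x \<in> box \<Longrightarrow> d / 2 \<le> D x \<Longrightarrow> r \<le> (\<Sum>i=1..N. x i)"
  proof -
    define C where "C = {x \<in> box. d / 2 \<le> D x}"
    have "closed C" unfolding C_def
      using continuous_on_subset[OF cont box(2)] compact_imp_closed[OF box(1)]
      by (intro continuous_on_closed_Collect_le continuous_on_const) auto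
    then have "compact C" using compact_Int_closed[OF box(1), of C] by (auto simp: C_def Int_absorb1 Collect_mono_iff)
    moreover have "x0 \<in> C" using x0box d by (simp add: C_def d_def)
    moreover have "continuous_on C (\<lambda>x. \<Sum>i=1..N. x i)" by (intro continuous_intros)
    ultimately obtain y where y: "y \<in> C" "\<And>x. x \<in> C \<Longrightarrow> (\<Sum>i=1..N. y i) \<le> (\<Sum>i=1..N. x i)"
      using continuous_attains_inf[of C "\<lambda>x. \<Sum>i=1..N. x i"] by auto
    have nn: "\<forall>i\<in>{1..N}. 0 \<le> y i" using y(1) by (auto simp: C_def box_def PiE_iff)
    have "(\<Sum>i=1..N. y i) \<noteq> 0"
    proof
      assume "(\<Sum>i=1..N. y i) = 0"
      then have "\<forall>i\<in>{1..N}. y i = 0" using nn by (subst (asm) sum_nonneg_eq_0_iff) auto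
      then have "y = (\<lambda>i\<in>{1..N}. 0)" using y(1) by (auto simp: C_def box_def PiE_iff extensional_def fun_eq_iff)
      then show False using y(1) d D0 by (simp add: C_def)
    qed
    moreover have "0 \<le> (\<Sum>i=1..N. y i)" using nn by (intro sum_nonneg) auto
    ultimately show ?thesis using y(2) by (intro that[of "\<Sum>i=1..N. y i"]) (auto simp: C_def)
  qed
  define b where "b = min 1 (a / 2)"
  have b: "0 < b" "b \<le> 1" "b < a" using a by (auto simp: b_def)
  define c where "c = 1 / (b * (a - b))"
  have c: "0 < c" using b by (simp add: c_def)
  define L where "L = (\<Sum>i=1..N. ln M - ln (x0 i))"
  define \<epsilon> where "\<epsilon> = min (d / (4 * (\<bar>L\<bar> + 1))) (\<eta> * r / a / (2 * N * c))"
  have Nc: "0 < 2 * real N * c" using N c by simp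
  have \<epsilon>: "0 < \<epsilon>" using d \<eta> r a Nc by (simp add: \<epsilon>_def)
  have \<epsilon>L: "\<epsilon> * L \<le> d / 4"
  proof -
    have "\<epsilon> * L \<le> \<epsilon> * (\<bar>L\<bar> + 1)" using \<epsilon> by (intro mult_left_mono) auto
    also have "\<dots> \<le> d / (4 * (\<bar>L\<bar> + 1)) * (\<bar>L\<bar> + 1)"
      by (intro mult_right_mono) (auto simp: \<epsilon>_def)
    also have "\<dots> = d / 4" by (simp add: field_simps)
    finally show ?thesis .
  qed
  have \<epsilon>c: "2 * real N * c * \<epsilon> \<le> \<eta> * r / a"
  proof -
    have "2 * real N * c * \<epsilon> \<le> 2 * real N * c * (\<eta> * r / a / (2 * real N * c))"
      using Nc by (intro mult_left_mono) (auto simp: \<epsilon>_def)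
    also have "\<dots> = \<eta> * r / a" using N c by simp
    finally show ?thesis .
  qed
  define F where "F = (\<lambda>x. exp ((D x - \<eta> * W x) / \<epsilon>) * (\<Prod>i=1..N. x i))"
  have "continuous_on box F"
    unfolding F_def using continuous_on_subset[OF cont box(2)] \<epsilon> by (intro continuous_intros Wc) auto
  then obtain z where z: "z \<in> box" "\<And>x. x \<in> box \<Longrightarrow> F x \<le> F z"
    using continuous_attains_sup[OF box(1), of F] x0box by auto
  have zc: "z \<in> configs N" using z box by auto
  have zM: "z i \<le> M" if "i \<in> {1..N}" for i using z(1) that by (auto simp: box_def PiE_iff)
  have zpos: "0 < z j" if "j \<in> {1..N}" for j
  proof (rule ccontr)
    assume "\<not> 0 < z j"
    then have "z j = 0" using z(1) that by (auto simp: box_def PiE_iff intro: antisym)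
    then have "F z = 0" using that by (auto simp: F_def)
    moreover have "0 < F x0" using x0(2) unfolding F_def by (intro mult_pos_pos prod_pos) auto
    ultimately show False using z(2)[OF x0box] by simp
  qed
  have max: "D y - D z \<le> \<eta> * (W y - W z) + \<epsilon> * (\<Sum>i=1..N. ln (z i) - ln (y i))"
    if y: "y \<in> box" "\<forall>j\<in>{1..N}. 0 < y j" for y
  proof -
    have lnF: "ln (F x) = (D x - \<eta> * W x) / \<epsilon> + (\<Sum>i=1..N. ln (x i))" if "\<forall>j\<in>{1..N}. 0 < x j" for x
      unfolding F_def using that prod_pos[of "{1..N}" x] by (subst ln_mult_pos) (auto intro!: ln_prod)
    have Fpos: "0 < F x" if "\<forall>j\<in>{1..N}. 0 < x j" for x
      unfolding F_def using that by (intro mult_pos_pos prod_pos) auto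
    have "ln (F y) \<le> ln (F z)"
      using z(2)[OF y(1)] Fpos[OF y(2)] by simp
    then have "(D y - \<eta> * W y) / \<epsilon> - (D z - \<eta> * W z) / \<epsilon> \<le> (\<Sum>i=1..N. ln (z i) - ln (y i))"
      using lnF[OF y(2)] lnF[of z] zpos by (simp add: sum_subtractf)
    then have "\<epsilon> * ((D y - \<eta> * W y) / \<epsilon> - (D z - \<eta> * W z) / \<epsilon>) \<le> \<epsilon> * (\<Sum>i=1..N. ln (z i) - ln (y i))"
      using \<epsilon> by (intro mult_left_mono) auto
    also have "\<epsilon> * ((D y - \<eta> * W y) / \<epsilon> - (D z - \<eta> * W z) / \<epsilon>) = (D y - \<eta> * W y) - (D z - \<eta> * W z)"
      using \<epsilon> by (simp flip: diff_divide_distrib)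
    finally show ?thesis by (simp add: algebra_simps)
  qed
  have Dz: "d / 2 \<le> D z"
  proof -
    have "d - D z \<le> \<eta> * (W x0 - W z) + \<epsilon> * (\<Sum>i=1..N. ln (z i) - ln (x0 i))"
      using max[OF x0box x0(2)] by (simp add: d_def)
    also have "\<dots> \<le> \<eta> * W x0 + \<epsilon> * L"
      unfolding L_def using \<eta> \<epsilon> W[OF z(1)] zM zpos
      by (intro add_mono mult_left_mono sum_mono diff_right_mono) (auto simp: ln_le_cancel_iff[OF _ M])
    finally show ?thesis using \<eta>(2) \<epsilon>L by simp
  qed
  have J: "jump_integrable a D z i v"
      "jump_integral a D z i v \<le> \<eta> / a * (w i * (v - z i)) + \<epsilon> * c"
    if i: "i \<in> {1..N}" and v: "0 \<le> v" "v \<le> M" for i v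
  proof -
    obtain K where K: "\<And>u. u \<in> {0<..<1} \<Longrightarrow> \<bar>D (z(i := z i - u * z i + u * v)) - D z\<bar> \<le> K * u"
      using lip[OF zc _ i v(1)] zpos by blast
    show int: "jump_integrable a D z i v"
      unfolding jump_integrable_def
      by (rule set_integrable_rate(1)[OF a borel_measurable_jump[OF cont zc i v(1)]]) (use K in auto)
    define h where "h = (\<lambda>u. \<eta> * w i * (v - z i) * (1 - u) powr (a - 1) + \<epsilon> / b * (1 - u) powr (a - b - 1))"
    have hi: "set_integrable lborel {0<..<1} (\<lambda>u. \<eta> * w i * (v - z i) * (1 - u) powr (a - 1))"
      "set_integrable lborel {0<..<1} (\<lambda>u. \<epsilon> / b * (1 - u) powr (a - b - 1))"
      using set_integrable_one_minus_powr[OF a] set_integrable_one_minus_powr[of "a - b"] b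
      by (auto intro!: set_integrable_mult_right)
    have "jump_integral a D z i v \<le> (LBINT u:{0<..<1}. h u)"
      unfolding jump_integral_def
    proof (rule set_integral_mono)
      fix u :: real assume u': "u \<in> {0<..<1}"
      then have u: "0 < u" "u < 1" by auto
      let ?y = "z(i := z i - u * z i + u * v)"
      have yi: "(1 - u) * z i \<le> ?y i" "?y i \<le> M" "0 < (1 - u) * z i"
        using u v zpos[OF i] zM[OF i] convex_bound_le[of "z i" M v "1 - u" u]
        by (auto simp: algebra_simps)
      have y1: "0 < ?y j \<and> ?y j \<le> M" if "j \<in> {1..N}" for j
      proof (cases "j = i")
        case True
        show ?thesis unfolding True using yi by linarith
      next
        case False
        then show ?thesis using zpos[OF that] zM[OF that] by simp
      qed
      have "?y \<in> extensional {1..N}" using z(1) i by (auto simp: box_def PiE_iff extensional_def)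
      then have y: "?y \<in> box" "\<forall>j\<in>{1..N}. 0 < ?y j"
        unfolding box_def PiE_iff using y1 by (blast intro: less_imp_le atLeastAtMost_iff[THEN iffD2])+
      have "W ?y - W z = (\<Sum>j=1..N. if j = i then w i * (u * (v - z i)) else 0)"
        unfolding W_def sum_subtractf[symmetric] by (intro sum.cong) (auto simp: algebra_simps)
      also have "\<dots> = w i * (u * (v - z i))" using i by simp
      finally have Wy: "W ?y - W z = w i * (u * (v - z i))" .
      have "(\<Sum>j=1..N. ln (z j) - ln (?y j)) = (\<Sum>j=1..N. if j = i then ln (z i) - ln (?y i) else 0)"
        by (intro sum.cong) auto
      also have "\<dots> = ln (z i) - ln (?y i)" using i by simp
      also have "\<dots> \<le> - ln (1 - u)"
      proof -
        have "ln ((1 - u) * z i) \<le> ln (?y i)" using yi by (subst ln_le_cancel_iff) auto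
        then show ?thesis using u zpos[OF i] by (simp add: ln_mult)
      qed
      also have "\<dots> \<le> u * (1 - u) powr - b / b" by (rule neg_ln_one_minus_le[OF u b(1,2)])
      finally have "\<epsilon> * (\<Sum>j=1..N. ln (z j) - ln (?y j)) \<le> \<epsilon> * (u * (1 - u) powr - b / b)"
        using \<epsilon> by (intro mult_left_mono) auto
      then have "D ?y - D z \<le> \<eta> * (w i * (u * (v - z i))) + \<epsilon> * (u * (1 - u) powr - b / b)"
        using max[OF y] unfolding Wy by linarith
      then have "(1 - u) powr (a - 1) / u * (D ?y - D z)
         \<le> (1 - u) powr (a - 1) / u * (\<eta> * (w i * (u * (v - z i))) + \<epsilon> * (u * (1 - u) powr - b / b))"
        using u by (intro mult_left_mono) auto
      also have "\<dots> = \<eta> * w i * (v - z i) * (1 - u) powr (a - 1) + \<epsilon> / b * ((1 - u) powr (a - 1) * (1 - u) powr - b)"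
        using u by (simp add: field_simps)
      also have "\<dots> = h u"
        by (simp add: h_def powr_add[symmetric] algebra_simps)
      finally show "(1 - u) powr (a - 1) / u * (D ?y - D z) \<le> h u" .
    next
      show "set_integrable lborel {0<..<1} h" unfolding h_def by (intro set_integral_add hi)
    qed (use int in \<open>simp add: jump_integrable_def\<close>)
    also have "(LBINT u:{0<..<1}. h u) = \<eta> * w i * (v - z i) * (1 / a) + \<epsilon> / b * (1 / (a - b))"
      unfolding h_def using set_integral_one_minus_powr[OF a] set_integral_one_minus_powr[of "a - b"] b
      by (subst set_integral_add(2)[OF hi]) simp
    finally show "jump_integral a D z i v \<le> \<eta> / a * (w i * (v - z i)) + \<epsilon> * c"
      by (simp add: c_def)
  qed
  let ?b = "boundary N 0 0 z"
  have bM: "0 \<le> ?b i" "?b i \<le> M" if "i \<le> N + 1" for i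
    using zpos[of i] zM[of i] M that by (auto simp: boundary_def less_imp_le)
  have bM1: "0 \<le> ?b (i - 1)" "?b (i - 1) \<le> M" "0 \<le> ?b (i + 1)" "?b (i + 1) \<le> M" if "i \<in> {1..N}" for i
    using that by (auto intro!: bM)
  have "0 \<le> hidden_generator s N 0 0 D z"
    using Dz d zpos by (intro gen[OF zc]) auto
  also have "\<dots> = (\<Sum>i=1..N. jump_integral a D z i (?b (i - 1)) + jump_integral a D z i (?b (i + 1)))"
    unfolding a_def using bM1 J(1) by (intro hidden_generator_eq_sum N) (auto simp: a_def)
  also have "\<dots> \<le> (\<Sum>i=1..N. (\<eta> / a * (w i * (?b (i - 1) - z i)) + \<epsilon> * c) + (\<eta> / a * (w i * (?b (i + 1) - z i)) + \<epsilon> * c))"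
    using bM1 by (intro sum_mono add_mono J(2)) auto
  also have "\<dots> = (\<Sum>i=1..N. \<eta> / a * (w i * (?b (i - 1) + ?b (i + 1) - 2 * z i)) + 2 * c * \<epsilon>)"
    by (intro sum.cong refl) (simp add: algebra_simps)
  also have "\<dots> = \<eta> / a * (\<Sum>i=1..N. w i * (?b (i - 1) + ?b (i + 1) - 2 * z i)) + 2 * N * c * \<epsilon>"
    by (simp add: sum_distrib_left sum.distrib)
  also have "(\<Sum>i=1..N. w i * (?b (i - 1) + ?b (i + 1) - 2 * z i)) = - 2 * (\<Sum>i=1..N. z i)"
    unfolding w_def by (rule sum_weighted_laplacian)
  finally have "\<eta> / a * (2 * (\<Sum>i=1..N. z i)) \<le> \<eta> * r / a" using \<epsilon>c by simp
  moreover have "\<eta> / a * (2 * r) \<le> \<eta> / a * (2 * (\<Sum>i=1..N. z i))"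
    using r(2)[OF z(1) Dz] \<eta> a by (intro mult_left_mono) auto
  moreover have "\<eta> / a * (2 * r) = 2 * (\<eta> * r / a)" by simp
  ultimately have "\<eta> * r / a \<le> 0" by linarith
  then show False using \<eta> r(1) a by (simp add: divide_le_0_iff mult_le_0_iff)
qed

section \<open>Laplace and Stieltjes transforms on the half-line\<close>

lemma finite_borel_measure_eqI_moments:
  assumes "finite_borel_measure M1" "finite_borel_measure M2"
    and supp: "AE x in M1. x \<in> {0..1}" "AE x in M2. x \<in> {0..1}"
    and moments: "\<And>k. (\<integral>x. x ^ k \<partial>M1) = (\<integral>x. x ^ k \<partial>M2)"
  shows "M1 = M2"
proof -
  interpret M1: finite_borel_measure M1 by fact
  interpret M2: finite_borel_measure M2 by fact
  have sets[measurable_cong]: "sets M1 = sets borel" "sets M2 = sets borel"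
    by (rule M1.M_is_borel M2.M_is_borel)+
  have int: "integrable M1 f" "integrable M2 f"
    if "f \<in> borel_measurable borel" "\<And>x. x \<in> {0..1} \<Longrightarrow> \<bar>f x\<bar> \<le> B" for f :: "real \<Rightarrow> real" and B
  proof -
    have "AE x in M1. norm (f x) \<le> B" using supp(1) by (rule eventually_mono) (use that(2) in auto)
    then show "integrable M1 f" using that(1) by (intro M1.integrable_const_bound[where B = B]) auto
    have "AE x in M2. norm (f x) \<le> B" using supp(2) by (rule eventually_mono) (use that(2) in auto)
    then show "integrable M2 f" using that(1) by (intro M2.integrable_const_bound[where B = B]) auto
  qed
  have pint: "integrable M1 (\<lambda>x. x ^ k * (1 - x) ^ m)" "integrable M2 (\<lambda>x. x ^ k * (1 - x) ^ m)" for k m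
    by (rule int[where B = 1]; auto simp: abs_mult intro!: mult_le_one power_le_one)+
  have bern: "(\<integral>x. x ^ k * (1 - x) ^ m \<partial>M1) = (\<integral>x. x ^ k * (1 - x) ^ m \<partial>M2)" for k m
  proof (induction m arbitrary: k)
    case 0
    then show ?case using moments by simp
  next
    case (Suc m)
    have eq: "(\<lambda>x::real. x ^ k * (1 - x) ^ Suc m) = (\<lambda>x. x ^ k * (1 - x) ^ m - x ^ Suc k * (1 - x) ^ m)"
      by (simp add: fun_eq_iff algebra_simps)
    show ?case unfolding eq using Suc[of k] Suc[of "Suc k"] pint[of k m] pint[of "Suc k" m]
      by (simp only: Bochner_Integration.integral_diff)
  qed
  have cont: "(\<integral>x. f x \<partial>M1) = (\<integral>x. f x \<partial>M2)" if f: "continuous_on UNIV f" for f :: "real \<Rightarrow> real"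
  proof -
    define m where "m = measure M1 (space M1) + measure M2 (space M2)"
    have m: "0 \<le> m" by (simp add: m_def)
    have fm[measurable]: "f \<in> borel_measurable borel" by (rule borel_measurable_continuous_onI[OF f])
    have bf: "compact (f ` {0..1})" by (rule compact_continuous_image[OF continuous_on_subset[OF f]]) auto
    then obtain B where B: "\<And>x. x \<in> {0..1} \<Longrightarrow> \<bar>f x\<bar> \<le> B"
      using compact_imp_bounded[OF bf] unfolding bounded_iff real_norm_def by blast
    have "\<bar>(\<integral>x. f x \<partial>M1) - (\<integral>x. f x \<partial>M2)\<bar> \<le> e * m" if e: "0 < e" for e
    proof -
      obtain n where n: "\<And>x. x \<in> {0..1} \<Longrightarrow> \<bar>f x - (\<Sum>k\<le>n. f (k / n) * Bernstein n k x)\<bar> < e"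
        using Bernstein_Weierstrass[OF continuous_on_subset[OF f] e] by blast
      define p where "p = (\<lambda>x. \<Sum>k\<le>n. f (k / n) * Bernstein n k x)"
      have p: "p = (\<lambda>x. \<Sum>k\<le>n. f (k / n) * real (n choose k) * (x ^ k * (1 - x) ^ (n - k)))"
        by (simp add: p_def Bernstein_def mult.assoc)
      have ip: "integrable M1 p" "integrable M2 p"
        unfolding p by (intro Bochner_Integration.integrable_sum integrable_mult_right pint)+
      have pp: "(\<integral>x. p x \<partial>M1) = (\<integral>x. p x \<partial>M2)"
        unfolding p using pint bern by (simp add: Bochner_Integration.integral_sum)
      have fi: "integrable M1 f" "integrable M2 f" by (rule int[OF fm B]; assumption)+
      have le: "\<bar>f x - p x\<bar> \<le> e" if "x \<in> {0..1}" for x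
        unfolding p_def by (rule less_imp_le[OF n[OF that]])
      have fp1: "AE x in M1. \<bar>f x - p x\<bar> \<le> e" by (rule eventually_mono[OF supp(1) le])
      have fp2: "AE x in M2. \<bar>f x - p x\<bar> \<le> e" by (rule eventually_mono[OF supp(2) le])
      have "\<bar>\<integral>x. f x - p x \<partial>M1\<bar> \<le> (\<integral>x. e \<partial>M1)"
        using fp1 fi(1) ip(1) by (intro order_trans[OF integral_abs_bound] integral_mono_AE) auto
      moreover have "\<bar>\<integral>x. f x - p x \<partial>M2\<bar> \<le> (\<integral>x. e \<partial>M2)"
        using fp2 fi(2) ip(2) by (intro order_trans[OF integral_abs_bound] integral_mono_AE) auto
      moreover have "(\<integral>x. f x - p x \<partial>M1) = (\<integral>x. f x \<partial>M1) - (\<integral>x. p x \<partial>M1)"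
        "(\<integral>x. f x - p x \<partial>M2) = (\<integral>x. f x \<partial>M2) - (\<integral>x. p x \<partial>M2)"
        by (rule Bochner_Integration.integral_diff[OF fi(1) ip(1)] Bochner_Integration.integral_diff[OF fi(2) ip(2)])+
      moreover have "(\<integral>x. e \<partial>M1) + (\<integral>x. e \<partial>M2) = e * m" by (simp add: m_def algebra_simps)
      ultimately show ?thesis using pp by linarith
    qed
    note le = this
    show ?thesis
    proof (rule ccontr)
      assume "(\<integral>x. f x \<partial>M1) \<noteq> (\<integral>x. f x \<partial>M2)"
      then have d: "0 < \<bar>(\<integral>x. f x \<partial>M1) - (\<integral>x. f x \<partial>M2)\<bar>" (is "0 < ?d") by simp
      have "?d \<le> ?d / 2 / (m + 1) * m" using d m by (intro le) auto
      also have "\<dots> \<le> ?d / 2 / (m + 1) * (m + 1)" using m by (intro mult_left_mono) auto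
      also have "\<dots> = ?d / 2" by (rule nonzero_eq_divide_eq[THEN iffD1, OF _ refl]) (use m in simp)
      finally show False using d by simp
    qed
  qed
  have "cdf M1 = cdf M2"
  proof
    fix c
    let ?f = "\<lambda>n. cts_step c (c + 1 / Suc n)"
    have fc: "continuous_on UNIV (?f n)" for n
      by (rule uniformly_continuous_imp_continuous[OF cts_step_uniformly_continuous]) simp
    have fm[measurable]: "?f n \<in> borel_measurable borel" for n
      by (rule borel_measurable_continuous_onI[OF fc])
    have fmM: "?f n \<in> borel_measurable M1" "?f n \<in> borel_measurable M2" for n
      by (simp_all only: measurable_cong_sets[OF sets(1) refl] measurable_cong_sets[OF sets(2) refl] fm)
    have "\<bar>cts_step a b x\<bar> \<le> 1" if "a < b" for a b x
      using that by (auto simp: cts_step_def abs_divide)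
    then have fb: "\<bar>?f n x\<bar> \<le> 1" for n x by simp
    have lim: "(\<lambda>n. ?f n x) \<longlonglongrightarrow> indicator {..c} x" for x
    proof (cases "x \<le> c")
      case False
      have "\<forall>\<^sub>F n in sequentially. 1 / real (Suc n) < x - c"
        using False by (intro order_tendstoD(2)[OF LIMSEQ_inverse_real_of_nat[unfolded inverse_eq_divide]]) auto
      then have "\<forall>\<^sub>F n in sequentially. ?f n x = 0"
        by eventually_elim (use False in \<open>auto simp: cts_step_def\<close>)
      then show ?thesis using False by (simp add: tendsto_eventually)
    qed (simp add: cts_step_def)
    have "(\<lambda>n. \<integral>x. ?f n x \<partial>M1) \<longlonglongrightarrow> (\<integral>x. indicator {..c} x \<partial>M1)"
      using lim fb by (intro integral_dominated_convergence[where w = "\<lambda>_. 1"] fmM AE_I2) (auto simp del: of_nat_Suc)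
    moreover have "(\<lambda>n. \<integral>x. ?f n x \<partial>M2) \<longlonglongrightarrow> (\<integral>x. indicator {..c} x \<partial>M2)"
      using lim fb by (intro integral_dominated_convergence[where w = "\<lambda>_. 1"] fmM AE_I2) (auto simp del: of_nat_Suc)
    ultimately have "(\<integral>x. indicator {..c} x \<partial>M1) = (\<integral>x. indicator {..c} x \<partial>M2 :: real)"
      unfolding cont[OF fc] by (rule LIMSEQ_unique)
    then show "cdf M1 c = cdf M2 c" by (simp add: cdf_def)
  qed
  then show ?thesis by (intro cdf_unique' assms(1,2))
qed

lemma weighted_law_eqI_moments:
  fixes y G :: "'a \<Rightarrow> real"
  assumes "finite_measure \<mu>" "finite_measure \<pi>" and sets: "sets \<mu> = sets \<pi>"
    and y: "y \<in> borel_measurable \<pi>" "\<And>x. x \<in> space \<pi> \<Longrightarrow> y x \<in> {0..1}"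
    and G: "G \<in> borel_measurable \<pi>" "\<And>x. x \<in> space \<pi> \<Longrightarrow> G x \<in> {0..1}"
    and moments: "\<And>k. (\<integral>x. G x * y x ^ k \<partial>\<mu>) = (\<integral>x. G x * y x ^ k \<partial>\<pi>)"
    and h: "h \<in> borel_measurable borel" "\<And>t. 0 \<le> h t"
  shows "(\<integral>x. G x * h (y x) \<partial>\<mu>) = (\<integral>x. G x * h (y x) \<partial>\<pi>)"
proof -
  have sp: "space \<mu> = space \<pi>" by (rule sets_eq_imp_space_eq[OF sets])
  define D where "D = (\<lambda>M. distr (density M (\<lambda>x. ennreal (G x))) borel y)"
  have meas: "y \<in> borel_measurable M" "G \<in> borel_measurable M" if "M = \<mu> \<or> M = \<pi>" for M
    using that y(1) G(1) measurable_cong_sets[OF sets refl] by auto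
  have AEG: "AE x in M. 0 \<le> G x" if "M = \<mu> \<or> M = \<pi>" for M using that G(2) sp by (intro AE_I2) auto
  have fin: "finite_borel_measure (D M)" and supp: "AE t in D M. t \<in> {0..1}"
    and integ: "f \<in> borel_measurable borel \<Longrightarrow> (\<integral>t. f t \<partial>D M) = (\<integral>x. G x * f (y x) \<partial>M)"
    if M: "M = \<mu> \<or> M = \<pi>" for M and f :: "real \<Rightarrow> real"
  proof -
    note [measurable] = meas[OF M]
    interpret finite_measure M using M assms by auto
    have "(\<integral>\<^sup>+x. ennreal (G x) \<partial>M) \<le> (\<integral>\<^sup>+x. 1 \<partial>M)"
      using M G(2) sp by (intro nn_integral_mono) auto
    also have "\<dots> < \<infinity>" using emeasure_finite[of "space M"] by (simp add: less_top[symmetric])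
    finally have "finite_measure (density M (\<lambda>x. ennreal (G x)))"
      by (intro finite_measureI) (simp add: emeasure_density cong: nn_integral_cong)
    then have "finite_measure (D M)" unfolding D_def by (intro finite_measure.finite_measure_distr) auto
    then show "finite_borel_measure (D M)"
      by (simp add: finite_borel_measure_def finite_borel_measure_axioms_def D_def)
    show "AE t in D M. t \<in> {0..1}"
      unfolding D_def using M y(2) sp by (subst AE_distr_iff) (auto simp: AE_density intro!: AE_I2)
    show "(\<integral>t. f t \<partial>D M) = (\<integral>x. G x * f (y x) \<partial>M)" if [measurable]: "f \<in> borel_measurable borel"
      unfolding D_def using AEG[OF M] by (simp add: integral_distr integral_density)
  qed
  have "D \<mu> = D \<pi>"
    by (rule finite_borel_measure_eqI_moments) (use fin supp integ moments in auto)
  then show ?thesis using integ[of \<mu> h] integ[of \<pi> h] h by simp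
qed

lemma laplace_determines_law:
  fixes X G :: "'a \<Rightarrow> real"
  assumes fin: "finite_measure \<mu>" "finite_measure \<pi>" and sets: "sets \<mu> = sets \<pi>"
    and X: "X \<in> borel_measurable \<pi>" "\<And>x. x \<in> space \<pi> \<Longrightarrow> 0 \<le> X x"
    and G: "G \<in> borel_measurable \<pi>" "\<And>x. x \<in> space \<pi> \<Longrightarrow> G x \<in> {0..1}"
    and eq: "\<And>l. 0 < l \<Longrightarrow> (\<integral>x. G x * exp (- (l * X x)) \<partial>\<mu>) = (\<integral>x. G x * exp (- (l * X x)) \<partial>\<pi>)"
    and A: "A \<in> sets borel"
  shows "(\<integral>x. G x * indicator A (X x) \<partial>\<mu>) = (\<integral>x. G x * indicator A (X x) \<partial>\<pi>)"
proof -
  have sp: "space \<mu> = space \<pi>" by (rule sets_eq_imp_space_eq[OF sets])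
  define h where "h = (\<lambda>t::real. \<bar>1 / t\<bar> * indicator A (- ln t))"
  have "(\<integral>x. (G x * exp (- X x)) * h (exp (- X x)) \<partial>\<mu>) = (\<integral>x. (G x * exp (- X x)) * h (exp (- X x)) \<partial>\<pi>)"
  proof (rule weighted_law_eqI_moments[OF fin sets, where y = "\<lambda>x. exp (- X x)" and G = "\<lambda>x. G x * exp (- X x)" and h = h])
    fix k
    have e: "(\<lambda>x. G x * exp (- X x) * exp (- X x) ^ k) = (\<lambda>x. G x * exp (- ((1 + real k) * X x)))"
      by (simp add: fun_eq_iff exp_of_nat_mult[symmetric] mult.assoc exp_add[symmetric] algebra_simps)
    show "(\<integral>x. G x * exp (- X x) * exp (- X x) ^ k \<partial>\<mu>) = (\<integral>x. G x * exp (- X x) * exp (- X x) ^ k \<partial>\<pi>)"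
      unfolding e by (rule eq) simp
  next
    show "h \<in> borel_measurable borel" unfolding h_def using A by measurable
  qed (use X G in \<open>auto simp: h_def intro!: mult_le_one\<close>)
  moreover have "G x * exp (- X x) * h (exp (- X x)) = G x * indicator A (X x)" for x
    by (simp add: h_def)
  ultimately show ?thesis by simp
qed

lemma powser_eq_0:
  fixes a :: "nat \<Rightarrow> real"
  assumes "0 < s" and "\<And>x. \<bar>x\<bar> < s \<Longrightarrow> (\<lambda>n. a n * x ^ n) sums 0"
  shows "a n = 0"
proof (induction n rule: less_induct)
  case (less n)
  have "((\<lambda>x. 0) \<longlongrightarrow> (\<lambda>k. a (k + n)) 0) (at (0::real))"
  proof (rule powser_limit_0_strong[OF \<open>0 < s\<close>])
    fix x :: real assume "x \<noteq> 0" "norm x < s"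
    then have x: "x \<noteq> 0" "\<bar>x\<bar> < s" by auto
    have "(\<lambda>k. a (k + n) * x ^ (k + n)) sums 0"
      using sums_split_initial_segment[OF assms(2)[OF x(2)], of n] less by simp
    then have "(\<lambda>k. a (k + n) * x ^ (k + n) / x ^ n) sums (0 / x ^ n)" by (rule sums_divide)
    then show "(\<lambda>k. a (k + n) * x ^ k) sums 0" using x(1) by (simp add: power_add)
  qed
  then have "(\<lambda>k. a (k + n)) 0 = 0" using tendsto_unique[OF at_neq_bot _ tendsto_const] by blast
  then show ?case by simp
qed

lemma stieltjes_determines_law:
  fixes X G :: "'a \<Rightarrow> real"
  assumes a: "0 < a" and fin: "finite_measure \<mu>" "finite_measure \<pi>" and sets: "sets \<mu> = sets \<pi>"
    and X: "X \<in> borel_measurable \<pi>" "\<And>x. x \<in> space \<pi> \<Longrightarrow> 0 \<le> X x"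
    and G: "G \<in> borel_measurable \<pi>" "\<And>x. x \<in> space \<pi> \<Longrightarrow> G x \<in> {0..1}"
    and eq: "\<And>l. 0 < l \<Longrightarrow> (\<integral>x. G x * (1 + l * X x) powr - a \<partial>\<mu>) = (\<integral>x. G x * (1 + l * X x) powr - a \<partial>\<pi>)"
    and A: "A \<in> sets borel"
  shows "(\<integral>x. G x * indicator A (X x) \<partial>\<mu>) = (\<integral>x. G x * indicator A (X x) \<partial>\<pi>)"
proof -
  have sp: "space \<mu> = space \<pi>" by (rule sets_eq_imp_space_eq[OF sets])
  define w where "w = (\<lambda>x. (1 + X x) powr - a)"
  define z where "z = (\<lambda>x. X x / (1 + X x))"
  have w: "0 \<le> w x" "w x \<le> 1" if "x \<in> space \<pi>" for x
    using X(2)[OF that] a powr_mono2'[of "- a" 1 "1 + X x"] by (auto simp: w_def)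
  have z: "0 \<le> z x" "z x < 1" if "x \<in> space \<pi>" for x
    using X(2)[OF that] by (auto simp: z_def)
  define g where "g = (\<lambda>k. (- a gchoose k))"
  have g0: "g k \<noteq> 0" for k
    using pochhammer_pos[OF a, of k] by (simp add: g_def gbinomial_pochhammer)
  define c where "c = (\<lambda>M k. \<integral>x. G x * w x * z x ^ k \<partial>M)"
  have ser: "(\<lambda>k. g k * c M k * t ^ k) sums (\<integral>x. G x * (1 + (1 + t) * X x) powr - a \<partial>M)"
    if M: "M = \<mu> \<or> M = \<pi>" and t: "\<bar>t\<bar> < 1" for M t
  proof -
    have spM: "space M = space \<pi>" using M sp by auto
    interpret M: finite_measure M using M fin by auto
    have [measurable]: "X \<in> borel_measurable M" "G \<in> borel_measurable M"
      using M X(1) G(1) measurable_cong_sets[OF sets refl] by auto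
    define F where "F = (\<lambda>k x. G x * w x * (g k * (t * z x) ^ k))"
    have tz: "\<bar>t * z x\<bar> \<le> \<bar>t\<bar>" if "x \<in> space \<pi>" for x
      using z[OF that] by (simp add: abs_mult mult_left_le)
    have b: "norm (F k x) \<le> norm (g k * \<bar>t\<bar> ^ k)" if "x \<in> space \<pi>" for k x
    proof -
      have "norm (F k x) = (G x * w x) * (\<bar>g k\<bar> * \<bar>t * z x\<bar> ^ k)"
        using G(2)[OF that] w[OF that] by (simp add: F_def abs_mult power_abs)
      also have "\<dots> \<le> 1 * (\<bar>g k\<bar> * \<bar>t\<bar> ^ k)"
        using G(2)[OF that] w[OF that] tz[OF that]
        by (intro mult_mono mult_le_one power_mono) auto
      finally show ?thesis by (simp add: abs_mult)
    qed
    have sm: "summable (\<lambda>k. norm (g k * \<bar>t\<bar> ^ k))"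
    proof (rule powser_insidea)
      show "summable (\<lambda>k. g k * ((1 + \<bar>t\<bar>) / 2) ^ k)"
        unfolding g_def by (rule sums_summable[OF gen_binomial_real]) (use t in auto)
    qed (use t in auto)
    have Fm[measurable]: "F k \<in> borel_measurable M" for k
      unfolding F_def w_def z_def by measurable
    have Fi: "integrable M (F k)" for k
      by (rule M.integrable_const_bound[where B = "norm (g k * \<bar>t\<bar> ^ k)"]) (use b spM in \<open>auto intro!: AE_I2\<close>)
    have "(\<lambda>k. \<integral>x. F k x \<partial>M) sums (\<integral>x. (\<Sum>k. F k x) \<partial>M)"
    proof (rule sums_integral[OF Fi])
      show "AE x in M. summable (\<lambda>k. norm (F k x))"
        by (rule AE_I2) (use b spM in \<open>auto intro!: summable_comparison_test'[OF sm]\<close>)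
      show "summable (\<lambda>k. \<integral>x. norm (F k x) \<partial>M)"
      proof (rule summable_comparison_test')
        show "summable (\<lambda>k. norm (g k * \<bar>t\<bar> ^ k) * measure M (space M))" using sm by (rule summable_mult2)
        show "norm (\<integral>x. norm (F k x) \<partial>M) \<le> norm (g k * \<bar>t\<bar> ^ k) * measure M (space M)" for k
        proof -
          have "(\<integral>x. norm (F k x) \<partial>M) \<le> (\<integral>x. norm (g k * \<bar>t\<bar> ^ k) \<partial>M)"
            using b spM Fi by (intro integral_mono integrable_norm) auto
          then show ?thesis by (simp add: mult.commute)
        qed
      qed
    qed
    also have "(\<integral>x. (\<Sum>k. F k x) \<partial>M) = (\<integral>x. G x * (1 + (1 + t) * X x) powr - a \<partial>M)"
    proof (rule Bochner_Integration.integral_cong[OF refl])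
      fix x assume "x \<in> space M"
      then have x: "x \<in> space \<pi>" using spM by simp
      have "\<bar>t * z x\<bar> < 1" using tz[OF x] t by linarith
      then have "(\<lambda>k. G x * w x * (g k * (t * z x) ^ k)) sums (G x * w x * (1 + t * z x) powr - a)"
        unfolding g_def by (intro sums_mult gen_binomial_real)
      then have "(\<Sum>k. F k x) = G x * (w x * (1 + t * z x) powr - a)"
        by (simp add: F_def sums_iff)
      also have "w x * (1 + t * z x) powr - a = ((1 + X x) * (1 + t * z x)) powr - a"
        using X(2)[OF x] \<open>\<bar>t * z x\<bar> < 1\<close> by (simp add: w_def powr_mult)
      also have "(1 + X x) * (1 + t * z x) = 1 + (1 + t) * X x"
        using X(2)[OF x] by (simp add: z_def field_simps)
      finally show "(\<Sum>k. F k x) = G x * (1 + (1 + t) * X x) powr - a" .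
    qed
    also have "(\<lambda>k. \<integral>x. F k x \<partial>M) = (\<lambda>k. g k * c M k * t ^ k)"
    proof
      fix k
      have "F k = (\<lambda>x. (g k * t ^ k) * (G x * w x * z x ^ k))"
        by (simp add: F_def fun_eq_iff power_mult_distrib)
      then show "(\<integral>x. F k x \<partial>M) = g k * c M k * t ^ k" by (simp add: c_def)
    qed
    finally show ?thesis .
  qed
  have cc: "c \<mu> k = c \<pi> k" for k
  proof -
    have "g k * (c \<mu> k - c \<pi> k) = 0"
    proof (rule powser_eq_0[of 1 "\<lambda>k. g k * (c \<mu> k - c \<pi> k)"])
      fix t :: real assume t: "\<bar>t\<bar> < 1"
      have "(\<lambda>k. g k * c \<mu> k * t ^ k - g k * c \<pi> k * t ^ k) sums 0"
        using sums_diff[OF ser[of \<mu> t] ser[of \<pi> t]] eq[of "1 + t"] t by simp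
      then show "(\<lambda>k. g k * (c \<mu> k - c \<pi> k) * t ^ k) sums 0" by (simp add: algebra_simps)
    qed simp
    then show ?thesis using g0[of k] by simp
  qed
  define h where "h = (\<lambda>t::real. (1 - t) powr - a * indicator A (t / (1 - t)))"
  have "(\<integral>x. (G x * w x) * h (z x) \<partial>\<mu>) = (\<integral>x. (G x * w x) * h (z x) \<partial>\<pi>)"
  proof (rule weighted_law_eqI_moments[OF fin sets, where y = z and G = "\<lambda>x. G x * w x" and h = h])
    show "z \<in> borel_measurable \<pi>" "(\<lambda>x. G x * w x) \<in> borel_measurable \<pi>"
      using X(1) G(1) unfolding z_def w_def by measurable
    show "h \<in> borel_measurable borel" unfolding h_def using A by measurable
    show "(\<integral>x. G x * w x * z x ^ k \<partial>\<mu>) = (\<integral>x. G x * w x * z x ^ k \<partial>\<pi>)" for k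
      using cc[of k] by (simp add: c_def)
    show "z x \<in> {0..1}" if "x \<in> space \<pi>" for x using z[OF that] by simp
    show "G x * w x \<in> {0..1}" if "x \<in> space \<pi>" for x
      using w[OF that] G(2)[OF that] by (simp add: mult_le_one)
    show "0 \<le> h t" for t by (simp add: h_def)
  qed
  moreover have "(\<integral>x. (G x * w x) * h (z x) \<partial>M) = (\<integral>x. G x * indicator A (X x) \<partial>M)" if "M = \<mu> \<or> M = \<pi>" for M
  proof (rule Bochner_Integration.integral_cong[OF refl])
    fix x assume "x \<in> space M"
    then have "0 \<le> X x" using that sp X(2) by auto
    then have p: "0 < 1 + X x" by simp
    then have 1: "1 - z x = 1 / (1 + X x)" by (simp add: z_def diff_divide_eq_iff)
    moreover have "z x / (1 - z x) = X x" unfolding 1 using p by (simp add: z_def)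
    moreover have "w x * (1 / (1 + X x)) powr - a = 1"
      using p by (simp add: w_def powr_divide)
    ultimately show "(G x * w x) * h (z x) = G x * indicator A (X x)" by (simp add: h_def)
  qed
  ultimately show ?thesis by simp
qed

section \<open>Laws on the configuration space\<close>

lemma space_config_space [simp]: "space (config_space N) = configs N"
  by (auto simp: config_space_def space_PiM space_restrict_space)

lemma measurable_coordinate:
  assumes "i \<in> {1..N}"
  shows "(\<lambda>x. x i) \<in> borel_measurable (config_space N)"
proof -
  have "(\<lambda>x. x i) \<in> config_space N \<rightarrow>\<^sub>M restrict_space borel {0..}"
    unfolding config_space_def using assms by measurable
  then show ?thesis by (simp add: measurable_restrict_space2_iff)
qed

lemma sets_config_space: "sets (config_space N) = sets (restrict_space borel (configs N))"
proof
  have 1: "(\<lambda>x. x) \<in> borel_measurable (config_space N)"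
  proof (rule measurable_coordinatewise_then_product)
    fix i
    show "(\<lambda>x. x i) \<in> borel_measurable (config_space N)"
    proof (cases "i \<in> {1..N}")
      case False
      then have "x i = undefined" if "x \<in> space (config_space N)" for x
        using that by (auto simp: PiE_iff extensional_def)
      then show ?thesis by (subst measurable_cong[where g = "\<lambda>_. undefined"]) auto
    qed (rule measurable_coordinate)
  qed
  then have id1: "(\<lambda>x. x) \<in> config_space N \<rightarrow>\<^sub>M restrict_space borel (configs N)"
    by (intro measurable_restrict_space2) auto
  show "sets (restrict_space borel (configs N)) \<subseteq> sets (config_space N)"
  proof
    fix A assume A: "A \<in> sets (restrict_space borel (configs N))"
    then have "A \<subseteq> configs N" using sets.sets_into_space[OF A] by (simp add: space_restrict_space)
    then show "A \<in> sets (config_space N)"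
      using measurable_sets[OF id1 A] by (simp add: Int_absorb2)
  qed
  have id2: "(\<lambda>x. x) \<in> restrict_space borel (configs N) \<rightarrow>\<^sub>M config_space N"
    unfolding config_space_def
  proof (rule measurable_PiM_single')
    fix i assume i: "i \<in> {1..N}"
    have "(\<lambda>x::nat \<Rightarrow> real. x i) \<in> borel_measurable borel"
      by (rule borel_measurable_continuous_onI) (rule continuous_on_coordinate)
    then show "(\<lambda>x. x i) \<in> restrict_space borel (configs N) \<rightarrow>\<^sub>M restrict_space borel {0..}"
      using i by (intro measurable_restrict_space2 measurable_restrict_space1) (auto simp: space_restrict_space PiE_iff)
  qed (auto simp: space_restrict_space)
  show "sets (config_space N) \<subseteq> sets (restrict_space borel (configs N))"
  proof
    fix A assume A: "A \<in> sets (config_space N)"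
    then have "A \<subseteq> configs N" using sets.sets_into_space[OF A] by simp
    then show "A \<in> sets (restrict_space borel (configs N))"
      using measurable_sets[OF id2 A] by (simp add: Int_absorb2 space_restrict_space)
  qed
qed

lemma borel_measurable_config_space:
  fixes f :: "(nat \<Rightarrow> real) \<Rightarrow> real"
  assumes "continuous_on (configs N) f"
  shows "f \<in> borel_measurable (config_space N)"
  using borel_measurable_continuous_on_restrict[OF assms]
    measurable_cong_sets[OF sets_config_space refl] by blast

lemma transform_determines_measure:
  fixes q :: "real \<Rightarrow> real"
  assumes prob: "prob_space \<mu>" "prob_space \<pi>"
    and sets: "sets \<mu> = sets (config_space N)" "sets \<pi> = sets (config_space N)"
    and q: "q \<in> borel_measurable borel" "\<And>z. 0 \<le> z \<Longrightarrow> q z \<in> {0..1}"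
    and step: "\<And>i G A. i \<in> {1..N} \<Longrightarrow> G \<in> borel_measurable (config_space N) \<Longrightarrow>
      (\<And>x. x \<in> configs N \<Longrightarrow> G x \<in> {0..1}) \<Longrightarrow>
      (\<And>l. 0 < l \<Longrightarrow> (\<integral>x. G x * q (l * x i) \<partial>\<mu>) = (\<integral>x. G x * q (l * x i) \<partial>\<pi>)) \<Longrightarrow>
      A \<in> sets borel \<Longrightarrow> (\<integral>x. G x * indicator A (x i) \<partial>\<mu>) = (\<integral>x. G x * indicator A (x i) \<partial>\<pi>)"
    and eq: "\<And>l. (\<forall>i\<in>{1..N}. 0 < l i) \<Longrightarrow>
      (\<integral>x. (\<Prod>i=1..N. q (l i * x i)) \<partial>\<mu>) = (\<integral>x. (\<Prod>i=1..N. q (l i * x i)) \<partial>\<pi>)"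
  shows "\<mu> = \<pi>"
proof -
  interpret m: prob_space \<mu> by fact
  interpret p: prob_space \<pi> by fact
  define T where "T = (\<lambda>k A (l :: nat \<Rightarrow> real) (x :: nat \<Rightarrow> real) (i :: nat). if i \<le> k then indicator (A i) (x i) else q (l i * x i))"
  have T: "T k A l x i \<in> {0..1}" if "x \<in> configs N" "i \<in> {1..N}" "0 < l i" for k A l x i
  proof (cases "i \<le> k")
    case False
    have "0 \<le> x i" using that by (auto simp: PiE_iff)
    then have "0 \<le> l i * x i" using that by simp
    from q(2)[OF this] False show ?thesis by (simp add: T_def)
  qed (simp add: T_def)
  have Tm: "(\<lambda>x. T k A l x i) \<in> borel_measurable (config_space N)"
    if "A i \<in> sets borel" "i \<in> {1..N}" for k A l i
    unfolding T_def using measurable_coordinate[OF that(2)] q(1) that(1) by measurable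
  have main: "(\<integral>x. (\<Prod>i=1..N. T k A l x i) \<partial>\<mu>) = (\<integral>x. (\<Prod>i=1..N. T k A l x i) \<partial>\<pi>)"
    if "k \<le> N" "\<And>i. i \<in> {1..N} \<Longrightarrow> A i \<in> sets borel" "\<forall>i\<in>{1..N}. 0 < l i" for k A l
    using that
  proof (induction k arbitrary: l)
    case 0
    have "(\<Prod>i=1..N. T 0 A l x i) = (\<Prod>i=1..N. q (l i * x i))" for x
      by (intro prod.cong) (auto simp: T_def)
    then show ?case using eq[OF 0(3)] by simp
  next
    case (Suc k)
    let ?i = "Suc k"
    have i: "?i \<in> {1..N}" using Suc by auto
    define G where "G = (\<lambda>x. \<Prod>i\<in>{1..N} - {?i}. T k A l x i)"
    have split: "(\<Prod>i=1..N. T k' A l' x i) = T k' A l' x ?i * G x"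
      if "k' = k \<or> k' = Suc k" "\<And>j. j \<noteq> ?i \<Longrightarrow> l' j = l j" for k' l' x
    proof -
      have "(\<Prod>i\<in>{1..N} - {?i}. T k' A l' x i) = G x"
        unfolding G_def using that by (intro prod.cong) (auto simp: T_def)
      then show ?thesis using i by (simp add: prod.remove[of _ ?i])
    qed
    have "(\<integral>x. G x * indicator (A ?i) (x ?i) \<partial>\<mu>) = (\<integral>x. G x * indicator (A ?i) (x ?i) \<partial>\<pi>)"
    proof (rule step[OF i])
      show "G \<in> borel_measurable (config_space N)"
        unfolding G_def using Suc.prems(2) by (intro borel_measurable_prod Tm) auto
      show "G x \<in> {0..1}" if "x \<in> configs N" for x
        unfolding G_def using T[OF that] Suc.prems(3) by (auto intro!: prod_nonneg prod_le_1)
      show "A ?i \<in> sets borel" using Suc.prems(2) i by auto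
      fix c :: real assume c: "0 < c"
      have "(\<integral>x. (\<Prod>i=1..N. T k A (l(?i := c)) x i) \<partial>\<mu>) = (\<integral>x. (\<Prod>i=1..N. T k A (l(?i := c)) x i) \<partial>\<pi>)"
        using Suc.prems c by (intro Suc.IH) auto
      moreover have "(\<Prod>i=1..N. T k A (l(?i := c)) x i) = G x * q (c * x ?i)" for x
        by (subst split) (auto simp: T_def)
      ultimately show "(\<integral>x. G x * q (c * x ?i) \<partial>\<mu>) = (\<integral>x. G x * q (c * x ?i) \<partial>\<pi>)" by simp
    qed
    moreover have "(\<Prod>i=1..N. T (Suc k) A l x i) = G x * indicator (A ?i) (x ?i)" for x
      by (subst split) (auto simp: T_def)
    ultimately show ?case by simp
  qed
  show ?thesis
  proof (rule measure_eqI_PiM_finite)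
    show "finite {1..N}" by simp
    show "sets \<mu> = sets (PiM {1..N} (\<lambda>_. restrict_space borel {0..}))"
      "sets \<pi> = sets (PiM {1..N} (\<lambda>_. restrict_space borel {0..}))"
      using sets by (simp_all add: config_space_def)
    fix A :: "nat \<Rightarrow> real set" assume A: "\<And>i. i \<in> {1..N} \<Longrightarrow> A i \<in> sets (restrict_space borel {0..})"
    then have A': "A i \<in> sets borel" if "i \<in> {1..N}" for i
      using that by (auto simp: sets_restrict_space_iff)
    have box: "PiE {1..N} A \<in> sets (config_space N)"
      unfolding config_space_def using A by (intro sets_PiM_I_finite) auto
    have ind: "(\<Prod>i=1..N. T N A (\<lambda>_. 1) x i) = indicator (PiE {1..N} A) x" if "x \<in> configs N" for x
    proof -
      have "(\<Prod>i=1..N. T N A (\<lambda>_. 1) x i) = (\<Prod>i=1..N. indicator (A i) (x i))"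
        by (intro prod.cong) (auto simp: T_def)
      also have "\<dots> = indicator (PiE {1..N} A) x"
        using that by (auto simp: indicator_def PiE_iff prod_zero_iff intro!: prod.neutral)
      finally show ?thesis .
    qed
    have "measure M (PiE {1..N} A) = (\<integral>x. (\<Prod>i=1..N. T N A (\<lambda>_. 1) x i) \<partial>M)"
      if "sets M = sets (config_space N)" for M
    proof -
      have sp: "space M = configs N" using sets_eq_imp_space_eq[OF that] by simp
      have "PiE {1..N} A \<subseteq> space M" using sets.sets_into_space[OF box] sp by simp
      then have "measure M (PiE {1..N} A) = (\<integral>x. indicator (PiE {1..N} A) x \<partial>M)"
        by (simp add: Int_absorb2)
      also have "\<dots> = (\<integral>x. (\<Prod>i=1..N. T N A (\<lambda>_. 1) x i) \<partial>M)"
        using ind sp by (intro Bochner_Integration.integral_cong) auto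
      finally show ?thesis .
    qed
    then have "measure \<mu> (PiE {1..N} A) = measure \<pi> (PiE {1..N} A)"
      using main[of N A "\<lambda>_. 1"] A' sets by simp
    then show "emeasure \<mu> (PiE {1..N} A) = emeasure \<pi> (PiE {1..N} A)"
      by (simp add: m.emeasure_eq_measure p.emeasure_eq_measure)
  next
    show "range (\<lambda>_::nat. configs N) \<subseteq> prod_algebra {1..N} (\<lambda>_. restrict_space borel {0..})"
      by (auto intro!: prod_algebraI_finite simp: sets_restrict_space_iff)
  qed (auto simp: space_PiM space_restrict_space)
qed

lemma C0_bounded:
  assumes "f \<in> C0 N"
  shows "\<exists>B\<ge>0. \<forall>x\<in>configs N. \<bar>f x\<bar> \<le> B"
proof -
  have "\<forall>e>0. \<exists>R. \<forall>x\<in>configs N. (\<exists>i\<in>{1..N}. x i > R) \<longrightarrow> \<bar>f x\<bar> < e"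
    using assms by (simp add: C0_def)
  from this[rule_format, OF zero_less_one]
  obtain R where R: "\<And>x. x \<in> configs N \<Longrightarrow> \<exists>i\<in>{1..N}. x i > R \<Longrightarrow> \<bar>f x\<bar> < 1"
    by blast
  let ?K = "PiE {1..N} (\<lambda>_. {0..R}) :: (nat \<Rightarrow> real) set"
  have "compact (f ` ?K)"
  proof (rule compact_continuous_image[OF continuous_on_subset compact_PiE_Icc])
    show "continuous_on (configs N) f" using assms by (simp add: C0_def)
    show "?K \<subseteq> configs N" by (auto simp: PiE_iff)
  qed
  from compact_imp_bounded[OF this] obtain B where "\<forall>y\<in>f ` ?K. norm y \<le> B"
    unfolding bounded_iff ..
  from bspec[OF this, OF imageI] have B: "\<bar>f x\<bar> \<le> B" if "x \<in> ?K" for x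
    using that by simp
  have "\<bar>f x\<bar> \<le> max 1 B" if x: "x \<in> configs N" for x
  proof (cases "\<exists>i\<in>{1..N}. x i > R")
    case True
    from R[OF x this] show ?thesis by simp
  next
    case False
    then have "x \<in> ?K" using x by (auto simp: PiE_iff not_less)
    from B[OF this] show ?thesis by simp
  qed
  then show ?thesis by (intro exI[of _ "max 1 B"]) auto
qed

lemma C0_measurable: "f \<in> C0 N \<Longrightarrow> f \<in> borel_measurable (config_space N)"
  by (intro borel_measurable_config_space) (simp add: C0_def)

lemma closed_indicator_limit_C0:
  assumes "closed (C :: (nat \<Rightarrow> real) set)"
  obtains f where "\<And>n::nat. f n \<in> C0 N" "\<And>n x. x \<in> configs N \<Longrightarrow> f n x \<in> {0..1}"
    "\<And>x. x \<in> configs N \<Longrightarrow> (\<lambda>n. f n x) \<longlonglongrightarrow> indicator C x"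
proof (cases "C = {}")
  case True
  have "(\<lambda>_. 0) \<in> C0 N" by (simp add: C0_def)
  then show ?thesis using True that[of "\<lambda>n x. 0"] by simp
next
  case False
  define f where "f = (\<lambda>n x. max 0 (1 - real n * infdist x C) * (\<Prod>i=1..N. max 0 (min 1 (real n + 1 - x i))))"
  show ?thesis
  proof (rule that)
    fix n
    have "continuous_on (configs N) (f n)"
      unfolding f_def by (intro continuous_intros)
    moreover have "f n x = 0" if "\<exists>i\<in>{1..N}. x i > real n + 1" for x
      using that by (auto simp: f_def intro!: prod_zero bexI)
    ultimately show "f n \<in> C0 N"
      unfolding C0_def by (intro CollectI conjI allI impI exI[of _ "real n + 1"] ballI) simp_all
  next
    fix n x
    have "(\<Prod>i=1..N. max 0 (min 1 (real n + 1 - x i))) \<in> {0..1}"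
      by (auto intro!: prod_nonneg prod_le_1)
    moreover have "max 0 (1 - real n * infdist x C) \<in> {0..1}" by (auto simp: infdist_nonneg)
    ultimately show "f n x \<in> {0..1}" by (auto simp: f_def intro!: mult_le_one)
  next
    fix x
    have a: "(\<lambda>n. \<Prod>i=1..N. max 0 (min 1 (real n + 1 - x i))) \<longlonglongrightarrow> (\<Prod>i=1..N. 1)"
    proof (rule tendsto_prod)
      fix i
      have "\<forall>\<^sub>F n in sequentially. x i \<le> real n"
        using filterlim_real_sequentially unfolding filterlim_at_top by blast
      then have "\<forall>\<^sub>F n in sequentially. max 0 (min 1 (real n + 1 - x i)) = 1"
        by eventually_elim auto
      then show "(\<lambda>n. max 0 (min 1 (real n + 1 - x i))) \<longlonglongrightarrow> 1" by (rule tendsto_eventually)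
    qed
    have b: "(\<lambda>n. max 0 (1 - real n * infdist x C)) \<longlonglongrightarrow> indicator C x"
    proof (cases "x \<in> C")
      case False
      then have d: "0 < infdist x C"
        using in_closed_iff_infdist_zero[OF assms \<open>C \<noteq> {}\<close>] infdist_nonneg[of x C] by force
      have "\<forall>\<^sub>F n in sequentially. 1 / infdist x C \<le> real n"
        using filterlim_real_sequentially unfolding filterlim_at_top by blast
      then have "\<forall>\<^sub>F n in sequentially. max 0 (1 - real n * infdist x C) = 0"
        by eventually_elim (use d in \<open>simp add: field_simps\<close>)
      then show ?thesis using False by (simp add: tendsto_eventually)
    qed simp
    show "(\<lambda>n. f n x) \<longlonglongrightarrow> indicator C x"
      unfolding f_def using tendsto_mult[OF b a] by simp
  qed
qed

lemma sets_config_space_closed: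
  "sets (config_space N) = sigma_sets (configs N) ((\<inter>) (configs N) ` Collect closed)"
proof -
  have "closed (configs N)"
  proof -
    have "configs N = (\<Inter>i\<in>{1..N}. {x. 0 \<le> x i}) \<inter> (\<Inter>i\<in>-{1..N}. {x. x i = undefined})"
      by (auto simp: PiE_iff extensional_def)
    also have "closed \<dots>"
      by (intro closed_Int closed_INT ballI closed_Collect_le closed_Collect_eq continuous_intros)
    finally show ?thesis .
  qed
  then have "configs N \<in> sigma_sets UNIV (Collect closed)" by auto
  then have "(\<inter>) (configs N) ` sigma_sets UNIV (Collect closed)
      = sigma_sets (configs N) ((\<inter>) (configs N) ` Collect closed)"
    by (rule sigma_sets_Int) simp
  then show ?thesis
    by (simp add: sets_config_space sets_restrict_space borel_eq_closed)
qed

lemma Int_stable_config_closed: "Int_stable ((\<inter>) (configs N) ` Collect closed)"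
proof (rule Int_stableI)
  fix A B assume "A \<in> (\<inter>) (configs N) ` Collect closed" "B \<in> (\<inter>) (configs N) ` Collect closed"
  then obtain C D where "closed C" "A = configs N \<inter> C" "closed D" "B = configs N \<inter> D" by auto
  then show "A \<inter> B \<in> (\<inter>) (configs N) ` Collect closed"
    by (intro image_eqI[of _ _ "C \<inter> D"]) auto
qed

lemma measure_closed_limit:
  assumes M: "M \<in> space (prob_algebra (config_space N))" and C: "closed C"
    and f: "\<And>n::nat. f n \<in> C0 N" "\<And>n x. x \<in> configs N \<Longrightarrow> f n x \<in> {0..1}"
      "\<And>x. x \<in> configs N \<Longrightarrow> (\<lambda>n. f n x) \<longlonglongrightarrow> indicator C x"
  shows "(\<lambda>n. \<integral>x. f n x \<partial>M) \<longlonglongrightarrow> measure M (configs N \<inter> C)"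
proof -
  have sets: "sets M = sets (config_space N)" and "prob_space M" using M by (auto simp: space_prob_algebra)
  interpret prob_space M by fact
  have sp: "space M = configs N" using sets_eq_imp_space_eq[OF sets] by simp
  have m: "f n \<in> borel_measurable M" for n
    using C0_measurable[OF f(1)] measurable_cong_sets[OF sets refl] by blast
  have CM: "configs N \<inter> C \<in> sets M"
    unfolding sets sets_config_space_closed using C by auto
  have "(\<lambda>n. \<integral>x. f n x \<partial>M) \<longlonglongrightarrow> (\<integral>x. indicator (configs N \<inter> C) x \<partial>M)"
  proof (rule integral_dominated_convergence[where w = "\<lambda>_. 1"])
    show "AE x in M. (\<lambda>n. f n x) \<longlonglongrightarrow> indicator (configs N \<inter> C) x"
      using f(3) sp by (intro AE_I2) (auto simp: indicator_inter_arith)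
    show "AE x in M. norm (f n x) \<le> 1" for n
      using f(2) sp by (intro AE_I2) fastforce
  qed (use m CM in auto)
  then show ?thesis using CM sp by (simp add: Int_assoc Int_commute Int_left_commute)
qed

lemma measure_eqI_C0:
  assumes M: "M \<in> space (prob_algebra (config_space N))" "M' \<in> space (prob_algebra (config_space N))"
    and eq: "\<And>f. f \<in> C0 N \<Longrightarrow> (\<integral>x. f x \<partial>M) = (\<integral>x. f x \<partial>M')"
  shows "M = M'"
proof -
  have s: "sets M = sets (config_space N)" "sets M' = sets (config_space N)" and p: "prob_space M" "prob_space M'"
    using M by (auto simp: space_prob_algebra)
  interpret M: prob_space M by fact
  interpret M': prob_space M' by fact
  have e: "emeasure M A = emeasure M' A" if A: "A \<in> (\<inter>) (configs N) ` Collect closed" for A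
  proof -
    obtain C where C: "closed C" "A = configs N \<inter> C" using A by auto
    obtain f where f: "\<And>n::nat. f n \<in> C0 N" "\<And>n x. x \<in> configs N \<Longrightarrow> f n x \<in> {0..1}"
      "\<And>x. x \<in> configs N \<Longrightarrow> (\<lambda>n. f n x) \<longlonglongrightarrow> indicator C x"
      using closed_indicator_limit_C0[OF C(1), of N] by metis
    have "measure M A = measure M' A"
      using measure_closed_limit[OF M(1) C(1) f] measure_closed_limit[OF M(2) C(1) f]
      unfolding C(2) eq[OF f(1)] by (rule LIMSEQ_unique)
    then show ?thesis by (simp add: M.emeasure_eq_measure M'.emeasure_eq_measure)
  qed
  show ?thesis
  proof (rule measure_eqI_generator_eq[OF Int_stable_config_closed _ e])
    show "range (\<lambda>_::nat. configs N) \<subseteq> (\<inter>) (configs N) ` Collect closed"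
      by (auto intro!: image_eqI[of _ _ UNIV])
  qed (use s sets_config_space_closed in auto)
qed

lemma measurable_prob_algebra_C0:
  assumes K: "\<And>t. t \<in> space T \<Longrightarrow> K t \<in> space (prob_algebra (config_space N))"
    and meas: "\<And>f. f \<in> C0 N \<Longrightarrow> (\<lambda>t. \<integral>x. f x \<partial>K t) \<in> borel_measurable T"
  shows "K \<in> T \<rightarrow>\<^sub>M prob_algebra (config_space N)"
proof (rule measurable_prob_algebra_generated[OF sets_config_space_closed Int_stable_config_closed])
  fix A assume A: "A \<in> (\<inter>) (configs N) ` Collect closed"
  obtain C where C: "closed C" "A = configs N \<inter> C" using A by auto
  obtain f where f: "\<And>n::nat. f n \<in> C0 N" "\<And>n x. x \<in> configs N \<Longrightarrow> f n x \<in> {0..1}"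
    "\<And>x. x \<in> configs N \<Longrightarrow> (\<lambda>n. f n x) \<longlonglongrightarrow> indicator C x"
    using closed_indicator_limit_C0[OF C(1), of N] by metis
  have "(\<lambda>t. measure (K t) A) \<in> borel_measurable T"
    unfolding C(2)
    by (rule borel_measurable_LIMSEQ_real[OF measure_closed_limit[OF K C(1) f] meas[OF f(1)]])
  then have "(\<lambda>t. ennreal (measure (K t) A)) \<in> borel_measurable T" by measurable
  then show "(\<lambda>t. emeasure (K t) A) \<in> borel_measurable T"
    by (subst measurable_cong[where g = "\<lambda>t. ennreal (measure (K t) A)"])
      (use K in \<open>auto simp: space_prob_algebra prob_space_def finite_measure.emeasure_eq_measure\<close>)
qed (use K in \<open>auto simp: space_prob_algebra\<close>)

section \<open>Resolvent averages of a Feller semigroup\<close>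

lemma
  fixes \<kappa> :: real assumes "0 < \<kappa>"
  shows integrable_exponential_density: "integrable lborel (exponential_density \<kappa>)"
    and integral_exponential_density: "(\<integral>t. exponential_density \<kappa> t \<partial>lborel) = 1"
proof -
  interpret prob_space "density lborel (exponential_density \<kappa>)"
    by (rule prob_space_exponential_density[OF assms])
  have "(\<integral>\<^sup>+t. ennreal (exponential_density \<kappa> t) \<partial>lborel) = ennreal 1"
    using emeasure_space_1 by (simp add: emeasure_density)
  then have "has_bochner_integral lborel (exponential_density \<kappa>) 1"
    using assms by (intro has_bochner_integral_nn_integral) (auto simp: exponential_density_def)
  then show "integrable lborel (exponential_density \<kappa>)" "(\<integral>t. exponential_density \<kappa> t \<partial>lborel) = 1"
    by (auto simp: has_bochner_integral_iff)
qed

lemma integrable_exponential_density_mult: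
  fixes h :: "real \<Rightarrow> real"
  assumes "0 < \<kappa>" "h \<in> borel_measurable borel" "\<And>t. \<bar>h t\<bar> \<le> B"
  shows "integrable lborel (\<lambda>t. exponential_density \<kappa> t * h t)"
proof (rule Bochner_Integration.integrable_bound)
  show "integrable lborel (\<lambda>t. exponential_density \<kappa> t * B)"
    using integrable_exponential_density[OF assms(1)] by simp
  have "0 \<le> B" using assms(3)[of 0] by simp
  then show "AE t in lborel. norm (exponential_density \<kappa> t * h t) \<le> norm (exponential_density \<kappa> t * B)"
    using assms(1,3) by (intro AE_I2) (auto simp: abs_mult exponential_density_def intro!: mult_left_mono)
qed (use assms(2) in measurable)

lemma exponential_averages_const:
  fixes h :: "real \<Rightarrow> real"
  assumes h: "h \<in> borel_measurable borel" "\<And>t. \<bar>h t\<bar> \<le> B" and s: "0 \<le> s"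
    and avg: "\<And>\<kappa> t. 0 < \<kappa> \<Longrightarrow> 0 \<le> t \<Longrightarrow> (\<integral>r. exponential_density \<kappa> r * h (t + r) \<partial>lborel) = h t"
  shows "h s = h 0"
proof -
  have B: "0 \<le> B" using h(2)[of 0] by simp
  have bound: "\<bar>h s - h 0\<bar> \<le> B * (\<kappa> * s + (exp (\<kappa> * s) - 1))" if \<kappa>: "0 < \<kappa>" for \<kappa>
  proof -
    have hs: "integrable lborel (\<lambda>r. exponential_density \<kappa> r * h (s + r))"
      using h by (intro integrable_exponential_density_mult[OF \<kappa>]) auto
    have i1: "integrable lborel (\<lambda>t. exponential_density \<kappa> (t - s) * h t)"
      using lborel_integrable_real_affine[OF hs, of 1 "- s"] by (simp add: algebra_simps)
    have i0: "integrable lborel (\<lambda>t. exponential_density \<kappa> t * h t)"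
      using h by (intro integrable_exponential_density_mult[OF \<kappa>]) auto
    have e1: "h s = (\<integral>t. exponential_density \<kappa> (t - s) * h t \<partial>lborel)"
      using avg[OF \<kappa> s] lborel_integral_real_affine[of 1 "\<lambda>t. exponential_density \<kappa> (t - s) * h t" s] by simp
    have e0: "h 0 = (\<integral>t. exponential_density \<kappa> t * h t \<partial>lborel)"
      using avg[OF \<kappa>, of 0] by simp
    have "h s - h 0 = (\<integral>t. exponential_density \<kappa> (t - s) * h t - exponential_density \<kappa> t * h t \<partial>lborel)"
      unfolding e1 by (subst e0) (rule Bochner_Integration.integral_diff[OF i1 i0, symmetric])
    also have "\<bar>\<dots>\<bar> \<le> (\<integral>t. B * (\<kappa> * indicator {0..s} t + (exp (\<kappa> * s) - 1) * exponential_density \<kappa> t) \<partial>lborel)"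
    proof (rule order_trans[OF integral_abs_bound integral_mono])
      show "integrable lborel (\<lambda>t. B * (\<kappa> * indicator {0..s} t + (exp (\<kappa> * s) - 1) * exponential_density \<kappa> t))"
        using integrable_exponential_density[OF \<kappa>] s by simp
      fix t
      have p: "\<bar>exponential_density \<kappa> (t - s) - exponential_density \<kappa> t\<bar>
          \<le> \<kappa> * indicator {0..s} t + (exp (\<kappa> * s) - 1) * exponential_density \<kappa> t"
      proof -
        consider "t < 0" | "0 \<le> t" "t < s" | "s \<le> t" by linarith
        then show ?thesis
        proof cases
          case 2
          have z: "exponential_density \<kappa> (t - s) = 0" "indicator {0..s} t = (1 :: real)"
            using 2 by (auto simp: exponential_density_def)
          have "exponential_density \<kappa> t \<le> \<kappa>" "0 \<le> exponential_density \<kappa> t"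
            using 2 \<kappa> by (auto simp: exponential_density_def)
          moreover from this have "0 \<le> (exp (\<kappa> * s) - 1) * exponential_density \<kappa> t" using \<kappa> s by auto
          ultimately show ?thesis unfolding z by linarith
        next
          case 3
          have "exponential_density \<kappa> (t - s) - exponential_density \<kappa> t = (exp (\<kappa> * s) - 1) * exponential_density \<kappa> t"
            using 3 s by (simp add: exponential_density_def algebra_simps exp_diff exp_minus field_simps)
          moreover have "0 \<le> (exp (\<kappa> * s) - 1) * exponential_density \<kappa> t"
            using 3 s \<kappa> by (auto simp: exponential_density_def)
          moreover have "0 \<le> \<kappa> * indicator {0..s} t" using \<kappa> by simp
          ultimately show ?thesis by linarith
        qed (use s in \<open>simp add: exponential_density_def\<close>)
      qed
      have "\<bar>exponential_density \<kappa> (t - s) * h t - exponential_density \<kappa> t * h t\<bar>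
        = \<bar>exponential_density \<kappa> (t - s) - exponential_density \<kappa> t\<bar> * \<bar>h t\<bar>"
        by (simp add: abs_mult left_diff_distrib[symmetric])
      also have "\<dots> \<le> (\<kappa> * indicator {0..s} t + (exp (\<kappa> * s) - 1) * exponential_density \<kappa> t) * B"
        using p h(2) by (intro mult_mono) auto
      finally show "\<bar>exponential_density \<kappa> (t - s) * h t - exponential_density \<kappa> t * h t\<bar>
        \<le> B * (\<kappa> * indicator {0..s} t + (exp (\<kappa> * s) - 1) * exponential_density \<kappa> t)"
        by (simp add: mult.commute)
    qed (use i0 i1 in auto)
    also have "\<dots> = B * (\<kappa> * s + (exp (\<kappa> * s) - 1))"
      using integrable_exponential_density[OF \<kappa>] integral_exponential_density[OF \<kappa>] s by simp
    finally show ?thesis .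
  qed
  have "((\<lambda>\<kappa>. B * (\<kappa> * s + (exp (\<kappa> * s) - 1))) \<longlongrightarrow> B * (0 * s + (exp (0 * s) - 1))) (at_right 0)"
    by (intro tendsto_intros)
  then have "\<bar>h s - h 0\<bar> \<le> B * (0 * s + (exp (0 * s) - 1))"
    by (rule tendsto_lowerbound) (auto simp: eventually_at_filter bound)
  then show ?thesis by simp
qed

lemma integral_bind_kernel:
  fixes f :: "(nat \<Rightarrow> real) \<Rightarrow> real"
  assumes "prob_space M" "K \<in> M \<rightarrow>\<^sub>M prob_algebra (config_space N)"
    and "f \<in> borel_measurable (config_space N)" "\<And>x. x \<in> configs N \<Longrightarrow> \<bar>f x\<bar> \<le> B"
  shows "(\<integral>x. f x \<partial>(M \<bind> K)) = (\<integral>x. (\<integral>y. f y \<partial>K x) \<partial>M)"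
proof (rule integral_bind[where K = "config_space N" and B' = 1])
  show "finite_measure M" using assms(1) by (simp add: prob_space_def)
  show "AE x in M. emeasure (K x) (space (K x)) \<le> ennreal 1"
  proof (rule AE_I2)
    fix x assume "x \<in> space M"
    then have "prob_space (K x)" using measurable_space[OF assms(2)] by (auto simp: space_prob_algebra)
    then show "emeasure (K x) (space (K x)) \<le> ennreal 1" by (simp add: prob_space.emeasure_space_1)
  qed
qed (use assms in \<open>auto intro: measurable_prob_algebraD\<close>)

lemma integral_diff_le:
  fixes f g :: "(nat \<Rightarrow> real) \<Rightarrow> real"
  assumes M: "M \<in> space (prob_algebra (config_space N))"
    and "f \<in> borel_measurable (config_space N)" "g \<in> borel_measurable (config_space N)"
    and "\<And>x. x \<in> configs N \<Longrightarrow> \<bar>f x\<bar> \<le> B" "\<And>x. x \<in> configs N \<Longrightarrow> \<bar>g x\<bar> \<le> B'"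
    and "\<And>x. x \<in> configs N \<Longrightarrow> \<bar>f x - g x\<bar> \<le> e"
  shows "\<bar>(\<integral>x. f x \<partial>M) - (\<integral>x. g x \<partial>M)\<bar> \<le> e"
proof -
  have sets: "sets M = sets (config_space N)" and "prob_space M" using M by (auto simp: space_prob_algebra)
  interpret prob_space M by fact
  have sp: "space M = configs N" using sets_eq_imp_space_eq[OF sets] by simp
  have i: "integrable M f" "integrable M g"
  proof -
    have "f \<in> borel_measurable M" "g \<in> borel_measurable M"
      using assms(2,3) measurable_cong_sets[OF sets refl] by blast+
    then show "integrable M f" "integrable M g"
      using assms(4,5) sp
      by (auto intro!: integrable_const_bound[of f B] integrable_const_bound[of g B'] AE_I2)
  qed
  have "\<bar>(\<integral>x. f x \<partial>M) - (\<integral>x. g x \<partial>M)\<bar> = \<bar>\<integral>x. f x - g x \<partial>M\<bar>" using i by simp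
  also have "\<dots> \<le> (\<integral>x. e \<partial>M)"
    using i assms(6) sp by (intro order_trans[OF integral_abs_bound] integral_mono) auto
  also have "\<dots> = e" by (simp add: prob_space)
  finally show ?thesis .
qed

context
  fixes N :: nat and P :: "real \<Rightarrow> (nat \<Rightarrow> real) \<Rightarrow> (nat \<Rightarrow> real) measure" and \<mu> :: "(nat \<Rightarrow> real) measure"
  assumes feller: "feller_semigroup N P" and \<mu>: "\<mu> \<in> space (prob_algebra (config_space N))"
begin

lemma kernel: "0 \<le> t \<Longrightarrow> P t \<in> config_space N \<rightarrow>\<^sub>M prob_algebra (config_space N)"
  using feller by (simp add: feller_semigroup_def markov_semigroup_def)

lemma kernel_law: "0 \<le> t \<Longrightarrow> M \<in> space (prob_algebra (config_space N)) \<Longrightarrow>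
    M \<bind> P t \<in> space (prob_algebra (config_space N))"
  using prob_space_bind'[OF _ kernel] sets_bind'[OF _ kernel]
  unfolding space_prob_algebra[of "config_space N"] by blast

lemma C0_semigroup:
  assumes "f \<in> C0 N" "0 \<le> t" shows "(\<lambda>x. \<integral>y. f y \<partial>P t x) \<in> C0 N"
  using assms feller by (simp add: feller_semigroup_def)

lemma integral_kernel_law:
  assumes "f \<in> C0 N" "0 \<le> t" "M \<in> space (prob_algebra (config_space N))"
  shows "(\<integral>x. f x \<partial>(M \<bind> P t)) = (\<integral>x. (\<integral>y. f y \<partial>P t x) \<partial>M)"
proof -
  obtain B where "\<forall>x\<in>configs N. \<bar>f x\<bar> \<le> B" using C0_bounded[OF assms(1)] by blast
  moreover have "P t \<in> M \<rightarrow>\<^sub>M prob_algebra (config_space N)"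
    using kernel[OF assms(2)] assms(3) by (simp add: space_prob_algebra cong: measurable_cong_sets)
  ultimately show ?thesis
    using assms by (intro integral_bind_kernel[where B = B and N = N]) (auto simp: space_prob_algebra C0_measurable)
qed

lemma bind_semigroup_add:
  assumes "0 \<le> t" "0 \<le> r"
  shows "\<mu> \<bind> P (t + r) = (\<mu> \<bind> P t) \<bind> P r"
proof -
  have sets: "sets \<mu> = sets (config_space N)" using \<mu> by (simp add: space_prob_algebra)
  have "\<mu> \<bind> P (t + r) = \<mu> \<bind> (\<lambda>x. P t x \<bind> P r)"
    using assms feller sets_eq_imp_space_eq[OF sets]
    by (intro bind_cong_All) (auto simp: feller_semigroup_def markov_semigroup_def)
  also have "\<dots> = (\<mu> \<bind> P t) \<bind> P r"
    using kernel[OF assms(1)] kernel[OF assms(2)]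
    by (intro bind_assoc[symmetric, where N = "config_space N" and R = "config_space N"] measurable_prob_algebraD)
      (simp_all add: measurable_cong_sets[OF sets refl])
  finally show ?thesis .
qed

definition flow :: "((nat \<Rightarrow> real) \<Rightarrow> real) \<Rightarrow> real \<Rightarrow> real" where
  "flow f t = (\<integral>x. f x \<partial>(\<mu> \<bind> P (max 0 t)))"

lemma flow_add:
  assumes "f \<in> C0 N" "0 \<le> t" "0 \<le> r"
  shows "flow f (t + r) = (\<integral>x. (\<integral>y. f y \<partial>P r x) \<partial>(\<mu> \<bind> P t))"
  using assms integral_kernel_law[OF assms(1,3) kernel_law[OF assms(2) \<mu>]] bind_semigroup_add[of t r]
  by (simp add: flow_def)

lemma flow_0: "f \<in> C0 N \<Longrightarrow> flow f 0 = (\<integral>x. f x \<partial>\<mu>)"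
proof -
  assume f: "f \<in> C0 N"
  have sets: "sets \<mu> = sets (config_space N)" using \<mu> by (simp add: space_prob_algebra)
  have "(\<integral>y. f y \<partial>P 0 x) = f x" if "x \<in> space \<mu>" for x
    using that feller C0_measurable[OF f] sets_eq_imp_space_eq[OF sets]
    by (simp add: feller_semigroup_def markov_semigroup_def integral_return)
  then show ?thesis
    using integral_kernel_law[OF f _ \<mu>, of 0] by (simp add: flow_def cong: Bochner_Integration.integral_cong)
qed

lemma flow_bounded: "f \<in> C0 N \<Longrightarrow> \<exists>B. \<forall>t. \<bar>flow f t\<bar> \<le> B"
proof -
  assume f: "f \<in> C0 N"
  obtain B where B: "0 \<le> B" "\<forall>x\<in>configs N. \<bar>f x\<bar> \<le> B" using C0_bounded[OF f] by blast
  have "\<bar>flow f t\<bar> \<le> B" for t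
    using integral_diff_le[OF kernel_law[OF _ \<mu>, of "max 0 t"] C0_measurable[OF f], of "\<lambda>_. 0" B 0 B] B
    by (simp add: flow_def)
  then show ?thesis by blast
qed

lemma continuous_on_flow:
  assumes f: "f \<in> C0 N" shows "continuous_on {0..} (flow f)"
proof -
  have ul: "uniform_limit (configs N) (\<lambda>t x. \<integral>y. f y \<partial>P t x) f (at_right 0)"
    using feller f by (simp add: feller_semigroup_def)
  obtain B where B: "\<forall>x\<in>configs N. \<bar>f x\<bar> \<le> B" using C0_bounded[OF f] by blast
  show ?thesis unfolding continuous_on_iff
  proof (intro ballI allI impI)
    fix t e :: real assume t: "t \<in> {0..}" and e: "0 < e"
    have "\<forall>\<^sub>F r in at_right 0. \<forall>x\<in>configs N. dist (\<integral>y. f y \<partial>P r x) (f x) < e / 2"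
      using uniform_limitD[OF ul, of "e / 2"] e by simp
    then obtain d where d: "0 < d" "\<And>r x. 0 < r \<Longrightarrow> r < d \<Longrightarrow> x \<in> configs N \<Longrightarrow> dist (\<integral>y. f y \<partial>P r x) (f x) < e / 2"
      unfolding eventually_at_right_field by auto
    have close: "\<bar>flow f (t + r) - flow f t\<bar> \<le> e / 2" if "0 \<le> t" "0 < r" "r < d" for t r
    proof -
      have "0 \<le> r" using that by simp
      then obtain B' where B': "\<forall>x\<in>configs N. \<bar>\<integral>y. f y \<partial>P r x\<bar> \<le> B'"
        using C0_bounded[OF C0_semigroup[OF f]] by blast
      have "\<bar>(\<integral>x. (\<integral>y. f y \<partial>P r x) \<partial>(\<mu> \<bind> P t)) - (\<integral>x. f x \<partial>(\<mu> \<bind> P t))\<bar> \<le> e / 2"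
        using that d(2)[of r] B B'
        by (intro integral_diff_le[OF kernel_law[OF _ \<mu>], where B = B' and B' = B] C0_measurable f C0_semigroup)
          (auto simp: dist_real_def less_imp_le)
      then show ?thesis using flow_add[OF f that(1), of r] that by (simp add: flow_def)
    qed
    show "\<exists>d>0. \<forall>t'\<in>{0..}. dist t' t < d \<longrightarrow> dist (flow f t') (flow f t) < e"
    proof (intro exI[of _ d] conjI ballI impI d(1))
      fix t' assume t': "t' \<in> {0..}" "dist t' t < d"
      consider "t < t'" | "t' < t" | "t' = t" by linarith
      then show "dist (flow f t') (flow f t) < e"
        using close[of t "t' - t"] close[of t' "t - t'"] t t' e
        by cases (auto simp: dist_real_def abs_if split: if_splits)
    qed
  qed
qed

lemma flow_derivative:
  assumes gen: "(f, g) \<in> inf_generator N P" and t: "0 \<le> t"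
  shows "(flow f has_real_derivative flow g t) (at t within {0..})"
proof -
  have f: "f \<in> C0 N" and g: "g \<in> C0 N"
    and ul: "uniform_limit (configs N) (\<lambda>t x. ((\<integral>y. f y \<partial>P t x) - f x) / t) g (at_right 0)"
    using gen by (auto simp: inf_generator_def)
  obtain B where B: "\<forall>x\<in>configs N. \<bar>f x\<bar> \<le> B" using C0_bounded[OF f] by blast
  obtain C where C: "\<forall>x\<in>configs N. \<bar>g x\<bar> \<le> C" using C0_bounded[OF g] by blast
  show ?thesis unfolding has_field_derivative_iff
  proof (rule tendstoI)
    fix e :: real assume e: "0 < e"
    have "\<forall>\<^sub>F r in at_right 0. \<forall>x\<in>configs N. dist (((\<integral>y. f y \<partial>P r x) - f x) / r) (g x) < e / 3"
      using uniform_limitD[OF ul, of "e / 3"] e by simp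
    then obtain d where d: "0 < d" "\<And>r x. 0 < r \<Longrightarrow> r < d \<Longrightarrow> x \<in> configs N \<Longrightarrow>
        dist (((\<integral>y. f y \<partial>P r x) - f x) / r) (g x) < e / 3"
      unfolding eventually_at_right_field by auto
    have close: "\<bar>(flow f (t + r) - flow f t) / r - flow g t\<bar> \<le> e / 3" if "0 \<le> t" "0 < r" "r < d" for t r
    proof -
      have "0 \<le> r" using that by simp
      then obtain B' where B': "\<forall>x\<in>configs N. \<bar>\<integral>y. f y \<partial>P r x\<bar> \<le> B'"
        using C0_bounded[OF C0_semigroup[OF f]] by blast
      have b: "\<bar>((\<integral>y. f y \<partial>P r x) - f x) / r\<bar> \<le> (B' + B) / r" if "x \<in> configs N" for x
        using B B' that \<open>0 < r\<close> by (auto simp: abs_divide intro!: divide_right_mono order_trans[OF abs_triangle_ineq4] add_mono)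
      have M: "\<mu> \<bind> P t \<in> space (prob_algebra (config_space N))" using kernel_law[OF _ \<mu>] that by simp
      then have sets: "sets (\<mu> \<bind> P t) = sets (config_space N)" and "prob_space (\<mu> \<bind> P t)"
        by (auto simp: space_prob_algebra)
      interpret M: prob_space "\<mu> \<bind> P t" by fact
      have sp: "space (\<mu> \<bind> P t) = configs N" using sets_eq_imp_space_eq[OF sets] by simp
      have m: "f \<in> borel_measurable (config_space N)" "(\<lambda>x. \<integral>y. f y \<partial>P r x) \<in> borel_measurable (config_space N)"
        using that by (auto intro!: C0_measurable f C0_semigroup)
      have mM: "f \<in> borel_measurable (\<mu> \<bind> P t)" "(\<lambda>x. \<integral>y. f y \<partial>P r x) \<in> borel_measurable (\<mu> \<bind> P t)"
        using m by (simp_all only: measurable_cong_sets[OF sets refl])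
      have "integrable (\<mu> \<bind> P t) f"
        using B sp mM(1) by (intro M.integrable_const_bound[where B = B] AE_I2) auto
      moreover have "integrable (\<mu> \<bind> P t) (\<lambda>x. \<integral>y. f y \<partial>P r x)"
        using B' sp mM(2) by (intro M.integrable_const_bound[where B = B'] AE_I2) auto
      ultimately have "(flow f (t + r) - flow f t) / r = (\<integral>x. ((\<integral>y. f y \<partial>P r x) - f x) / r \<partial>(\<mu> \<bind> P t))"
        using flow_add[OF f that(1), of r] that by (simp add: flow_def)
      moreover have "\<bar>(\<integral>x. ((\<integral>y. f y \<partial>P r x) - f x) / r \<partial>(\<mu> \<bind> P t)) - (\<integral>x. g x \<partial>(\<mu> \<bind> P t))\<bar> \<le> e / 3"
        using d(2)[OF that(2,3)] b C m
        by (intro integral_diff_le[OF M, where B = "(B' + B) / r" and B' = C] C0_measurable[OF g]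
            borel_measurable_divide borel_measurable_diff borel_measurable_const)
          (auto simp: dist_real_def less_imp_le)
      ultimately show ?thesis using that by (simp add: flow_def)
    qed
    obtain d' where d': "0 < d'" "\<And>y. 0 \<le> y \<Longrightarrow> dist y t < d' \<Longrightarrow> dist (flow g y) (flow g t) < e / 3"
      using continuous_on_flow[OF g] t e unfolding continuous_on_iff
      by (metis atLeast_iff divide_pos_pos zero_less_numeral)
    show "\<forall>\<^sub>F y in at t within {0..}. dist ((flow f y - flow f t) / (y - t)) (flow g t) < e"
      unfolding eventually_at
    proof (intro exI[of _ "min d d'"] conjI ballI impI)
      show "0 < min d d'" using d d' by simp
      fix y assume y: "y \<in> {0..}" "y \<noteq> t \<and> dist y t < min d d'"
      show "dist ((flow f y - flow f t) / (y - t)) (flow g t) < e"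
      proof (cases "t < y")
        case True
        then show ?thesis using close[of t "y - t"] y t e by (auto simp: dist_real_def)
      next
        case False
        then have "\<bar>(flow f t - flow f y) / (t - y) - flow g y\<bar> \<le> e / 3"
          using close[of y "t - y"] y t by (auto simp: dist_real_def)
        moreover have "(flow f t - flow f y) / (t - y) = (flow f y - flow f t) / (y - t)"
          by (metis minus_diff_eq minus_divide_divide)
        moreover have "\<bar>flow g y - flow g t\<bar> < e / 3" using d'(2)[of y] y by (auto simp: dist_real_def)
        ultimately show ?thesis using e unfolding dist_real_def by linarith
      qed
    qed
  qed
qed

definition resolvent_law :: "real \<Rightarrow> (nat \<Rightarrow> real) measure" where
  "resolvent_law \<kappa> = density lborel (exponential_density \<kappa>) \<bind> (\<lambda>t. \<mu> \<bind> P (max 0 t))"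

lemma flow_measurable: "f \<in> C0 N \<Longrightarrow> flow f \<in> borel_measurable borel"
proof -
  assume f: "f \<in> C0 N"
  have "continuous_on UNIV (\<lambda>t. flow f (max 0 t))"
    by (rule continuous_on_compose2[OF continuous_on_flow[OF f]]) (auto intro!: continuous_intros)
  moreover have "flow f (max 0 t) = flow f t" for t by (simp add: flow_def)
  ultimately show ?thesis by (simp add: borel_measurable_continuous_onI)
qed

lemma flow_kernel: "(\<lambda>t. \<mu> \<bind> P (max 0 t)) \<in> borel \<rightarrow>\<^sub>M prob_algebra (config_space N)"
  using flow_measurable kernel_law[OF _ \<mu>] unfolding flow_def
  by (intro measurable_prob_algebra_C0) auto

lemma resolvent_law: "0 < \<kappa> \<Longrightarrow> resolvent_law \<kappa> \<in> space (prob_algebra (config_space N))"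
  using prob_space_bind'[of "density lborel (exponential_density \<kappa>)" borel, OF _ flow_kernel]
    sets_bind'[of "density lborel (exponential_density \<kappa>)" borel, OF _ flow_kernel]
    prob_space_exponential_density[of \<kappa>]
  by (simp add: space_prob_algebra resolvent_law_def)

lemma integral_resolvent_law:
  assumes "f \<in> C0 N" "0 < \<kappa>"
  shows "(\<integral>x. f x \<partial>resolvent_law \<kappa>) = (\<integral>t. exponential_density \<kappa> t * flow f t \<partial>lborel)"
proof -
  obtain B where B: "\<forall>x\<in>configs N. \<bar>f x\<bar> \<le> B" using C0_bounded[OF assms(1)] by blast
  have "(\<integral>x. f x \<partial>resolvent_law \<kappa>) = (\<integral>t. flow f t \<partial>density lborel (exponential_density \<kappa>))"
    unfolding resolvent_law_def flow_def
    using B prob_space_exponential_density[OF assms(2)] flow_kernel C0_measurable[OF assms(1)]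
    by (intro integral_bind_kernel[where B = B and N = N]) auto
  also have "\<dots> = (\<integral>t. exponential_density \<kappa> t * flow f t \<partial>lborel)"
    using flow_measurable[OF assms(1)] assms(2)
    by (subst integral_density) (auto simp: exponential_density_def)
  finally show ?thesis .
qed

lemma resolvent_law_equation:
  assumes gen: "(f, g) \<in> inf_generator N P" and \<kappa>: "0 < \<kappa>"
  shows "\<kappa> * ((\<integral>x. f x \<partial>resolvent_law \<kappa>) - (\<integral>x. f x \<partial>\<mu>)) = (\<integral>x. g x \<partial>resolvent_law \<kappa>)"
proof -
  have f: "f \<in> C0 N" and g: "g \<in> C0 N" using gen by (auto simp: inf_generator_def)
  obtain B where B: "\<And>t. \<bar>flow f t\<bar> \<le> B" using flow_bounded[OF f] by blast
  obtain C where C: "\<And>t. \<bar>flow g t\<bar> \<le> C" using flow_bounded[OF g] by blast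
  have i: "integrable lborel (\<lambda>t. exponential_density \<kappa> t * flow f t)"
    "integrable lborel (\<lambda>t. exponential_density \<kappa> t * flow g t)"
    using flow_measurable[OF f] flow_measurable[OF g] B C
    by (auto intro!: integrable_exponential_density_mult[OF \<kappa>])
  define \<Phi> where "\<Phi> = (\<lambda>t. exponential_density \<kappa> t * flow f t - exponential_density \<kappa> t * flow g t / \<kappa>)"
  have \<Phi>: "integrable lborel \<Phi>" unfolding \<Phi>_def using i by simp
  have FTC: "(\<integral>t. indicator {..T} t *\<^sub>R \<Phi> t \<partial>lborel) = flow f 0 - exp (- (\<kappa> * T)) * flow f T" if T: "0 \<le> T" for T
  proof -
    have "(\<integral>t. indicator {..T} t *\<^sub>R \<Phi> t \<partial>lborel)
        = (\<integral>t. indicator {0..T} t *\<^sub>R (exp (- (\<kappa> * t)) * (\<kappa> * flow f t - flow g t)) \<partial>lborel)"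
      using \<kappa> by (intro Bochner_Integration.integral_cong)
        (auto simp: \<Phi>_def exponential_density_def field_simps split: split_indicator)
    also have "\<dots> = - exp (- (\<kappa> * T)) * flow f T - - exp (- (\<kappa> * 0)) * flow f 0"
    proof (rule integral_FTC_atLeastAtMost[OF T])
      fix t assume t: "0 \<le> t" "t \<le> T"
      have "((\<lambda>t. - exp (- (\<kappa> * t)) * flow f t) has_real_derivative
          (\<kappa> * exp (- (\<kappa> * t))) * flow f t + flow g t * - exp (- (\<kappa> * t))) (at t within {0..T})"
        by (intro DERIV_mult DERIV_subset[OF flow_derivative[OF gen t(1)]])
          (auto intro!: derivative_eq_intros)
      then show "((\<lambda>t. - exp (- (\<kappa> * t)) * flow f t) has_vector_derivative
          exp (- (\<kappa> * t)) * (\<kappa> * flow f t - flow g t)) (at t within {0..T})"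
        unfolding has_real_derivative_iff_has_vector_derivative[symmetric] by (simp add: algebra_simps)
    next
      show "continuous_on {0..T} (\<lambda>t. exp (- (\<kappa> * t)) * (\<kappa> * flow f t - flow g t))"
        by (intro continuous_intros continuous_on_subset[OF continuous_on_flow[OF f]]
            continuous_on_subset[OF continuous_on_flow[OF g]]) auto
    qed
    finally show ?thesis by simp
  qed
  have "((\<lambda>T. exp (- (\<kappa> * T)) * flow f T) \<longlongrightarrow> 0) at_top"
  proof (rule Lim_null_comparison)
    show "\<forall>\<^sub>F T in at_top. norm (exp (- (\<kappa> * T)) * flow f T) \<le> exp (- (\<kappa> * T)) * B"
      using B by (simp add: abs_mult)
    have "((\<lambda>T. exp (- (\<kappa> * T))) \<longlongrightarrow> 0) at_top"
      using \<kappa> by (intro filterlim_compose[OF exp_at_bot] filterlim_compose[OF filterlim_uminus_at_bot_at_top]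
          filterlim_tendsto_pos_mult_at_top[OF tendsto_const] filterlim_ident) auto
    then show "((\<lambda>T. exp (- (\<kappa> * T)) * B) \<longlongrightarrow> 0) at_top" by (rule tendsto_mult_left_zero)
  qed
  then have "((\<lambda>T. flow f 0 - exp (- (\<kappa> * T)) * flow f T) \<longlongrightarrow> flow f 0 - 0) at_top"
    by (intro tendsto_diff tendsto_const)
  moreover have "\<forall>\<^sub>F T in at_top. flow f 0 - exp (- (\<kappa> * T)) * flow f T = (\<integral>t. indicator {..T} t *\<^sub>R \<Phi> t \<partial>lborel)"
    using eventually_ge_at_top[of 0] by eventually_elim (simp only: FTC)
  ultimately have "((\<lambda>T. \<integral>t. indicator {..T} t *\<^sub>R \<Phi> t \<partial>lborel) \<longlongrightarrow> flow f 0 - 0) at_top"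
    by (rule Lim_transform_eventually)
  moreover have "((\<lambda>T. \<integral>t. indicator {..T} t *\<^sub>R \<Phi> t \<partial>lborel) \<longlongrightarrow> (\<integral>t. \<Phi> t \<partial>lborel)) at_top"
    by (rule tendsto_integral_at_top) (use \<Phi> in auto)
  ultimately have "(\<integral>t. \<Phi> t \<partial>lborel) = flow f 0 - 0"
    by (intro tendsto_unique[of at_top]) auto
  moreover have "(\<integral>t. \<Phi> t \<partial>lborel) = (\<integral>x. f x \<partial>resolvent_law \<kappa>) - (\<integral>x. g x \<partial>resolvent_law \<kappa>) / \<kappa>"
    unfolding \<Phi>_def using i by (simp add: integral_resolvent_law f g \<kappa>)
  ultimately show ?thesis using \<kappa> flow_0[OF f] by (simp add: field_simps)
qed

lemma invariant_if_resolvent_laws_constant: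
  assumes "\<And>\<kappa>. 0 < \<kappa> \<Longrightarrow> resolvent_law \<kappa> = \<mu>"
  shows "invariant_measure N P \<mu>"
  unfolding invariant_measure_def
proof (intro conjI \<mu> allI impI)
  fix s :: real assume s: "0 \<le> s"
  show "\<mu> \<bind> P s = \<mu>"
  proof (rule measure_eqI_C0[OF kernel_law[OF s \<mu>] \<mu>])
    fix f assume f: "f \<in> C0 N"
    obtain B where B: "\<And>t. \<bar>flow f t\<bar> \<le> B" using flow_bounded[OF f] by blast
    have "flow f s = flow f 0"
    proof (rule exponential_averages_const[OF flow_measurable[OF f] B s])
      fix \<kappa> t :: real assume \<kappa>: "0 < \<kappa>" and t: "0 \<le> t"
      let ?f = "\<lambda>x. \<integral>y. f y \<partial>P t x"
      have f': "?f \<in> C0 N" by (rule C0_semigroup[OF f t])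
      have shift: "flow ?f r = flow f (t + r)" if "0 \<le> r" for r
        using flow_add[OF f that t] that by (simp add: flow_def add.commute)
      have "(\<integral>r. exponential_density \<kappa> r * flow f (t + r) \<partial>lborel) = (\<integral>r. exponential_density \<kappa> r * flow ?f r \<partial>lborel)"
        using shift by (intro Bochner_Integration.integral_cong) (auto simp: exponential_density_def)
      also have "\<dots> = (\<integral>x. ?f x \<partial>\<mu>)"
        using integral_resolvent_law[OF f' \<kappa>] assms[OF \<kappa>] by simp
      also have "\<dots> = flow f t"
        using integral_kernel_law[OF f t \<mu>] t by (simp add: flow_def)
      finally show "(\<integral>r. exponential_density \<kappa> r * flow f (t + r) \<partial>lborel) = flow f t" .
    qed
    then show "(\<integral>x. f x \<partial>(\<mu> \<bind> P s)) = (\<integral>x. f x \<partial>\<mu>)"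
      using flow_0[OF f] s by (simp add: flow_def)
  qed
qed

lemma invariant_equation:
  assumes inv: "invariant_measure N P \<mu>" and gen: "(f, g) \<in> inf_generator N P"
  shows "(\<integral>x. g x \<partial>\<mu>) = 0"
proof -
  have f: "f \<in> C0 N" and g: "g \<in> C0 N" using gen by (auto simp: inf_generator_def)
  have "flow h t = (\<integral>x. h x \<partial>\<mu>)" for h t
    using inv by (simp add: flow_def invariant_measure_def)
  then have "(flow f has_real_derivative (\<integral>x. g x \<partial>\<mu>)) (at 0 within {0..})" "flow f = (\<lambda>_. \<integral>x. f x \<partial>\<mu>)"
    using flow_derivative[OF gen, of 0] by auto
  then have "((\<lambda>_. \<integral>x. f x \<partial>\<mu>) has_real_derivative (\<integral>x. g x \<partial>\<mu>)) (at (0::real) within {0..})" by simp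
  then have "((\<lambda>_. \<integral>x. f x \<partial>\<mu>) has_real_derivative (\<integral>x. g x \<partial>\<mu>)) (at_right (0::real))"
    by (rule DERIV_subset) auto
  moreover have "((\<lambda>_. \<integral>x. f x \<partial>\<mu>) has_real_derivative 0) (at_right (0::real))" by simp
  ultimately show ?thesis
    by (auto simp: has_field_derivative_iff dest: tendsto_unique[OF trivial_limit_at_right_real])
qed

end

section \<open>Truncated duality functions\<close>

text \<open>
  The factor \<open>q (l\<^sub>i x\<^sub>i)\<close> is positive everywhere. Composing it with the cutoff gives a compactly
  supported function; the square makes it \<open>C\<^sup>1\<close>, and its Lipschitz constant does not depend on \<open>c\<close>.
\<close>

definition cutoff :: "real \<Rightarrow> real \<Rightarrow> real" where
  "cutoff c p = (max 0 (p - c))\<^sup>2 / p"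

lemma cutoff_0: "0 < p \<Longrightarrow> cutoff 0 p = p"
  by (simp add: cutoff_def power2_eq_square)

lemma cutoff_eq_0: "p \<le> c \<Longrightarrow> cutoff c p = 0"
  by (simp add: cutoff_def)

lemma cutoff_bounds:
  assumes "0 \<le> c" "0 < p" shows "0 \<le> cutoff c p" "cutoff c p \<le> p"
proof -
  show "0 \<le> cutoff c p" using assms by (simp add: cutoff_def)
  have "(max 0 (p - c))\<^sup>2 \<le> p\<^sup>2" using assms by (intro power_mono) auto
  then show "cutoff c p \<le> p" using assms by (simp add: cutoff_def divide_le_eq power2_eq_square)
qed

lemma cutoff_lipschitz:
  assumes "0 \<le> c" "0 < p" "0 < r" shows "\<bar>cutoff c p - cutoff c r\<bar> \<le> \<bar>p - r\<bar>"
  using assms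
proof (induction p r rule: linorder_wlog)
  case (le r p)
  show ?case
  proof (cases "r \<le> c")
    case True
    then have r: "cutoff c r = 0" by (rule cutoff_eq_0)
    have "cutoff c p \<le> p - r"
    proof (cases "p \<le> c")
      case False
      have "(p - c)\<^sup>2 \<le> (p - c) * p" unfolding power2_eq_square using False le by (intro mult_left_mono) auto
      then have "cutoff c p \<le> p - c" using False le by (simp add: cutoff_def divide_le_eq)
      then show ?thesis using True by simp
    qed (use le in \<open>simp add: cutoff_eq_0\<close>)
    then show ?thesis using cutoff_bounds(1)[of c p] le r by simp
  next
    case False
    have e: "cutoff c x = x - 2 * c + c\<^sup>2 / x" if "c < x" for x
      using that le by (simp add: cutoff_def power2_eq_square field_simps)
    have "c\<^sup>2 \<le> p * r" unfolding power2_eq_square using False le by (intro mult_mono) auto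
    then have "0 \<le> 1 - c\<^sup>2 / (p * r)" "1 - c\<^sup>2 / (p * r) \<le> 1" using le by (auto simp: divide_le_eq)
    note w = this
    have "0 \<le> (p - r) * (1 - c\<^sup>2 / (p * r))"
      using le by (intro mult_nonneg_nonneg w) simp
    moreover have "(p - r) * (1 - c\<^sup>2 / (p * r)) \<le> (p - r) * 1"
      using le by (intro mult_left_mono w) simp
    moreover have "cutoff c p - cutoff c r = (p - r) * (1 - c\<^sup>2 / (p * r))"
    proof -
      have "c\<^sup>2 / p - c\<^sup>2 / r = - ((p - r) * (c\<^sup>2 / (p * r)))"
        using le by (simp add: field_simps)
      moreover have "cutoff c p = p - 2 * c + c\<^sup>2 / p" "cutoff c r = r - 2 * c + c\<^sup>2 / r"
        using False le by (auto intro!: e)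
      ultimately have "cutoff c p - cutoff c r = (p - r) - (p - r) * (c\<^sup>2 / (p * r))" by linarith
      also have "\<dots> = (p - r) * (1 - c\<^sup>2 / (p * r))"
        using right_diff_distrib[of "p - r" 1 "c\<^sup>2 / (p * r)"] by simp
      finally show ?thesis .
    qed
    ultimately show ?thesis using le by simp
  qed
qed (simp add: abs_minus_commute)

lemma tendsto_cutoff:
  assumes "0 < p" shows "(\<lambda>n. cutoff (1 / Suc n) p) \<longlonglongrightarrow> cutoff 0 p"
  unfolding cutoff_def using assms
  by (intro tendsto_intros LIMSEQ_inverse_real_of_nat[unfolded inverse_eq_divide]) simp

lemma cutoff_measurable [measurable]: "cutoff c \<in> borel_measurable borel"
  unfolding cutoff_def by measurable

lemma has_derivative_max_power2: "((\<lambda>y::real. (max 0 y)\<^sup>2) has_real_derivative 2 * max 0 y) (at y)"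
proof -
  consider "y < 0" | "0 < y" | "y = 0" by linarith
  then show ?thesis
  proof cases
    case 1
    have "((\<lambda>y::real. 0) has_real_derivative 0) (at y)" by simp
    then have "((\<lambda>y::real. (max 0 y)\<^sup>2) has_real_derivative 0) (at y)"
      by (rule has_field_derivative_transform_within_open[where S = "{..<0}"]) (use 1 in auto)
    then show ?thesis using 1 by simp
  next
    case 2
    have "((\<lambda>y::real. y\<^sup>2) has_real_derivative 2 * y) (at y)"
      by (auto intro!: derivative_eq_intros)
    then have "((\<lambda>y::real. (max 0 y)\<^sup>2) has_real_derivative 2 * y) (at y)"
      by (rule has_field_derivative_transform_within_open[where S = "{0<..}"]) (use 2 in auto)
    then show ?thesis using 2 by simp
  next
    case 3
    have "((\<lambda>h. ((max 0 h)\<^sup>2 - 0) / h) \<longlongrightarrow> 0) (at (0::real))"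
    proof (rule Lim_null_comparison)
      show "\<forall>\<^sub>F h in at 0. norm (((max 0 h)\<^sup>2 - 0) / h) \<le> \<bar>h::real\<bar>"
        by (rule always_eventually) (auto simp: max_def power2_eq_square)
      show "((\<lambda>h::real. \<bar>h\<bar>) \<longlongrightarrow> 0) (at 0)" by (auto intro!: tendsto_eq_intros)
    qed
    then show ?thesis using 3 by (simp add: has_field_derivative_iff)
  qed
qed

definition cutoff_deriv :: "real \<Rightarrow> real \<Rightarrow> real" where
  "cutoff_deriv c p = 2 * max 0 (p - c) / p - (max 0 (p - c))\<^sup>2 / p\<^sup>2"

lemma has_derivative_cutoff:
  assumes "0 < p" shows "(cutoff c has_real_derivative cutoff_deriv c p) (at p)"
proof -
  have "((\<lambda>p. (max 0 (p - c))\<^sup>2) has_real_derivative 2 * max 0 (p - c) * 1) (at p)"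
    by (rule DERIV_chain2[OF has_derivative_max_power2]) (auto intro!: derivative_eq_intros)
  from DERIV_divide[OF this DERIV_ident] show ?thesis
    using assms unfolding cutoff_def[abs_def] cutoff_deriv_def
    by (auto simp: field_simps power2_eq_square)
qed

locale profile =
  fixes q q' :: "real \<Rightarrow> real" and k :: real
  assumes q_pos: "0 \<le> z \<Longrightarrow> 0 < q z" and q_le_1: "0 \<le> z \<Longrightarrow> q z \<le> 1"
    and q_deriv: "0 \<le> z \<Longrightarrow> (q has_real_derivative q' z) (at z)"
    and q'_cont: "continuous_on {0..} q'"
    and q_lim: "(q \<longlongrightarrow> 0) at_top"
    and q'_bound: "0 \<le> z \<Longrightarrow> z * \<bar>q' z\<bar> \<le> k"
    and q_meas [measurable]: "q \<in> borel_measurable borel"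
begin

lemma q_cont: "continuous_on {0..} q"
  by (rule continuous_at_imp_continuous_on) (auto intro: DERIV_isCont q_deriv)

lemma k_nonneg: "0 \<le> k"
  using q'_bound[of 0] by simp

lemma q_lipschitz:
  assumes l: "0 < l" and v: "0 \<le> v" and u: "0 < u" "u < 1" and x: "0 \<le> x"
  shows "\<bar>q ((l - u * l + u * v) * x) - q (l * x)\<bar> \<le> (2 + 2 * k * \<bar>v - l\<bar> / l) * u"
proof -
  define m where "m = l - u * l + u * v"
  have m: "m = (1 - u) * l + u * v" by (simp add: m_def algebra_simps)
  have m0: "0 \<le> m" unfolding m using l v u by simp
  have K: "0 \<le> k * \<bar>v - l\<bar> / l" using k_nonneg l by simp
  show ?thesis
  proof (cases "u \<le> 1 / 2")
    case True
    have ml: "l / 2 \<le> m" unfolding m using True l v u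
      by (intro add_increasing2) (auto simp: field_simps)
    have mv: "\<exists>y>s. y < t \<and> q t - q s = (t - s) * q' y" if "0 \<le> s" "s < t" for s t
      using MVT2[of s t q q'] q_deriv that by force
    have "\<exists>y. min (m * x) (l * x) \<le> y \<and> q (m * x) - q (l * x) = (m * x - l * x) * q' y"
    proof (rule linorder_cases[of "m * x" "l * x"])
      assume lt: "m * x < l * x"
      obtain y where "m * x < y" "q (l * x) - q (m * x) = (l * x - m * x) * q' y"
        using mv[OF _ lt] m0 x by auto
      then show ?thesis using lt by (intro exI[of _ y]) (simp add: left_diff_distrib min_def)
    next
      assume lt: "l * x < m * x"
      obtain y where "l * x < y" "q (m * x) - q (l * x) = (m * x - l * x) * q' y"
        using mv[OF _ lt] l x by auto
      then show ?thesis using lt by (intro exI[of _ y]) simp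
    qed auto
    then obtain y where y: "min (m * x) (l * x) \<le> y" "q (m * x) - q (l * x) = (m * x - l * x) * q' y" by blast
    have "l / 2 * x \<le> m * x" by (rule mult_right_mono[OF ml x])
    moreover have "l / 2 * x \<le> l * x" using l x by (intro mult_right_mono) auto
    ultimately have ly: "l / 2 * x \<le> y" using y(1) by linarith
    moreover have "0 \<le> l / 2 * x" using l x by simp
    ultimately have y0: "0 \<le> y" by linarith
    have xy: "x \<le> 2 / l * y" using ly l by (simp add: field_simps)
    have "\<bar>q (m * x) - q (l * x)\<bar> = (u * \<bar>v - l\<bar>) * (x * \<bar>q' y\<bar>)"
    proof -
      have "m * x - l * x = u * (v - l) * x" by (simp add: m algebra_simps)
      then show ?thesis unfolding y(2) using u x by (simp add: abs_mult)
    qed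
    also have "\<dots> \<le> (u * \<bar>v - l\<bar>) * (2 / l * y * \<bar>q' y\<bar>)"
      using xy u by (intro mult_left_mono mult_right_mono) auto
    also have "\<dots> \<le> (u * \<bar>v - l\<bar>) * (2 / l * k)"
      using q'_bound[OF y0] l u by (intro mult_left_mono) (auto simp: mult.assoc intro!: mult_left_mono divide_right_mono)
    also have "\<dots> \<le> (2 + 2 * k * \<bar>v - l\<bar> / l) * u"
      using u K by (simp add: field_simps)
    finally show ?thesis by (simp add: m_def)
  next
    case False
    have "\<bar>q (m * x) - q (l * x)\<bar> \<le> 1"
      using q_pos[of "m * x"] q_le_1[of "m * x"] q_pos[of "l * x"] q_le_1[of "l * x"] m0 l x by auto
    also have "\<dots> \<le> 2 * u" using False by simp
    also have "\<dots> \<le> (2 + 2 * k * \<bar>v - l\<bar> / l) * u"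
      using u K by (intro mult_right_mono) auto
    finally show ?thesis by (simp add: m_def)
  qed
qed

definition test :: "nat \<Rightarrow> real \<Rightarrow> (nat \<Rightarrow> real) \<Rightarrow> (nat \<Rightarrow> real) \<Rightarrow> real" where
  "test N c l x = (\<Prod>i=1..N. cutoff c (q (l i * x i)))"

definition kern :: "nat \<Rightarrow> (nat \<Rightarrow> real) \<Rightarrow> (nat \<Rightarrow> real) \<Rightarrow> real" where
  "kern N l x = (\<Prod>i=1..N. q (l i * x i))"

lemma kern_commute: "kern N l x = kern N x l"
  by (simp add: kern_def mult.commute)

lemma prod_q_mult_pos:
  assumes "x \<in> configs N" "l \<in> configs N" "i \<in> {1..N}"
  shows "0 < q (l i * x i)" "q (l i * x i) \<le> 1"
  using assms by (auto intro!: q_pos q_le_1 simp: PiE_iff)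

lemma test_0: "x \<in> configs N \<Longrightarrow> l \<in> configs N \<Longrightarrow> test N 0 l x = kern N l x"
  unfolding test_def kern_def by (intro prod.cong refl cutoff_0 prod_q_mult_pos)

lemma kern_bounds: "x \<in> configs N \<Longrightarrow> l \<in> configs N \<Longrightarrow> 0 \<le> kern N l x \<and> kern N l x \<le> 1"
  unfolding kern_def using prod_q_mult_pos[of x N l]
  by (intro conjI prod_nonneg prod_le_1; simp add: less_imp_le)

lemma kern_split:
  assumes "i \<in> {1..N}" shows "kern N l x = q (l i * x i) * (\<Prod>j\<in>{1..N} - {i}. q (l j * x j))"
  unfolding kern_def using assms by (simp add: prod.remove[of _ i])

lemma test_update:
  assumes "i \<in> {1..N}"
  shows "test N c l (x(i := v)) = cutoff c (q (l i * v)) * (\<Prod>j\<in>{1..N} - {i}. cutoff c (q (l j * x j)))"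
  unfolding test_def using assms by (simp add: prod.remove[of _ i])

lemma test_bounds:
  assumes "0 \<le> c" "x \<in> configs N" "l \<in> configs N" "J \<subseteq> {1..N}"
  shows "0 \<le> (\<Prod>j\<in>J. cutoff c (q (l j * x j)))"
    "(\<Prod>j\<in>J. cutoff c (q (l j * x j))) \<le> (\<Prod>j\<in>J. q (l j * x j))"
    "(\<Prod>j\<in>J. q (l j * x j)) \<le> 1"
proof -
  have p: "0 < q (l j * x j)" "q (l j * x j) \<le> 1" if "j \<in> J" for j
    using prod_q_mult_pos[OF assms(2,3)] that assms(4) by blast+
  show "0 \<le> (\<Prod>j\<in>J. cutoff c (q (l j * x j)))"
    using cutoff_bounds(1)[OF assms(1)] p by (intro prod_nonneg) auto
  show "(\<Prod>j\<in>J. cutoff c (q (l j * x j))) \<le> (\<Prod>j\<in>J. q (l j * x j))"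
    using cutoff_bounds[OF assms(1)] p by (intro prod_mono) auto
  show "(\<Prod>j\<in>J. q (l j * x j)) \<le> 1"
    using p by (intro prod_le_1) (auto intro: less_imp_le)
qed

lemma test_C1c:
  assumes c: "0 < c" and l: "l \<in> configs N" "\<forall>i\<in>{1..N}. 0 < l i"
  shows "test N c l \<in> C1c N"
proof -
  have mult: "l i * x i \<in> {0..}" if "x \<in> configs N" "i \<in> {1..N}" for x i
    using that l by (auto simp: PiE_iff less_imp_le)
  have cq: "continuous_on (configs N) (\<lambda>x. q (l i * x i))" if "i \<in> {1..N}" for i
    using mult that by (intro continuous_on_compose2[OF q_cont] continuous_intros) auto
  have cq': "continuous_on (configs N) (\<lambda>x. q' (l i * x i))" if "i \<in> {1..N}" for i
    using mult that by (intro continuous_on_compose2[OF q'_cont] continuous_intros) auto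
  have qn: "q (l i * x i) \<noteq> 0" if "x \<in> configs N" "i \<in> {1..N}" for x i
    using prod_q_mult_pos(1)[OF that(1) l(1) that(2)] by simp
  have cc: "continuous_on (configs N) (\<lambda>x. cutoff c (q (l i * x i)))" if "i \<in> {1..N}" for i
    unfolding cutoff_def using qn that by (intro continuous_intros cq) auto
  have cd: "continuous_on (configs N) (\<lambda>x. cutoff_deriv c (q (l i * x i)))" if "i \<in> {1..N}" for i
    unfolding cutoff_deriv_def using qn that by (intro continuous_intros cq) auto
  define D where "D = (\<lambda>i x. cutoff_deriv c (q (l i * x i)) * (q' (l i * x i) * l i)
      * (\<Prod>j\<in>{1..N} - {i}. cutoff c (q (l j * x j))))"
  have "continuous_on (configs N) (test N c l)"
    unfolding test_def by (intro continuous_on_prod cc) auto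
  moreover have "continuous_on (configs N) (D i)" if "i \<in> {1..N}" for i
    unfolding D_def using that by (intro continuous_on_mult continuous_on_prod cc cd cq' continuous_on_const) auto
  moreover have "((\<lambda>r. test N c l (x(i := r))) has_real_derivative D i x) (at (x i) within {0..})"
    if i: "i \<in> {1..N}" and x: "x \<in> configs N" for i x
  proof -
    have 0: "0 \<le> l i * x i" using mult[OF x i] by simp
    have "((\<lambda>r. l i * r) has_real_derivative l i) (at (x i))"
      by (auto intro!: derivative_eq_intros)
    from DERIV_chain2[where f = q and g = "\<lambda>r. l i * r", OF q_deriv[OF 0] this]
    have "((\<lambda>r. q (l i * r)) has_real_derivative q' (l i * x i) * l i) (at (x i))" .
    from DERIV_chain2[where f = "cutoff c" and g = "\<lambda>r. q (l i * r)", OF has_derivative_cutoff[OF q_pos[OF 0]] this]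
    have "((\<lambda>r. cutoff c (q (l i * r))) has_real_derivative
        cutoff_deriv c (q (l i * x i)) * (q' (l i * x i) * l i)) (at (x i))" .
    then show ?thesis
      unfolding test_update[OF i] D_def by (rule has_field_derivative_at_within[OF DERIV_cmult_right])
  qed
  moreover have "\<exists>R. \<forall>x\<in>configs N. (\<exists>i\<in>{1..N}. x i > R) \<longrightarrow> test N c l x = 0"
  proof -
    have "\<forall>\<^sub>F z in at_top. q z < c" using order_tendstoD(2)[OF q_lim c] .
    then obtain R where R: "\<And>z. R \<le> z \<Longrightarrow> q z < c" unfolding eventually_at_top_linorder by blast
    define R' where "R' = (\<Sum>i=1..N. \<bar>R\<bar> / l i)"
    have "test N c l x = 0" if x: "x \<in> configs N" and i: "i \<in> {1..N}" "x i > R'" for x i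
    proof -
      have li: "0 < l i" using l i by blast
      have "\<bar>R\<bar> / l i \<le> R'"
        unfolding R'_def using l(2) i by (intro member_le_sum) (auto intro!: divide_nonneg_pos)
      then have "\<bar>R\<bar> / l i < x i" using i by simp
      then have "\<bar>R\<bar> < l i * x i" using li by (simp add: divide_less_eq mult.commute)
      then have "q (l i * x i) < c" by (intro R) linarith
      then have "cutoff c (q (l i * x i)) = 0" by (intro cutoff_eq_0) simp
      then show ?thesis unfolding test_def using i by (intro prod_zero) auto
    qed
    then show ?thesis by blast
  qed
  ultimately show ?thesis unfolding C1c_def by (intro CollectI conjI exI[of _ D] ballI)
qed

lemma tendsto_test:
  assumes "x \<in> configs N" "l \<in> configs N"
  shows "(\<lambda>n. test N (1 / Suc n) l x) \<longlonglongrightarrow> kern N l x"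
  unfolding test_0[OF assms, symmetric] unfolding test_def
  by (intro tendsto_prod tendsto_cutoff prod_q_mult_pos(1)[OF assms])

lemma kern_measurable:
  assumes "\<And>i. i \<in> {1..N} \<Longrightarrow> (\<lambda>w. l w i) \<in> borel_measurable M"
    "\<And>i. i \<in> {1..N} \<Longrightarrow> (\<lambda>w. x w i) \<in> borel_measurable M"
  shows "(\<lambda>w. kern N (l w) (x w)) \<in> borel_measurable M"
  unfolding kern_def using assms
  by (intro borel_measurable_prod measurable_compose[OF _ q_meas] borel_measurable_times) auto

lemma test_measurable:
  assumes "\<And>i. i \<in> {1..N} \<Longrightarrow> (\<lambda>w. x w i) \<in> borel_measurable M"
  shows "(\<lambda>w. test N c l (x w)) \<in> borel_measurable M"
  unfolding test_def using assms
  by (intro borel_measurable_prod measurable_compose[OF _ cutoff_measurable] measurable_compose[OF _ q_meas] borel_measurable_times) auto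

lemma kern_lipschitz:
  assumes l: "l \<in> configs N" "\<forall>i\<in>{1..N}. 0 < l i" and i: "i \<in> {1..N}" and v: "0 \<le> v"
    and u: "0 < u" "u < 1" and x: "x \<in> configs N"
  shows "\<bar>kern N (l(i := l i - u * l i + u * v)) x - kern N l x\<bar> \<le> (2 + 2 * k * \<bar>v - l i\<bar> / l i) * u"
proof -
  let ?R = "\<Prod>j\<in>{1..N} - {i}. q (l j * x j)"
  have "kern N (l(i := l i - u * l i + u * v)) x = q ((l i - u * l i + u * v) * x i) * ?R"
    unfolding kern_split[OF i] by simp
  then have "\<bar>kern N (l(i := l i - u * l i + u * v)) x - kern N l x\<bar>
      = \<bar>q ((l i - u * l i + u * v) * x i) - q (l i * x i)\<bar> * \<bar>?R\<bar>"
    unfolding kern_split[OF i, of l] by (simp add: left_diff_distrib[symmetric] abs_mult)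
  also have "\<dots> \<le> \<bar>q ((l i - u * l i + u * v) * x i) - q (l i * x i)\<bar> * 1"
    using test_bounds[OF order_refl x l(1), of "{1..N} - {i}"] by (intro mult_left_mono) auto
  also have "\<dots> \<le> (2 + 2 * k * \<bar>v - l i\<bar> / l i) * u"
    using q_lipschitz[of "l i" v u "x i"] l i v u x by (auto simp: PiE_iff)
  finally show ?thesis .
qed

section \<open>The equation satisfied by the transform\<close>

definition transform :: "nat \<Rightarrow> (nat \<Rightarrow> real) measure \<Rightarrow> (nat \<Rightarrow> real) \<Rightarrow> real" where
  "transform N M l = (\<integral>x. kern N l x \<partial>M)"

context
  fixes N :: nat and M :: "(nat \<Rightarrow> real) measure"
  assumes M: "M \<in> space (prob_algebra (config_space N))"
begin

lemma M_prob: "prob_space M" and M_sets [measurable_cong]: "sets M = sets (config_space N)" and M_space: "space M = configs N"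
  using M sets_eq_imp_space_eq[of M "config_space N"] by (auto simp: space_prob_algebra)

lemma M_coordinate [measurable]: "i \<in> {1..N} \<Longrightarrow> (\<lambda>x. x i) \<in> borel_measurable M"
  using measurable_coordinate[of i N] measurable_cong_sets[OF M_sets refl] by blast

lemma kern_integrable: "l \<in> configs N \<Longrightarrow> integrable M (kern N l)"
  using kern_bounds[of _ N l] M_space
  by (intro finite_measure.integrable_const_bound[OF prob_space.finite_measure[OF M_prob], where B = 1] AE_I2 kern_measurable M_coordinate)
    auto

lemma continuous_on_transform: "continuous_on (configs N) (transform N M)"
  unfolding continuous_on_sequentially
proof (intro allI ballI impI, elim conjE)
  fix X l assume l: "l \<in> configs N" and X: "\<forall>n. X n \<in> configs N" "X \<longlonglongrightarrow> l"
  interpret prob_space M by (rule M_prob)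
  show "(transform N M \<circ> X) \<longlonglongrightarrow> transform N M l"
    unfolding comp_def transform_def
  proof (rule integral_dominated_convergence[where w = "\<lambda>_. 1"])
    show "kern N l \<in> borel_measurable M" "kern N (X n) \<in> borel_measurable M" for n
      by (intro kern_measurable M_coordinate; simp)+
    show "AE x in M. norm (kern N (X n) x) \<le> 1" for n
      using kern_bounds[OF _ X(1)[rule_format, of n]] M_space by (intro AE_I2) auto
    show "AE x in M. (\<lambda>n. kern N (X n) x) \<longlonglongrightarrow> kern N l x"
    proof (rule AE_I2)
      fix x assume "x \<in> space M"
      then have x: "x \<in> configs N" using M_space by simp
      show "(\<lambda>n. kern N (X n) x) \<longlonglongrightarrow> kern N l x"
        unfolding kern_def
      proof (rule tendsto_prod)
        fix i assume i: "i \<in> {1..N}"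
        have "(\<lambda>n. X n i) \<longlonglongrightarrow> l i"
          using continuous_on_tendsto_compose[OF continuous_on_coordinate[of UNIV i] X(2)] by simp
        then have "(\<lambda>n. X n i * x i) \<longlonglongrightarrow> l i * x i" by (intro tendsto_intros)
        moreover have "isCont q (l i * x i)"
          using l x i by (intro DERIV_isCont[OF q_deriv]) (auto simp: PiE_iff)
        ultimately show "(\<lambda>n. q (X n i * x i)) \<longlonglongrightarrow> q (l i * x i)" by (rule isCont_tendsto_compose[rotated])
      qed
    qed
  qed simp
qed

lemma transform_lipschitz:
  assumes l: "l \<in> configs N" "\<forall>i\<in>{1..N}. 0 < l i" and i: "i \<in> {1..N}" and v: "0 \<le> v"
    and u: "0 < u" "u < 1"
  shows "\<bar>transform N M (l(i := l i - u * l i + u * v)) - transform N M l\<bar> \<le> (2 + 2 * k * \<bar>v - l i\<bar> / l i) * u"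
  unfolding transform_def
  using kern_lipschitz[OF l i v u] kern_bounds[OF _ jump_config[OF l(1) i v u]] kern_bounds[OF _ l(1)]
  by (intro integral_diff_le[OF M, where B = 1 and B' = 1] kern_measurable measurable_coordinate) auto

lemma
  assumes a: "0 < a" and l: "l \<in> configs N" "\<forall>i\<in>{1..N}. 0 < l i" and i: "i \<in> {1..N}" and v: "0 \<le> v"
  shows transform_jump_integrable: "jump_integrable a (transform N M) l i v"
    and kern_jump_integrable: "x \<in> configs N \<Longrightarrow> jump_integrable a (kern N x) l i v"
    and integrable_kern_jump: "integrable M (\<lambda>x. jump_integral a (kern N x) l i v)"
    and transform_jump: "jump_integral a (transform N M) l i v = (\<integral>x. jump_integral a (kern N x) l i v \<partial>M)"
proof -
  define K where "K = 2 + 2 * k * \<bar>v - l i\<bar> / l i"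
  define l' where "l' = (\<lambda>u. l(i := l i - u * l i + u * v))"
  have l': "l' u \<in> configs N" if "0 < u" "u < 1" for u
    unfolding l'_def by (rule jump_config[OF l(1) i v that])
  have lip: "\<bar>kern N x (l' u) - kern N x l\<bar> \<le> K * u" if "0 < u" "u < 1" "x \<in> configs N" for u x
    unfolding l'_def K_def kern_commute[of N x] by (rule kern_lipschitz[OF l i v that])
  have l'm: "(\<lambda>u. l' u j) \<in> borel_measurable borel" for j
    unfolding l'_def fun_upd_def by (cases "j = i") simp_all
  show "jump_integrable a (transform N M) l i v"
    unfolding jump_integrable_def
    by (rule set_integrable_rate(1)[OF a borel_measurable_jump[OF continuous_on_transform l(1) i v]
          transform_lipschitz[OF l i v]])
  show "jump_integrable a (kern N x) l i v" if x: "x \<in> configs N" for x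
    unfolding jump_integrable_def
  proof (rule set_integrable_rate(1)[OF a])
    show "(\<lambda>u. kern N x (l(i := l i - u * l i + u * v)) - kern N x l) \<in> borel_measurable (restrict_space borel {0<..<1})"
      using l'm by (intro measurable_restrict_space1 borel_measurable_diff kern_measurable)
        (auto simp: l'_def)
  qed (use lip x in \<open>simp add: l'_def\<close>)
  interpret prob_space M by (rule M_prob)
  interpret pair: pair_sigma_finite lborel M
    by (simp add: pair_sigma_finite_def sigma_finite_lborel sigma_finite_measure_axioms)
  define F where "F = (\<lambda>(u, x). indicator {0<..<1} u *\<^sub>R ((1 - u) powr (a - 1) / u * (kern N x (l' u) - kern N x l)))"
  have Fm: "F \<in> borel_measurable (lborel \<Otimes>\<^sub>M M)"
  proof -
    have "(\<lambda>p. kern N (snd p) (l' (fst p))) \<in> borel_measurable (lborel \<Otimes>\<^sub>M M)"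
      using measurable_compose[OF measurable_fst l'm] measurable_compose[OF measurable_snd M_coordinate]
      by (intro kern_measurable) (auto simp: measurable_cong_sets[OF sets_pair_measure_cong[OF sets_lborel refl] refl])
    moreover have "(\<lambda>p. kern N (snd p) l) \<in> borel_measurable (lborel \<Otimes>\<^sub>M M)"
      using measurable_compose[OF measurable_snd M_coordinate] by (intro kern_measurable) auto
    ultimately show ?thesis unfolding F_def case_prod_beta' by measurable
  qed
  have Fi: "integrable (lborel \<Otimes>\<^sub>M M) F"
  proof (rule pair.Fubini_integrable[OF Fm])
    have F1: "\<bar>F (u, x)\<bar> \<le> indicator {0<..<1} u *\<^sub>R (K * (1 - u) powr (a - 1))" if "x \<in> configs N" for u x
    proof (cases "0 < u \<and> u < 1")
      case True
      then have "\<bar>F (u, x)\<bar> = (1 - u) powr (a - 1) / u * \<bar>kern N x (l' u) - kern N x l\<bar>"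
        by (simp add: F_def abs_mult)
      also have "\<dots> \<le> (1 - u) powr (a - 1) / u * (K * u)"
        using True lip that by (intro mult_left_mono) auto
      finally show ?thesis using True by (simp add: field_simps)
    qed (auto simp: F_def)
    have Ki: "integrable lborel (\<lambda>u. indicator {0<..<1} u *\<^sub>R (K * (1 - u) powr (a - 1)))"
      using set_integrable_mult_right[OF set_integrable_one_minus_powr[OF a], of K]
      by (simp add: set_integrable_def)
    have Fx: "integrable M (\<lambda>x. F (u, x))" for u
      using F1 M_space measurable_Pair2[OF Fm, of u]
      by (intro integrable_const_bound[where B = "indicator {0<..<1} u *\<^sub>R (K * (1 - u) powr (a - 1))"] AE_I2) auto
    then show "AE u in lborel. integrable M (\<lambda>x. F (u, x))" by simp
    show "integrable lborel (\<lambda>u. \<integral>x. norm (F (u, x)) \<partial>M)"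
    proof (rule Bochner_Integration.integrable_bound[OF Ki])
      show "(\<lambda>u. \<integral>x. norm (F (u, x)) \<partial>M) \<in> borel_measurable lborel"
        using Fm by (intro borel_measurable_lebesgue_integral) (simp add: case_prod_beta')
      show "AE u in lborel. norm (\<integral>x. norm (F (u, x)) \<partial>M) \<le> norm (indicator {0<..<1} u *\<^sub>R (K * (1 - u) powr (a - 1)))"
      proof (rule AE_I2)
        fix u
        have "(\<integral>x. norm (F (u, x)) \<partial>M) \<le> (\<integral>x. indicator {0<..<1} u *\<^sub>R (K * (1 - u) powr (a - 1)) \<partial>M)"
          using F1 M_space Fx by (intro integral_mono) auto
        also have "\<dots> = indicator {0<..<1} u *\<^sub>R (K * (1 - u) powr (a - 1))" by (simp add: prob_space)
        finally show "norm (\<integral>x. norm (F (u, x)) \<partial>M) \<le> norm (indicator {0<..<1} u *\<^sub>R (K * (1 - u) powr (a - 1)))"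
          by (simp add: order_trans[OF _ abs_ge_self])
      qed
    qed
  qed
  have J: "jump_integral a (kern N x) l i v = (\<integral>u. F (u, x) \<partial>lborel)" for x
    by (simp add: jump_integral_def set_lebesgue_integral_def F_def l'_def)
  show "integrable M (\<lambda>x. jump_integral a (kern N x) l i v)"
    unfolding J using pair.integrable_snd[of "\<lambda>u x. F (u, x)"] Fi by simp
  have "jump_integral a (transform N M) l i v = (\<integral>u. (\<integral>x. F (u, x) \<partial>M) \<partial>lborel)"
    unfolding jump_integral_def set_lebesgue_integral_def
  proof (rule Bochner_Integration.integral_cong[OF refl])
    fix u :: real
    show "indicator {0<..<1} u *\<^sub>R ((1 - u) powr (a - 1) / u * (transform N M (l(i := l i - u * l i + u * v)) - transform N M l))
      = (\<integral>x. F (u, x) \<partial>M)"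
    proof (cases "0 < u \<and> u < 1")
      case True
      have e: "l(i := l i - u * l i + u * v) = l' u" by (simp add: l'_def)
      have c: "kern N x (l' u) = kern N (l' u) x" "kern N x l = kern N l x" for x
        by (rule kern_commute)+
      have "integrable M (kern N l)" "integrable M (kern N (l' u))"
        using True by (auto intro!: kern_integrable l l')
      then show ?thesis using True unfolding e F_def transform_def by (simp add: c)
    qed (auto simp: F_def)
  qed
  also have "\<dots> = (\<integral>x. (\<integral>u. F (u, x) \<partial>lborel) \<partial>M)"
    using pair.Fubini_integral[of "\<lambda>u x. F (u, x)"] Fi by simp
  finally show "jump_integral a (transform N M) l i v = (\<integral>x. jump_integral a (kern N x) l i v \<partial>M)"
    by (simp add: J)
qed

end

end

lemma set_integral_dominated_convergence_at_top:
  fixes f :: "nat \<Rightarrow> real \<Rightarrow> real"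
  assumes "\<And>n. f n \<in> borel_measurable (restrict_space borel S)" "g \<in> borel_measurable (restrict_space borel S)"
    and S: "S \<in> sets borel" and w: "set_integrable lborel S w"
    and bound: "\<And>n u. u \<in> S \<Longrightarrow> \<bar>f n u\<bar> \<le> w u" and lim: "\<And>u. u \<in> S \<Longrightarrow> (\<lambda>n. f n u) \<longlonglongrightarrow> g u"
  shows "(\<lambda>n. LBINT u:S. f n u) \<longlonglongrightarrow> (LBINT u:S. g u)" "\<And>n. set_integrable lborel S (f n)"
    "\<And>n. \<bar>LBINT u:S. f n u\<bar> \<le> (LBINT u:S. w u)"
proof -
  have m: "(\<lambda>u. indicator S u *\<^sub>R f n u) \<in> borel_measurable lborel" "(\<lambda>u. indicator S u *\<^sub>R g u) \<in> borel_measurable lborel" for n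
    using assms(1,2) S by (auto simp: borel_measurable_restrict_space_iff)
  show "(\<lambda>n. LBINT u:S. f n u) \<longlonglongrightarrow> (LBINT u:S. g u)"
    unfolding set_lebesgue_integral_def
    by (rule integral_dominated_convergence[OF m(2) m(1) w[unfolded set_integrable_def]])
      (auto simp: bound lim split: split_indicator)
  show i: "set_integrable lborel S (f n)" for n
    unfolding set_integrable_def
    by (rule Bochner_Integration.integrable_bound[OF w[unfolded set_integrable_def] m(1)])
      (auto simp: order_trans[OF bound abs_ge_self] split: split_indicator)
  show "\<bar>LBINT u:S. f n u\<bar> \<le> (LBINT u:S. w u)" for n
    using set_integral_norm_bound[OF i, of n] set_integral_mono[OF set_integrable_abs[OF i] w, of n] bound
    by (auto intro: order_trans)
qed

lemma boundary_nonneg: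
  assumes "x \<in> configs N" "0 \<le> l" "0 \<le> r" "i \<le> N + 1"
  shows "0 \<le> boundary N l r x i"
  using assms by (cases "i \<in> {1..N}") (auto simp: boundary_def PiE_iff)

lemma boundary_neighbours:
  assumes "x \<in> configs N" "0 \<le> l" "0 \<le> r" "i \<in> {1..N}"
  shows "0 \<le> boundary N l r x (i - 1)" "0 \<le> boundary N l r x (i + 1)"
  using assms by (auto intro!: boundary_nonneg)

context profile
begin

lemma hidden_generator_transform:
  assumes s: "0 < s" and N: "1 \<le> N" and M: "M \<in> space (prob_algebra (config_space N))"
    and l: "l \<in> configs N" "\<forall>i\<in>{1..N}. 0 < l i"
  shows "integrable M (\<lambda>x. hidden_generator s N 0 0 (kern N x) l)"
    "hidden_generator s N 0 0 (transform N M) l = (\<integral>x. hidden_generator s N 0 0 (kern N x) l \<partial>M)"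
proof -
  have a: "0 < 2 * s" using s by simp
  let ?b = "boundary N 0 0 l"
  note b = boundary_neighbours[OF l(1) order_refl order_refl]
  let ?J = "\<lambda>x. \<Sum>i=1..N. jump_integral (2 * s) (kern N x) l i (?b (i - 1)) + jump_integral (2 * s) (kern N x) l i (?b (i + 1))"
  have sp: "space M = configs N" by (rule M_space[OF M])
  have e: "hidden_generator s N 0 0 (kern N x) l = ?J x" if "x \<in> space M" for x
    using that sp b by (intro hidden_generator_eq_sum[OF N] ballI conjI kern_jump_integrable[OF M a l]) auto
  have i: "integrable M (\<lambda>x. jump_integral (2 * s) (kern N x) l i (?b (i - 1)))"
    "integrable M (\<lambda>x. jump_integral (2 * s) (kern N x) l i (?b (i + 1)))" if "i \<in> {1..N}" for i
    using that b by (auto intro!: integrable_kern_jump[OF M a l])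
  have "integrable M ?J" using i by (intro Bochner_Integration.integrable_sum Bochner_Integration.integrable_add) auto
  then show "integrable M (\<lambda>x. hidden_generator s N 0 0 (kern N x) l)"
    using e by (subst Bochner_Integration.integrable_cong[OF refl e]) auto
  have "hidden_generator s N 0 0 (transform N M) l
      = (\<Sum>i=1..N. jump_integral (2 * s) (transform N M) l i (?b (i - 1)) + jump_integral (2 * s) (transform N M) l i (?b (i + 1)))"
    using b by (intro hidden_generator_eq_sum[OF N] ballI conjI transform_jump_integrable[OF M a l]) auto
  also have "\<dots> = (\<Sum>i=1..N. \<integral>x. jump_integral (2 * s) (kern N x) l i (?b (i - 1)) + jump_integral (2 * s) (kern N x) l i (?b (i + 1)) \<partial>M)"
    using b i by (intro sum.cong refl) (simp add: transform_jump[OF M a l])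
  also have "\<dots> = (\<integral>x. ?J x \<partial>M)"
    using i by (subst Bochner_Integration.integral_sum) auto
  also have "\<dots> = (\<integral>x. hidden_generator s N 0 0 (kern N x) l \<partial>M)"
    using e by (intro Bochner_Integration.integral_cong) auto
  finally show "hidden_generator s N 0 0 (transform N M) l = (\<integral>x. hidden_generator s N 0 0 (kern N x) l \<partial>M)" .
qed

lemma hidden_generator_transform_diff:
  assumes s: "0 < s" and N: "1 \<le> N"
    and M: "M \<in> space (prob_algebra (config_space N))" "M' \<in> space (prob_algebra (config_space N))"
    and l: "l \<in> configs N" "\<forall>i\<in>{1..N}. 0 < l i"
  shows "hidden_generator s N 0 0 (\<lambda>l. transform N M l - transform N M' l) l
    = hidden_generator s N 0 0 (transform N M) l - hidden_generator s N 0 0 (transform N M') l"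
proof -
  have a: "0 < 2 * s" using s by simp
  let ?b = "boundary N 0 0 l" and ?D = "\<lambda>l. transform N M l - transform N M' l"
  note b = boundary_neighbours[OF l(1) order_refl order_refl]
  have J: "jump_integrable (2 * s) ?D l i v"
    "jump_integral (2 * s) ?D l i v = jump_integral (2 * s) (transform N M) l i v - jump_integral (2 * s) (transform N M') l i v"
    if "i \<in> {1..N}" "0 \<le> v" for i v
    using set_integral_diff[OF transform_jump_integrable[OF M(1) a l that, unfolded jump_integrable_def]
        transform_jump_integrable[OF M(2) a l that, unfolded jump_integrable_def]]
    by (simp_all add: jump_integrable_def jump_integral_def algebra_simps)
  have "hidden_generator s N 0 0 ?D l = (\<Sum>i=1..N. jump_integral (2 * s) ?D l i (?b (i - 1)) + jump_integral (2 * s) ?D l i (?b (i + 1)))"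
    using b by (intro hidden_generator_eq_sum[OF N] ballI conjI J(1)) auto
  also have "\<dots> = (\<Sum>i=1..N. jump_integral (2 * s) (transform N M) l i (?b (i - 1)) + jump_integral (2 * s) (transform N M) l i (?b (i + 1)))
      - (\<Sum>i=1..N. jump_integral (2 * s) (transform N M') l i (?b (i - 1)) + jump_integral (2 * s) (transform N M') l i (?b (i + 1)))"
    unfolding sum_subtractf[symmetric] using b by (intro sum.cong refl) (simp add: J(2))
  also have "(\<Sum>i=1..N. jump_integral (2 * s) (transform N M) l i (?b (i - 1)) + jump_integral (2 * s) (transform N M) l i (?b (i + 1)))
      = hidden_generator s N 0 0 (transform N M) l"
    using b by (intro hidden_generator_eq_sum[OF N, symmetric] ballI conjI transform_jump_integrable[OF M(1) a l]) auto
  also have "(\<Sum>i=1..N. jump_integral (2 * s) (transform N M') l i (?b (i - 1)) + jump_integral (2 * s) (transform N M') l i (?b (i + 1)))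
      = hidden_generator s N 0 0 (transform N M') l"
    using b by (intro hidden_generator_eq_sum[OF N, symmetric] ballI conjI transform_jump_integrable[OF M(2) a l]) auto
  finally show ?thesis .
qed

lemma transform_le:
  assumes s: "0 < s" and N: "1 \<le> N"
    and M: "M \<in> space (prob_algebra (config_space N))" "M' \<in> space (prob_algebra (config_space N))"
    and V: "\<And>l. l \<in> configs N \<Longrightarrow> 0 \<le> V l"
    and eq: "\<And>l. l \<in> configs N \<Longrightarrow> \<forall>i\<in>{1..N}. 0 < l i \<Longrightarrow>
      hidden_generator s N 0 0 (transform N M) l - hidden_generator s N 0 0 (transform N M') l
      = V l * (transform N M l - transform N M' l)"
    and l: "l \<in> configs N" "\<forall>i\<in>{1..N}. 0 < l i"
  shows "transform N M l \<le> transform N M' l"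
proof -
  let ?D = "\<lambda>l. transform N M l - transform N M' l"
  have "?D l \<le> 0"
  proof (rule hidden_maximum_principle[OF s N _ _ _ _ l])
    show "continuous_on (configs N) ?D"
      by (intro continuous_on_diff continuous_on_transform M)
    have "kern N (\<lambda>i\<in>{1..N}. 0) = (\<lambda>x. q 0 ^ N)" by (simp add: kern_def fun_eq_iff)
    then have "transform N m (\<lambda>i\<in>{1..N}. 0) = q 0 ^ N" if "m = M \<or> m = M'" for m
      unfolding transform_def using that prob_space.prob_space[OF M_prob[OF M(1)]] prob_space.prob_space[OF M_prob[OF M(2)]] by auto
    then show "?D (\<lambda>i\<in>{1..N}. 0) = 0" by simp
  next
    fix x i and v :: real assume x: "x \<in> configs N" "\<forall>j\<in>{1..N}. 0 < x j" "i \<in> {1..N}" "0 \<le> v"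
    let ?K = "2 + 2 * k * \<bar>v - x i\<bar> / x i"
    have "\<bar>?D (x(i := x i - u * x i + u * v)) - ?D x\<bar> \<le> (2 * ?K) * u" if "u \<in> {0<..<1}" for u
    proof -
      have u: "0 < u" "u < 1" using that by auto
      have "2 * ?K * u = ?K * u + ?K * u" by simp
      then show ?thesis
        using transform_lipschitz[OF M(1) x u] transform_lipschitz[OF M(2) x u] by linarith
    qed
    then show "\<exists>K. \<forall>u\<in>{0<..<1}. \<bar>?D (x(i := x i - u * x i + u * v)) - ?D x\<bar> \<le> K * u" by blast
  next
    fix x assume x: "x \<in> configs N" "\<forall>j\<in>{1..N}. 0 < x j" "0 < ?D x"
    show "0 \<le> hidden_generator s N 0 0 ?D x"
      using hidden_generator_transform_diff[OF s N M x(1,2)] eq[OF x(1,2)] V[OF x(1)] x(3) by simp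
  qed
  then show ?thesis by simp
qed

lemma transform_unique:
  assumes s: "0 < s" and N: "1 \<le> N" and \<kappa>: "0 \<le> \<kappa>"
    and M: "M \<in> space (prob_algebra (config_space N))" "M' \<in> space (prob_algebra (config_space N))"
    and V: "\<And>l. l \<in> configs N \<Longrightarrow> 0 \<le> V l"
    and eq: "\<And>l. l \<in> configs N \<Longrightarrow> \<forall>i\<in>{1..N}. 0 < l i \<Longrightarrow>
      \<kappa> * (transform N M l - transform N M' l) = hidden_generator s N 0 0 (transform N M) l - V l * transform N M l"
    and eq': "\<And>l. l \<in> configs N \<Longrightarrow> \<forall>i\<in>{1..N}. 0 < l i \<Longrightarrow>
      hidden_generator s N 0 0 (transform N M') l = V l * transform N M' l"
    and l: "l \<in> configs N" "\<forall>i\<in>{1..N}. 0 < l i"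
  shows "transform N M l = transform N M' l"
proof (rule antisym)
  show "transform N M l \<le> transform N M' l"
    by (rule transform_le[where V = "\<lambda>l. V l + \<kappa>", OF s N M _ _ l])
      (use V \<kappa> eq eq' in \<open>auto simp: algebra_simps\<close>)
  show "transform N M' l \<le> transform N M l"
    by (rule transform_le[where V = "\<lambda>l. V l + \<kappa>", OF s N M(2,1) _ _ l])
      (use V \<kappa> eq eq' in \<open>auto simp: algebra_simps\<close>)
qed

lemma kern_equation:
  assumes M: "M \<in> space (prob_algebra (config_space N))" "M' \<in> space (prob_algebra (config_space N))"
    and eq: "\<And>f. f \<in> C1c N \<Longrightarrow> \<kappa> * ((\<integral>x. f x \<partial>M) - (\<integral>x. f x \<partial>M')) = (\<integral>x. L f x \<partial>M)"
    and meas: "\<And>f. f \<in> C1c N \<Longrightarrow> L f \<in> borel_measurable (config_space N)"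
    and l: "l \<in> configs N" "\<forall>i\<in>{1..N}. 0 < l i"
    and lim: "\<And>x. x \<in> configs N \<Longrightarrow> (\<lambda>n. L (test N (1 / Suc n) l) x) \<longlonglongrightarrow> G x"
    and bound: "\<And>n x. x \<in> configs N \<Longrightarrow> \<bar>L (test N (1 / Suc n) l) x\<bar> \<le> K"
  shows "\<kappa> * (transform N M l - transform N M' l) = (\<integral>x. G x \<partial>M)"
proof -
  have C: "test N (1 / Suc n) l \<in> C1c N" for n by (rule test_C1c[OF _ l]) simp
  have t: "(\<lambda>n. \<integral>x. test N (1 / Suc n) l x \<partial>m) \<longlonglongrightarrow> transform N m l"
    if m: "m \<in> space (prob_algebra (config_space N))" for m
  proof -
    interpret prob_space m by (rule M_prob[OF m])
    show ?thesis unfolding transform_def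
    proof (rule integral_dominated_convergence[where w = "\<lambda>_. 1"])
      show "kern N l \<in> borel_measurable m" "test N (1 / Suc n) l \<in> borel_measurable m" for n
        by (intro kern_measurable test_measurable M_coordinate[OF m]; simp)+
      show "AE x in m. (\<lambda>n. test N (1 / Suc n) l x) \<longlonglongrightarrow> kern N l x"
        using M_space[OF m] tendsto_test l by (intro AE_I2) auto
      show "AE x in m. norm (test N (1 / Suc n) l x) \<le> 1" for n
      proof (rule AE_I2)
        fix x assume "x \<in> space m"
        then show "norm (test N (1 / Suc n) l x) \<le> 1"
          using test_bounds[of "1 / Suc n" x N l "{1..N}"] M_space[OF m] l by (simp add: test_def)
      qed
    qed simp
  qed
  interpret prob_space M by (rule M_prob[OF M(1)])
  have Lm: "L (test N (1 / Suc n) l) \<in> borel_measurable M" for n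
    using meas[OF C] by (simp only: measurable_cong_sets[OF M_sets[OF M(1)] refl])
  have "(\<lambda>n. \<integral>x. L (test N (1 / Suc n) l) x \<partial>M) \<longlonglongrightarrow> (\<integral>x. G x \<partial>M)"
  proof (rule integral_dominated_convergence[where w = "\<lambda>_. K"])
    show "AE x in M. (\<lambda>n. L (test N (1 / Suc n) l) x) \<longlonglongrightarrow> G x"
      using lim M_space[OF M(1)] by (intro AE_I2) simp
    show "G \<in> borel_measurable M"
      using lim M_space[OF M(1)] by (intro borel_measurable_LIMSEQ_real[OF _ Lm]) simp
    show "AE x in M. norm (L (test N (1 / Suc n) l) x) \<le> K" for n
      using bound M_space[OF M(1)] by (intro AE_I2) simp
  qed (use Lm in auto)
  moreover have "(\<lambda>n. \<kappa> * ((\<integral>x. test N (1 / Suc n) l x \<partial>M) - (\<integral>x. test N (1 / Suc n) l x \<partial>M'))) \<longlonglongrightarrow>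
      \<kappa> * (transform N M l - transform N M' l)"
    by (intro tendsto_intros t M)
  ultimately show ?thesis unfolding eq[OF C] by (metis LIMSEQ_unique)
qed

end

section \<open>Duality for the hidden parameter model\<close>

lemma profile_stieltjes:
  assumes "0 < a"
  shows "profile (\<lambda>z. (1 + z) powr - a) (\<lambda>z. - a * (1 + z) powr (- a - 1)) a"
proof
  fix z :: real assume z: "0 \<le> z"
  show "0 < (1 + z) powr - a" using z by simp
  show "(1 + z) powr - a \<le> 1" using z assms powr_mono2'[of "- a" 1 "1 + z"] by simp
  show "((\<lambda>z. (1 + z) powr - a) has_real_derivative - a * (1 + z) powr (- a - 1)) (at z)"
    using z by (intro DERIV_cong[OF DERIV_fun_powr[where m = 1]]) (auto intro!: derivative_eq_intros)
  have "z * (a * (1 + z) powr (- a - 1)) \<le> (1 + z) * (a * (1 + z) powr (- a - 1))"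
    using z assms by (intro mult_right_mono) auto
  also have "\<dots> = a * (1 + z) powr - a"
    using powr_mult_base[of "1 + z" "- a - 1"] z by (simp add: mult_ac)
  also have "\<dots> \<le> a * 1" using \<open>(1 + z) powr - a \<le> 1\<close> assms by (intro mult_left_mono) auto
  finally show "z * \<bar>- a * (1 + z) powr (- a - 1)\<bar> \<le> a" using assms by (simp add: abs_mult)
next
  show "continuous_on {0..} (\<lambda>z. - a * (1 + z) powr (- a - 1))"
    by (intro continuous_intros) auto
  show "((\<lambda>z. (1 + z) powr - a) \<longlongrightarrow> 0) at_top"
    using assms by (intro tendsto_neg_powr filterlim_tendsto_add_at_top[OF tendsto_const] filterlim_ident) auto
qed measurable

lemma powr_neg_mult_ln_le:
  fixes A a :: real assumes "0 < a" "1 \<le> A"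
  shows "A powr - a * ln A \<le> 1 / a"
proof -
  have "a * ln A = ln (A powr a)" using assms by (simp add: ln_powr)
  also have "\<dots> \<le> A powr a - 1" using assms by (intro ln_le_minus_one) auto
  finally have "ln A \<le> A powr a / a" using assms by (simp add: field_simps)
  then have "A powr - a * ln A \<le> A powr - a * (A powr a / a)" by (intro mult_left_mono) auto
  then show ?thesis using assms by (simp add: powr_minus)
qed

locale stieltjes =
  fixes a :: real assumes a: "0 < a"
begin

sublocale profile "\<lambda>z. (1 + z) powr - a" "\<lambda>z. - a * (1 + z) powr (- a - 1)" a
  by (rule profile_stieltjes[OF a])

lemma
  assumes c: "0 \<le> c" and x: "x \<in> configs N" and l: "l \<in> configs N" and i: "i \<in> {1..N}" and v: "0 \<le> v"
  shows test_jump_integrable: "jump_integrable a (test N c l) x i v"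
    and test_jump_bound: "\<bar>jump_integral a (test N c l) x i v\<bar> \<le>
      (1 + l i * x i) powr - a * \<bar>ln (1 + l i * x i) - ln (1 + l i * v)\<bar> * (\<Prod>j\<in>{1..N} - {i}. (1 + l j * x j) powr - a)"
    and kern_jump_integrable': "jump_integrable a (kern N l) x i v"
    and kern_jump_eq: "jump_integral a (kern N l) x i v = (ln (1 + l i * x i) - ln (1 + l i * v)) * kern N l x"
    and test_jump_tendsto: "(\<lambda>n. jump_integral a (test N (1 / Suc n) l) x i v) \<longlonglongrightarrow> jump_integral a (kern N l) x i v"
proof -
  define A where "A = 1 + l i * x i"
  define B where "B = 1 + l i * v"
  have li: "0 \<le> l i" "0 \<le> x i" using l x i by (auto simp: PiE_iff)
  have A: "0 < A" and B: "0 < B" using li v by (auto simp: A_def B_def intro!: add_pos_nonneg)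
  let ?R = "\<Prod>j\<in>{1..N} - {i}. (1 + l j * x j) powr - a"
  have R: "0 \<le> ?R" by (intro prod_nonneg) auto
  let ?Rc = "\<lambda>c. \<Prod>j\<in>{1..N} - {i}. cutoff c ((1 + l j * x j) powr - a)"
  let ?y = "\<lambda>u. x(i := x i - u * x i + u * v)"
  let ?w = "\<lambda>u. (1 - u) powr (a - 1) / u * \<bar>((1 - u) * A + u * B) powr - a - A powr - a\<bar> * ?R"
  have AB: "1 + l i * (x i - u * x i + u * v) = (1 - u) * A + u * B" for u
    by (simp add: A_def B_def algebra_simps)
  have pos: "0 < (1 - u) * A + u * B" if "0 < u" "u < 1" for u
    using that A B by (intro add_pos_pos) auto
  have td: "test N c l (?y u) - test N c l x = (cutoff c (((1 - u) * A + u * B) powr - a) - cutoff c (A powr - a)) * ?Rc c" for c u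
    using test_update[OF i, of c l x "x i - u * x i + u * v"] test_update[OF i, of c l x "x i"]
    by (simp only: AB fun_upd_triv left_diff_distrib) (simp add: A_def)
  have tb: "\<bar>(1 - u) powr (a - 1) / u * (test N c l (?y u) - test N c l x)\<bar> \<le> ?w u" if "0 \<le> c" "u \<in> {0<..<1}" for c u
  proof -
    have u: "0 < u" "u < 1" using that by auto
    have "\<bar>cutoff c (((1 - u) * A + u * B) powr - a) - cutoff c (A powr - a)\<bar> * \<bar>?Rc c\<bar>
      \<le> \<bar>((1 - u) * A + u * B) powr - a - A powr - a\<bar> * ?R"
      using test_bounds[OF that(1) x l, of "{1..N} - {i}"] pos[OF u] A
      by (intro mult_mono cutoff_lipschitz that) auto
    then have "(1 - u) powr (a - 1) / u * (\<bar>cutoff c (((1 - u) * A + u * B) powr - a) - cutoff c (A powr - a)\<bar> * \<bar>?Rc c\<bar>)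
      \<le> (1 - u) powr (a - 1) / u * (\<bar>((1 - u) * A + u * B) powr - a - A powr - a\<bar> * ?R)"
      using u by (intro mult_left_mono) auto
    then show ?thesis unfolding td using u by (simp add: abs_mult mult.assoc)
  qed
  have w: "set_integrable lborel {0<..<1} ?w"
    by (intro set_integrable_mult_left set_integrable_log_kernel[OF a A B])
  have wI: "(LBINT u:{0<..<1}. ?w u) = A powr - a * \<bar>ln A - ln B\<bar> * ?R"
    by (subst set_integral_mult_left) (simp only: set_integral_abs_log_kernel[OF a A B])
  have m: "(\<lambda>u. (1 - u) powr (a - 1) / u * (test N c l (?y u) - test N c l x)) \<in> borel_measurable (restrict_space borel {0<..<1})" for c
    unfolding td by (intro measurable_restrict_space1) measurable
  have kd: "kern N l (?y u) - kern N l x = (((1 - u) * A + u * B) powr - a - A powr - a) * ?R" for u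
    using kern_split[OF i, of l "?y u"] kern_split[OF i, of l x]
    by (simp only: fun_upd_same AB left_diff_distrib) (simp add: A_def)
  have km: "(\<lambda>u. (1 - u) powr (a - 1) / u * (kern N l (?y u) - kern N l x)) \<in> borel_measurable (restrict_space borel {0<..<1})"
    unfolding kd by (intro measurable_restrict_space1) measurable
  have lim: "(\<lambda>n. (1 - u) powr (a - 1) / u * (test N (1 / Suc n) l (?y u) - test N (1 / Suc n) l x))
      \<longlonglongrightarrow> (1 - u) powr (a - 1) / u * (kern N l (?y u) - kern N l x)" if "u \<in> {0<..<1}" for u
    using that jump_config[OF x i v, of u] by (intro tendsto_intros tendsto_test x l) auto
  note dom = set_integral_dominated_convergence_at_top[OF m km _ w tb lim]
  show "(\<lambda>n. jump_integral a (test N (1 / Suc n) l) x i v) \<longlonglongrightarrow> jump_integral a (kern N l) x i v"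
    unfolding jump_integral_def by (rule dom(1)) auto
  note domc = set_integral_dominated_convergence_at_top[OF m m _ w tb[OF c] tendsto_const]
  show "jump_integrable a (test N c l) x i v"
    unfolding jump_integrable_def by (rule domc(2)) auto
  have "\<bar>jump_integral a (test N c l) x i v\<bar> \<le> A powr - a * \<bar>ln A - ln B\<bar> * ?R"
    unfolding jump_integral_def wI[symmetric] by (rule domc(3)) auto
  then show "\<bar>jump_integral a (test N c l) x i v\<bar> \<le>
      (1 + l i * x i) powr - a * \<bar>ln (1 + l i * x i) - ln (1 + l i * v)\<bar> * ?R"
    by (simp add: A_def B_def)
  have kb: "\<bar>(1 - u) powr (a - 1) / u * (kern N l (?y u) - kern N l x)\<bar> \<le> ?w u" if "u \<in> {0<..<1}" for u
    unfolding kd using that R by (simp add: abs_mult mult.assoc)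
  show "jump_integrable a (kern N l) x i v"
    unfolding jump_integrable_def
    by (rule set_integral_dominated_convergence_at_top(2)[OF km km _ w kb tendsto_const]) auto
  have "jump_integral a (kern N l) x i v
      = (LBINT u:{0<..<1}. (1 - u) powr (a - 1) / u * (((1 - u) * A + u * B) powr - a - A powr - a) * ?R)"
    unfolding jump_integral_def kd by (simp only: mult.assoc)
  also have "\<dots> = A powr - a * (ln A - ln B) * ?R"
    by (subst set_integral_mult_left) (simp only: set_integral_log_kernel[OF a A B])
  also have "\<dots> = (ln A - ln B) * kern N l x"
    unfolding kern_split[OF i] by (simp add: A_def)
  finally show "jump_integral a (kern N l) x i v = (ln (1 + l i * x i) - ln (1 + l i * v)) * kern N l x"
    by (simp add: A_def B_def)
qed

lemma hidden_generator_kern: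
  assumes N: "1 \<le> N" and x: "x \<in> configs N" and l: "l \<in> configs N" and r: "0 \<le> r" "0 \<le> r'" and s: "a = 2 * s"
  shows "hidden_generator s N r r' (kern N l) x = (\<Sum>i=1..N. 2 * ln (1 + l i * x i)
      - ln (1 + l i * boundary N r r' x (i - 1)) - ln (1 + l i * boundary N r r' x (i + 1))) * kern N l x"
proof -
  note b = boundary_neighbours[OF x r]
  have "hidden_generator s N r r' (kern N l) x
      = (\<Sum>i=1..N. jump_integral a (kern N l) x i (boundary N r r' x (i - 1)) + jump_integral a (kern N l) x i (boundary N r r' x (i + 1)))"
    unfolding s using b
    by (intro hidden_generator_eq_sum[OF N] ballI conjI kern_jump_integrable'[OF order_refl x l, unfolded s]) auto
  also have "\<dots> = (\<Sum>i=1..N. (2 * ln (1 + l i * x i)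
      - ln (1 + l i * boundary N r r' x (i - 1)) - ln (1 + l i * boundary N r r' x (i + 1))) * kern N l x)"
  proof (intro sum.cong refl)
    fix i assume i: "i \<in> {1..N}"
    show "jump_integral a (kern N l) x i (boundary N r r' x (i - 1)) + jump_integral a (kern N l) x i (boundary N r r' x (i + 1))
      = (2 * ln (1 + l i * x i) - ln (1 + l i * boundary N r r' x (i - 1)) - ln (1 + l i * boundary N r r' x (i + 1))) * kern N l x"
      unfolding kern_jump_eq[OF order_refl x l i b(1)[OF i]] kern_jump_eq[OF order_refl x l i b(2)[OF i]] by algebra
  qed
  finally show ?thesis by (simp add: sum_distrib_right)
qed

text \<open>
  The interaction terms pair neighbouring sites of \<open>l\<close> and \<open>x\<close>, so the generators acting on \<open>x\<close> and on
  \<open>l\<close> differ by the two boundary terms only.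
\<close>

lemma hidden_generator_kern_dual:
  assumes N: "1 \<le> N" and x: "x \<in> configs N" and l: "l \<in> configs N" and r: "0 \<le> r" "0 \<le> r'" and s: "a = 2 * s"
  shows "hidden_generator s N r r' (kern N l) x
    = hidden_generator s N 0 0 (kern N x) l - (ln (1 + l 1 * r) + ln (1 + l N * r')) * kern N l x"
proof -
  let ?x = "boundary N r r' x" and ?l = "boundary N 0 0 l"
  have x': "?x i = x i" and l': "?l i = l i" if "i \<in> {1..N}" for i using that by (auto simp: boundary_def)
  have l0: "?l 0 = 0" "?l (Suc N) = 0" by (auto simp: boundary_def)
  define g where "g = (\<lambda>p q::real. ln (1 + p * q))"
  have g0: "g 0 q = 0" for q by (simp add: g_def)
  have "(\<Sum>i=1..N. g (?l i) (?x (i + 1))) = (\<Sum>k<N. g (?l (Suc k)) (?x (Suc (Suc k))))"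
    by (simp add: sum.atLeast1_atMost_eq)
  also have "\<dots> = (\<Sum>k<Suc N. g (?l k) (?x (Suc k)))"
    by (subst sum.lessThan_Suc_shift) (simp add: l0 g0)
  also have "\<dots> = (\<Sum>i=1..N. g (?l (i - 1)) (?x i)) + g (?l N) (?x (Suc N))"
    by (simp add: sum.atLeast1_atMost_eq)
  finally have 1: "(\<Sum>i=1..N. g (?l i) (?x (i + 1))) = (\<Sum>i=1..N. g (?l (i - 1)) (?x i)) + g (?l N) (?x (Suc N))" .
  have "(\<Sum>i=1..N. g (?l i) (?x (i - 1))) = (\<Sum>k<N. g (?l (Suc k)) (?x k))"
    by (simp add: sum.atLeast1_atMost_eq)
  also have "\<dots> = (\<Sum>k<Suc N. g (?l (Suc k)) (?x k))" by (simp add: l0 g0)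
  also have "\<dots> = (\<Sum>i=1..N. g (?l (i + 1)) (?x i)) + g (?l 1) (?x 0)"
    by (subst sum.lessThan_Suc_shift) (simp add: sum.atLeast1_atMost_eq)
  finally have 2: "(\<Sum>i=1..N. g (?l i) (?x (i - 1))) = (\<Sum>i=1..N. g (?l (i + 1)) (?x i)) + g (?l 1) (?x 0)" .
  have "(\<Sum>i=1..N. 2 * g (l i) (x i) - g (l i) (?x (i - 1)) - g (l i) (?x (i + 1)))
      = (\<Sum>i=1..N. 2 * g (l i) (x i)) - (\<Sum>i=1..N. g (?l i) (?x (i - 1))) - (\<Sum>i=1..N. g (?l i) (?x (i + 1)))"
    by (simp add: sum_subtractf l')
  also have "\<dots> = (\<Sum>i=1..N. 2 * g (l i) (x i)) - (\<Sum>i=1..N. g (?l (i + 1)) (?x i)) - (\<Sum>i=1..N. g (?l (i - 1)) (?x i))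
      - (g (?l 1) (?x 0) + g (?l N) (?x (Suc N)))"
    unfolding 1 2 by simp
  also have "\<dots> = (\<Sum>i=1..N. 2 * g (x i) (l i) - g (x i) (?l (i - 1)) - g (x i) (?l (i + 1)))
      - (g (l 1) r + g (l N) r')"
  proof -
    have "g p q = g q p" for p q by (simp add: g_def mult.commute)
    then have "(\<Sum>i=1..N. 2 * g (x i) (l i) - g (x i) (?l (i - 1)) - g (x i) (?l (i + 1)))
      = (\<Sum>i=1..N. 2 * g (l i) (x i) - g (?l (i - 1)) (?x i) - g (?l (i + 1)) (?x i))"
      using x' by (intro sum.cong refl) metis
    moreover have "?x 0 = r" "?x (Suc N) = r'" "?l 1 = l 1" "?l N = l N" using N by (auto simp: boundary_def)
    ultimately show ?thesis by (simp add: sum_subtractf)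
  qed
  finally have "(\<Sum>i=1..N. 2 * g (l i) (x i) - g (l i) (?x (i - 1)) - g (l i) (?x (i + 1))) * kern N l x
      = (\<Sum>i=1..N. 2 * g (x i) (l i) - g (x i) (?l (i - 1)) - g (x i) (?l (i + 1))) * kern N l x
      - (g (l 1) r + g (l N) r') * kern N l x" by (simp add: left_diff_distrib)
  then show ?thesis
    unfolding hidden_generator_kern[OF N x l r s] hidden_generator_kern[OF N l x order_refl order_refl s] g_def
    by (simp add: kern_commute[of N x l])
qed

lemma hidden_generator_test:
  assumes N: "1 \<le> N" and l: "l \<in> configs N" "\<forall>i\<in>{1..N}. 0 < l i" and r: "0 \<le> r" "0 \<le> r'" and s: "a = 2 * s"
  shows "x \<in> configs N \<Longrightarrow> (\<lambda>n. hidden_generator s N r r' (test N (1 / Suc n) l) x) \<longlonglongrightarrow> hidden_generator s N r r' (kern N l) x"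
    and "\<exists>K. \<forall>n. \<forall>x\<in>configs N. \<bar>hidden_generator s N r r' (test N (1 / Suc n) l) x\<bar> \<le> K"
proof -
  let ?b = "boundary N r r'"
  have e: "hidden_generator s N r r' (test N c l) x
      = (\<Sum>i=1..N. jump_integral a (test N c l) x i (?b x (i - 1)) + jump_integral a (test N c l) x i (?b x (i + 1)))"
    if "0 \<le> c" "x \<in> configs N" for x c
    unfolding s using boundary_neighbours[OF that(2) r] that
    by (intro hidden_generator_eq_sum[OF N] ballI conjI test_jump_integrable[unfolded s, OF _ _ l(1)]) auto
  have e': "hidden_generator s N r r' (kern N l) x
      = (\<Sum>i=1..N. jump_integral a (kern N l) x i (?b x (i - 1)) + jump_integral a (kern N l) x i (?b x (i + 1)))"
    if "x \<in> configs N" for x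
    unfolding s using boundary_neighbours[OF that r] that
    by (intro hidden_generator_eq_sum[OF N] ballI conjI kern_jump_integrable'[unfolded s, OF order_refl _ l(1)]) auto
  show "(\<lambda>n. hidden_generator s N r r' (test N (1 / Suc n) l) x) \<longlonglongrightarrow> hidden_generator s N r r' (kern N l) x" if x: "x \<in> configs N" for x
  proof -
    have "(\<lambda>n. hidden_generator s N r r' (test N (1 / Suc n) l) x) = (\<lambda>n. \<Sum>i=1..N.
        jump_integral a (test N (1 / Suc n) l) x i (?b x (i - 1)) + jump_integral a (test N (1 / Suc n) l) x i (?b x (i + 1)))"
      by (rule ext) (rule e[OF _ x], simp)
    then show ?thesis
      unfolding e'[OF x] using boundary_neighbours[OF x r]
      by (auto intro!: tendsto_sum tendsto_add test_jump_tendsto[OF order_refl x l(1)] simp del: of_nat_Suc)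
  qed
  define C where "C = (\<lambda>i j. 2 / a + (if j = 0 then ln (1 + l i * r) else if j = N + 1 then ln (1 + l i * r') else ln (1 + l i / l j)))"
  have C: "\<bar>jump_integral a (test N c l) x i (?b x j)\<bar> \<le> C i j"
    if c: "0 \<le> c" and x: "x \<in> configs N" and i: "i \<in> {1..N}" and j: "j \<le> N + 1" "j \<noteq> i" for c x i j
  proof -
    let ?R = "\<Prod>m\<in>{1..N} - {i}. (1 + l m * x m) powr - a"
    have bj: "0 \<le> ?b x j" by (rule boundary_nonneg[OF x r j(1)])
    have li: "0 < l i" "0 \<le> x i" using l x i by (auto simp: PiE_iff)
    define A where "A = 1 + l i * x i"
    define B where "B = 1 + l i * ?b x j"
    have A: "1 \<le> A" and B: "1 \<le> B" using li bj by (auto simp: A_def B_def)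
    have A1: "A powr - a \<le> 1" using A a powr_mono2'[of "- a" 1 A] by simp
    have R: "0 \<le> ?R" "?R \<le> 1" using test_bounds[OF order_refl x l(1), of "{1..N} - {i}"] by (auto intro!: prod_nonneg)
    have AR: "A powr - a * \<bar>ln A - ln B\<bar> * ?R \<le> 1 / a + ln B * ?R"
    proof -
      have "\<bar>ln A - ln B\<bar> \<le> ln A + ln B" using A B by (simp add: abs_le_iff)
      then have "A powr - a * \<bar>ln A - ln B\<bar> * ?R \<le> A powr - a * (ln A + ln B) * ?R"
        using R by (intro mult_right_mono mult_left_mono) auto
      also have "\<dots> = (A powr - a * ln A) * ?R + A powr - a * (ln B * ?R)" by (simp add: algebra_simps)
      also have "\<dots> \<le> (1 / a) * 1 + 1 * (ln B * ?R)"
        using R A1 B A a powr_neg_mult_ln_le[OF a A] by (intro add_mono mult_mono) auto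
      finally show ?thesis by simp
    qed
    have "ln B * ?R \<le> C i j - 1 / a"
    proof (cases "j \<in> {1..N}")
      case True
      have lj: "0 < l j" "0 \<le> x j" using l x True by (auto simp: PiE_iff)
      define D where "D = 1 + l j * x j"
      have D: "1 \<le> D" using lj by (simp add: D_def)
      have Rj: "?R \<le> D powr - a"
      proof -
        have "?R = D powr - a * (\<Prod>m\<in>{1..N} - {i} - {j}. (1 + l m * x m) powr - a)"
          by (subst prod.remove[of _ j]) (use True j in \<open>auto simp: D_def\<close>)
        also have "\<dots> \<le> D powr - a * 1"
          using test_bounds(3)[OF order_refl x l(1), of "{1..N} - {i} - {j}"] by (intro mult_left_mono) auto
        finally show ?thesis by simp
      qed
      have "B \<le> (1 + l i / l j) * D"
      proof -
        have "(1 + l i / l j) * D = 1 + l j * x j + l i / l j + l i * x j"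
          using lj by (simp add: D_def field_simps)
        moreover have "B = 1 + l i * x j" using True by (auto simp: B_def boundary_def)
        ultimately show ?thesis using lj li by simp
      qed
      then have "ln B \<le> ln ((1 + l i / l j) * D)" using B by (subst ln_le_cancel_iff) auto
      also have "\<dots> = ln (1 + l i / l j) + ln D" using D lj li by (intro ln_mult_pos) (auto intro!: add_pos_nonneg)
      finally have "ln B * ?R \<le> (ln (1 + l i / l j) + ln D) * ?R" using R by (intro mult_right_mono)
      also have "\<dots> \<le> ln (1 + l i / l j) * 1 + ln D * D powr - a"
        unfolding distrib_right using R Rj D lj li by (intro add_mono mult_left_mono) auto
      also have "ln D * D powr - a \<le> 1 / a" using powr_neg_mult_ln_le[OF a D] by (simp add: mult.commute)
      finally show ?thesis using True j by (simp add: C_def)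
    next
      case False
      then have j': "j = 0 \<or> j = N + 1" using j by auto
      have "ln B * ?R \<le> ln B * 1" using R B by (intro mult_left_mono) auto
      moreover have "C i j - 1 / a = ln B + 1 / a"
        using j' by (auto simp: C_def B_def boundary_def)
      moreover have "0 \<le> 1 / a" using a by simp
      ultimately show ?thesis by linarith
    qed
    then show ?thesis
      using test_jump_bound[OF c x l(1) i bj] AR by (simp add: A_def B_def)
  qed
  show "\<exists>K. \<forall>n. \<forall>x\<in>configs N. \<bar>hidden_generator s N r r' (test N (1 / Suc n) l) x\<bar> \<le> K"
  proof (intro exI allI ballI)
    fix n x assume x: "x \<in> configs N"
    let ?t = "test N (1 / Suc n) l"
    have c: "0 \<le> 1 / real (Suc n)" by simp
    have "\<bar>hidden_generator s N r r' ?t x\<bar> \<le> (\<Sum>i=1..N. \<bar>jump_integral a ?t x i (?b x (i - 1)) + jump_integral a ?t x i (?b x (i + 1))\<bar>)"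
      unfolding e[OF c x] by (rule sum_abs)
    also have "\<dots> \<le> (\<Sum>i=1..N. C i (i - 1) + C i (i + 1))"
    proof (rule sum_mono)
      fix i assume i: "i \<in> {1..N}"
      have "\<bar>jump_integral a ?t x i (?b x (i - 1))\<bar> \<le> C i (i - 1)" "\<bar>jump_integral a ?t x i (?b x (i + 1))\<bar> \<le> C i (i + 1)"
        using i by (intro C[OF c x i]; force)+
      then show "\<bar>jump_integral a ?t x i (?b x (i - 1)) + jump_integral a ?t x i (?b x (i + 1))\<bar> \<le> C i (i - 1) + C i (i + 1)"
        by linarith
    qed
    finally show "\<bar>hidden_generator s N r r' ?t x\<bar> \<le> (\<Sum>i=1..N. C i (i - 1) + C i (i + 1))" .
  qed
qed

end

section \<open>Duality for the harmonic model\<close>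

lemma mult_exp_neg_le_1: "z * exp (- z) \<le> (1 :: real)"
proof -
  have "z \<le> exp z" using exp_ge_add_one_self[of z] by linarith
  then show ?thesis by (simp add: exp_minus field_simps)
qed

lemma profile_laplace: "profile (\<lambda>z. exp (- z)) (\<lambda>z. - exp (- z)) 1"
proof
  show "((\<lambda>z. exp (- z)) has_real_derivative - exp (- z)) (at z)" for z :: real
    by (auto intro!: derivative_eq_intros)
  show "((\<lambda>z::real. exp (- z)) \<longlongrightarrow> 0) at_top"
    by (intro filterlim_compose[OF exp_at_bot] filterlim_uminus_at_bot_at_top)
  show "z * \<bar>- exp (- z)\<bar> \<le> 1" for z :: real
    using mult_exp_neg_le_1[of z] by simp
  show "continuous_on {0..} (\<lambda>z::real. - exp (- z))" by (intro continuous_intros)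
qed auto

interpretation laplace: profile "\<lambda>z. exp (- z)" "\<lambda>z. - exp (- z)" 1
  by (rule profile_laplace)

lemma laplace_kern_eq_exp: "laplace.kern N l x = exp (- (\<Sum>i=1..N. l i * x i))"
  by (simp add: laplace.kern_def exp_sum[symmetric] sum_negf)

lemma sum_update:
  fixes l x :: "nat \<Rightarrow> real"
  assumes "i \<in> {1..N}"
  shows "(\<Sum>j=1..N. l j * (x(i := y)) j) = (\<Sum>j=1..N. l j * x j) + l i * (y - x i)"
proof -
  have "(\<Sum>j=1..N. l j * (x(i := y)) j) = (\<Sum>j=1..N. l j * x j + (if j = i then l i * (y - x i) else 0))"
    by (intro sum.cong refl) (auto simp: algebra_simps)
  then show ?thesis using assms by (simp add: sum.distrib)
qed

lemma laplace_kern_move: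
  assumes "i \<in> {1..N}" "j \<in> {1..N}" "i \<noteq> j"
  shows "laplace.kern N l (x(i := x i - u * x i, j := x j + u * x i))
    = laplace.kern N x (l(i := l i - u * l i + u * l j))"
  unfolding laplace.kern_commute[of N x] laplace_kern_eq_exp
  using assms sum_update[OF assms(2), of l "x(i := x i - u * x i)" "x j + u * x i"] sum_update[OF assms(1), of l x "x i - u * x i"]
    sum_update[OF assms(1), of x l "l i - u * l i + u * l j"]
  by (simp add: algebra_simps)

lemma laplace_kern_remove:
  assumes "i \<in> {1..N}"
  shows "laplace.kern N l (x(i := x i - u * x i)) = laplace.kern N x (l(i := l i - u * l i + u * 0))"
  unfolding laplace.kern_commute[of N x] laplace_kern_eq_exp
  using sum_update[OF assms(1), of l x "x i - u * x i"] sum_update[OF assms(1), of x l "l i - u * l i + u * 0"]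
  by (simp add: algebra_simps)

lemma laplace_kern_inject:
  assumes "i \<in> {1..N}"
  shows "laplace.kern N l (x(i := x i + u * r)) = laplace.kern N l x * exp (- (l i * r * u))"
  unfolding laplace_kern_eq_exp exp_add[symmetric]
  using sum_update[OF assms(1), of l x "x i + u * r"] by (simp add: algebra_simps)

lemma laplace_kern_inject_integral:
  assumes "i \<in> {1..N}" "0 \<le> l i" "0 \<le> r"
  shows "(LBINT u:{0<..}. exp (- u) / u * (laplace.kern N l (x(i := x i + u * r)) - laplace.kern N l x))
    = - ln (1 + l i * r) * laplace.kern N l x"
proof -
  have "(LBINT u:{0<..}. exp (- u) / u * (laplace.kern N l (x(i := x i + u * r)) - laplace.kern N l x))
      = (LBINT u:{0<..}. (exp (- u) / u * (exp (- (l i * r * u)) - 1)) * laplace.kern N l x)"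
    unfolding laplace_kern_inject[OF assms(1)]
    by (intro set_lebesgue_integral_cong) (auto simp: algebra_simps)
  also have "\<dots> = - ln (1 + l i * r) * laplace.kern N l x"
    by (subst set_integral_mult_left) (use set_integral_frullani[of "l i * r"] assms in simp)
  finally show ?thesis .
qed

lemma harmonic_generator_laplace_kern:
  assumes N: "1 \<le> N" and l: "l \<in> configs N" and r: "0 \<le> r" "0 \<le> r'"
  shows "harmonic_generator s N r r' (laplace.kern N l) x
    = hidden_generator s N 0 0 (laplace.kern N x) l - (ln (1 + l 1 * r) + ln (1 + l N * r')) * laplace.kern N l x"
proof -
  have l0: "0 \<le> l 1" "0 \<le> l N" using l N by (auto simp: PiE_iff)
  have N1: "1 \<in> {1..N}" "N \<in> {1..N}" using N by auto
  have e: "laplace.kern N l x = laplace.kern N x l" by (rule laplace.kern_commute)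
  have bulk: "(\<Sum>i=1..<N. LBINT u:{0<..<1}. (1 - u) powr (2 * s - 1) / u *
        (laplace.kern N l (x(i := x i - u * x i, i+1 := x (i+1) + u * x i))
       + laplace.kern N l (x(i+1 := x (i+1) - u * x (i+1), i := x i + u * x (i+1))) - 2 * laplace.kern N l x))
    = (\<Sum>i=1..<N. LBINT u:{0<..<1}. (1 - u) powr (2 * s - 1) / u *
        (laplace.kern N x (l(i := l i - u * l i + u * l (i+1)))
       + laplace.kern N x (l(i+1 := l (i+1) - u * l (i+1) + u * l i)) - 2 * laplace.kern N x l))"
  proof (intro sum.cong refl)
    fix i assume "i \<in> {1..<N}"
    then have i: "i \<in> {1..N}" "i + 1 \<in> {1..N}" by auto
    show "(LBINT u:{0<..<1}. (1 - u) powr (2 * s - 1) / u *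
        (laplace.kern N l (x(i := x i - u * x i, i+1 := x (i+1) + u * x i))
       + laplace.kern N l (x(i+1 := x (i+1) - u * x (i+1), i := x i + u * x (i+1))) - 2 * laplace.kern N l x))
     = (LBINT u:{0<..<1}. (1 - u) powr (2 * s - 1) / u *
        (laplace.kern N x (l(i := l i - u * l i + u * l (i+1)))
       + laplace.kern N x (l(i+1 := l (i+1) - u * l (i+1) + u * l i)) - 2 * laplace.kern N x l))"
      using i laplace_kern_move[of i N "i + 1" l x] laplace_kern_move[of "i + 1" N i l x] by (simp add: e)
  qed
  show ?thesis
    unfolding harmonic_generator_def hidden_generator_def bulk
      laplace_kern_inject_integral[where i = 1 and l = l, OF N1(1) l0(1) r(1)]
      laplace_kern_inject_integral[where i = N and l = l, OF N1(2) l0(2) r(2)]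
      laplace_kern_remove[OF N1(1)] laplace_kern_remove[OF N1(2)]
    by (simp add: e algebra_simps)
qed

lemma config_move:
  assumes "x \<in> configs N" "i \<in> {1..N}" "j \<in> {1..N}" "0 < u" "u < 1"
  shows "x(i := x i - u * x i, j := x j + u * x i) \<in> configs N"
proof -
  have "0 \<le> x i" "0 \<le> x j" using assms by (auto simp: PiE_iff)
  then have "0 \<le> x i - u * x i" "0 \<le> x j + u * x i"
    using assms mult_right_mono[of u 1 "x i"] by auto
  then show ?thesis using assms by (auto simp: PiE_iff extensional_def)
qed

lemma laplace_test_move_bound:
  assumes c: "0 \<le> c" and x: "x \<in> configs N" and l: "l \<in> configs N" "\<forall>i\<in>{1..N}. 0 < l i"
    and ij: "i \<in> {1..N}" "j \<in> {1..N}" "i \<noteq> j" and u: "0 < u" "u < 1"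
  shows "\<bar>laplace.test N c l (x(i := x i - u * x i, j := x j + u * x i)) - laplace.test N c l x\<bar> \<le> (4 + l j / l i) * u"
proof -
  have p: "0 < l i" "0 < l j" "0 \<le> x i" "0 \<le> x j" using x l ij by (auto simp: PiE_iff)
  let ?R = "\<Prod>m\<in>{1..N} - {j} - {i}. cutoff c (exp (- (l m * x m)))"
  define p1 where "p1 = exp (- (l i * x i))"
  define p2 where "p2 = exp (- (l i * (x i - u * x i)))"
  define r1 where "r1 = exp (- (l j * x j))"
  define r2 where "r2 = exp (- (l j * (x j + u * x i)))"
  have pos: "0 < p1" "0 < p2" "0 < r1" "0 < r2" by (auto simp: p1_def p2_def r1_def r2_def)
  have le: "r2 \<le> 1" using p u by (simp add: r2_def)
  have R: "0 \<le> ?R" "?R \<le> 1"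
    using laplace.test_bounds(1)[OF c x l(1), of "{1..N} - {j} - {i}"]
      order_trans[OF laplace.test_bounds(2,3)[OF c x l(1), of "{1..N} - {j} - {i}"]] by blast+
  have "laplace.test N c l (x(i := y, j := z)) = cutoff c (exp (- (l j * z))) * (cutoff c (exp (- (l i * y))) * ?R)" for y z
  proof -
    have "laplace.test N c l (x(i := y, j := z)) = cutoff c (exp (- (l j * z))) *
        (\<Prod>m\<in>{1..N} - {j}. cutoff c (exp (- (l m * (x(i := y)) m))))"
      by (rule laplace.test_update[OF ij(2)])
    also have "(\<Prod>m\<in>{1..N} - {j}. cutoff c (exp (- (l m * (x(i := y)) m)))) = cutoff c (exp (- (l i * y))) * ?R"
      by (subst prod.remove[of _ i]) (use ij in \<open>auto intro!: prod.cong\<close>)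
    finally show ?thesis .
  qed
  from this[of "x i - u * x i" "x j + u * x i"] this[of "x i" "x j"]
  have "laplace.test N c l (x(i := x i - u * x i, j := x j + u * x i)) - laplace.test N c l x
      = (cutoff c r2 * (cutoff c p2 - cutoff c p1) + cutoff c p1 * (cutoff c r2 - cutoff c r1)) * ?R"
    by (simp add: p1_def p2_def r1_def r2_def algebra_simps)
  also have "\<bar>\<dots>\<bar> \<le> \<bar>cutoff c r2 * (cutoff c p2 - cutoff c p1) + cutoff c p1 * (cutoff c r2 - cutoff c r1)\<bar> * 1"
    using R by (simp add: abs_mult mult_left_le)
  also have "\<dots> \<le> \<bar>cutoff c r2\<bar> * \<bar>cutoff c p2 - cutoff c p1\<bar> + \<bar>cutoff c p1\<bar> * \<bar>cutoff c r2 - cutoff c r1\<bar>"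
    by (simp add: abs_mult[symmetric])
  also have "\<dots> \<le> 1 * \<bar>p2 - p1\<bar> + p1 * \<bar>r2 - r1\<bar>"
    using cutoff_bounds[OF c] pos le by (intro add_mono mult_mono cutoff_lipschitz c) (auto intro: order_trans)
  also have "\<bar>p2 - p1\<bar> \<le> 4 * u"
  proof -
    have "\<bar>exp (- ((l i - u * l i + u * 0) * x i)) - exp (- (l i * x i))\<bar> \<le> (2 + 2 * 1 * \<bar>0 - l i\<bar> / l i) * u"
      by (rule laplace.q_lipschitz) (use p u in auto)
    then show ?thesis using p by (simp add: p1_def p2_def algebra_simps)
  qed
  also have "p1 * \<bar>r2 - r1\<bar> \<le> l j / l i * u"
  proof -
    have "r2 = r1 * exp (- (l j * u * x i))" by (simp add: r1_def r2_def exp_add[symmetric] algebra_simps)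
    then have "r1 - r2 = r1 * (1 - exp (- (l j * u * x i)))" by (simp add: algebra_simps)
    moreover have e1: "1 - exp (- (l j * u * x i)) \<le> l j * u * x i"
      using exp_ge_add_one_self[of "- (l j * u * x i)"] by linarith
    moreover have e0: "0 \<le> 1 - exp (- (l j * u * x i))" using p u by simp
    moreover have "r1 \<le> 1" using p by (simp add: r1_def)
    then have "r1 * (1 - exp (- (l j * u * x i))) \<le> 1 * (l j * u * x i)"
      by (intro mult_mono e1 e0) auto
    moreover have "0 \<le> r1 * (1 - exp (- (l j * u * x i)))" using e0 pos by simp
    ultimately have "\<bar>r2 - r1\<bar> \<le> l j * u * x i" by linarith
    then have "p1 * \<bar>r2 - r1\<bar> \<le> p1 * (l j * u * x i)" using pos by (intro mult_left_mono) auto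
    also have "\<dots> = (l j / l i * u) * ((l i * x i) * exp (- (l i * x i)))" using p by (simp add: p1_def)
    also have "\<dots> \<le> (l j / l i * u) * 1"
      using p u by (intro mult_left_mono mult_exp_neg_le_1) auto
    finally show ?thesis by simp
  qed
  finally show ?thesis by (simp add: algebra_simps)
qed

lemma laplace_test_remove_bound:
  assumes c: "0 \<le> c" and x: "x \<in> configs N" and l: "l \<in> configs N" "\<forall>i\<in>{1..N}. 0 < l i"
    and i: "i \<in> {1..N}" and u: "0 < u" "u < 1"
  shows "\<bar>laplace.test N c l (x(i := x i - u * x i)) - laplace.test N c l x\<bar> \<le> 4 * u"
proof -
  have p: "0 < l i" "0 \<le> x i" using x l i by (auto simp: PiE_iff)
  let ?R = "\<Prod>m\<in>{1..N} - {i}. cutoff c (exp (- (l m * x m)))"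
  have R: "0 \<le> ?R" "?R \<le> 1"
    using laplace.test_bounds(1)[OF c x l(1), of "{1..N} - {i}"]
      order_trans[OF laplace.test_bounds(2,3)[OF c x l(1), of "{1..N} - {i}"]] by blast+
  have "laplace.test N c l (x(i := x i - u * x i)) - laplace.test N c l x
      = (cutoff c (exp (- (l i * (x i - u * x i)))) - cutoff c (exp (- (l i * x i)))) * ?R"
    using laplace.test_update[OF i, of c l x "x i - u * x i"] laplace.test_update[OF i, of c l x "x i"]
    by (simp add: left_diff_distrib)
  also have "\<bar>\<dots>\<bar> \<le> \<bar>exp (- (l i * (x i - u * x i))) - exp (- (l i * x i))\<bar> * 1"
    unfolding abs_mult using R by (intro mult_mono cutoff_lipschitz c) auto
  also have "\<dots> \<le> 4 * u"
  proof -
    have "\<bar>exp (- ((l i - u * l i + u * 0) * x i)) - exp (- (l i * x i))\<bar> \<le> (2 + 2 * 1 * \<bar>0 - l i\<bar> / l i) * u"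
      by (rule laplace.q_lipschitz) (use p u in auto)
    then show ?thesis using p by (simp add: algebra_simps)
  qed
  finally show ?thesis .
qed

lemma laplace_test_inject_bound:
  assumes c: "0 \<le> c" and x: "x \<in> configs N" and l: "l \<in> configs N"
    and i: "i \<in> {1..N}" and u: "0 < u" and r: "0 \<le> r"
  shows "\<bar>laplace.test N c l (x(i := x i + u * r)) - laplace.test N c l x\<bar> \<le> 1 - exp (- (l i * r * u))"
proof -
  have p: "0 \<le> l i" "0 \<le> x i" using x l i by (auto simp: PiE_iff)
  let ?R = "\<Prod>m\<in>{1..N} - {i}. cutoff c (exp (- (l m * x m)))"
  have R: "0 \<le> ?R" "?R \<le> 1"
    using laplace.test_bounds(1)[OF c x l(1), of "{1..N} - {i}"]
      order_trans[OF laplace.test_bounds(2,3)[OF c x l(1), of "{1..N} - {i}"]] by blast+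
  have "laplace.test N c l (x(i := x i + u * r)) - laplace.test N c l x
      = (cutoff c (exp (- (l i * (x i + u * r)))) - cutoff c (exp (- (l i * x i)))) * ?R"
    using laplace.test_update[OF i, of c l x "x i + u * r"] laplace.test_update[OF i, of c l x "x i"]
    by (simp add: left_diff_distrib)
  also have "\<bar>\<dots>\<bar> \<le> \<bar>exp (- (l i * (x i + u * r))) - exp (- (l i * x i))\<bar> * 1"
    unfolding abs_mult using R by (intro mult_mono cutoff_lipschitz c) auto
  also have "\<dots> = exp (- (l i * x i)) * (1 - exp (- (l i * r * u)))"
  proof -
    have "exp (- (l i * (x i + u * r))) = exp (- (l i * x i)) * exp (- (l i * r * u))"
      by (simp add: exp_add[symmetric] algebra_simps)
    then have "exp (- (l i * x i)) - exp (- (l i * (x i + u * r))) = exp (- (l i * x i)) * (1 - exp (- (l i * r * u)))"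
      by (simp add: algebra_simps)
    moreover have "0 \<le> exp (- (l i * x i)) * (1 - exp (- (l i * r * u)))" using p u r by simp
    ultimately show ?thesis unfolding mult_1_right by linarith
  qed
  also have "\<dots> \<le> 1 * (1 - exp (- (l i * r * u)))" using p u r by (intro mult_right_mono) auto
  finally show ?thesis by simp
qed

lemma harmonic_generator_test:
  assumes s: "0 < s" and N: "1 \<le> N" and l: "l \<in> configs N" "\<forall>i\<in>{1..N}. 0 < l i" and r: "0 \<le> r" "0 \<le> r'"
  shows "x \<in> configs N \<Longrightarrow> (\<lambda>n. harmonic_generator s N r r' (laplace.test N (1 / Suc n) l) x) \<longlonglongrightarrow>
      harmonic_generator s N r r' (laplace.kern N l) x"
    and "\<exists>K. \<forall>n. \<forall>x\<in>configs N. \<bar>harmonic_generator s N r r' (laplace.test N (1 / Suc n) l) x\<bar> \<le> K"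
proof -
  let ?a = "2 * s"
  have a: "0 < ?a" using s by simp
  let ?t = "\<lambda>n. laplace.test N (1 / Suc n) l" and ?k = "laplace.kern N l"
  have c: "0 \<le> 1 / real (Suc n)" for n by simp
  have tm: "(\<lambda>u. ?t n (y u)) \<in> borel_measurable (restrict_space borel S)"
    and km: "(\<lambda>u. ?k (y u)) \<in> borel_measurable (restrict_space borel S)"
    if "\<And>i. (\<lambda>u. y u i) \<in> borel_measurable borel" for y :: "real \<Rightarrow> nat \<Rightarrow> real" and n and S
    using that by (auto intro!: measurable_restrict_space1 laplace.test_measurable laplace.kern_measurable)
  have upd: "(\<lambda>u. (x(i := g u)) j) \<in> borel_measurable borel"
    if "g \<in> borel_measurable borel" for x :: "nat \<Rightarrow> real" and i j and g :: "real \<Rightarrow> real"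
    using that by (cases "j = i") auto
  have upd2: "(\<lambda>u. (x(i := g u, i' := h u)) j) \<in> borel_measurable borel"
    if "g \<in> borel_measurable borel" "h \<in> borel_measurable borel" for x :: "nat \<Rightarrow> real" and i i' j and g h :: "real \<Rightarrow> real"
    using that by (cases "j = i'"; cases "j = i") auto
  have w: "set_integrable lborel {0<..<1} (\<lambda>u. K * (1 - u) powr (?a - 1))"
    "(LBINT u:{0<..<1}. K * (1 - u) powr (?a - 1)) = K / ?a" for K
    using set_integrable_one_minus_powr[OF a] set_integral_one_minus_powr[OF a] by auto
  have rate: "\<bar>(1 - u) powr (?a - 1) / u * y\<bar> \<le> K * (1 - u) powr (?a - 1)" if "u \<in> {0<..<1}" "\<bar>y\<bar> \<le> K * u" for u y K
  proof -
    have "\<bar>(1 - u) powr (?a - 1) / u * y\<bar> = (1 - u) powr (?a - 1) / u * \<bar>y\<bar>" using that by (simp add: abs_mult)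
    also have "\<dots> \<le> (1 - u) powr (?a - 1) / u * (K * u)" using that by (intro mult_left_mono) auto
    finally show ?thesis using that by (simp add: field_simps)
  qed
  have kt: "(\<lambda>n. ?t n x) \<longlonglongrightarrow> ?k x" if "x \<in> configs N" for x by (rule laplace.tendsto_test[OF that l(1)])
  have rem_conf: "x(i := x i - u * x i) \<in> configs N" if "x \<in> configs N" "i \<in> {1..N}" "u \<in> {0<..<1}" for x i u
    using jump_config[OF that(1,2) order_refl, of u] that by simp
  have inj_conf: "x(i := x i + u * r) \<in> configs N" if "x \<in> configs N" "i \<in> {1..N}" "u \<in> {0<..}" "0 \<le> r" for x i u r
    using that by (auto simp: PiE_iff extensional_def)

  have remove: "(\<lambda>n. LBINT u:{0<..<1}. (1 - u) powr (?a - 1) / u * (?t n (x(i := x i - u * x i)) - ?t n x))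
      \<longlonglongrightarrow> (LBINT u:{0<..<1}. (1 - u) powr (?a - 1) / u * (?k (x(i := x i - u * x i)) - ?k x))"
    "\<bar>LBINT u:{0<..<1}. (1 - u) powr (?a - 1) / u * (?t n (x(i := x i - u * x i)) - ?t n x)\<bar> \<le> 4 / ?a"
    if x: "x \<in> configs N" and i: "i \<in> {1..N}" for x i n
  proof -
    have 1: "(\<lambda>u. (1 - u) powr (?a - 1) / u * (?t n (x(i := x i - u * x i)) - ?t n x)) \<in> borel_measurable (restrict_space borel {0<..<1})" for n
      by (intro borel_measurable_times borel_measurable_diff tm upd measurable_restrict_space1) auto
    have 2: "(\<lambda>u. (1 - u) powr (?a - 1) / u * (?k (x(i := x i - u * x i)) - ?k x)) \<in> borel_measurable (restrict_space borel {0<..<1})"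
      by (intro borel_measurable_times borel_measurable_diff km upd measurable_restrict_space1) auto
    have 3: "\<bar>(1 - u) powr (?a - 1) / u * (?t n (x(i := x i - u * x i)) - ?t n x)\<bar> \<le> 4 * (1 - u) powr (?a - 1)" if "u \<in> {0<..<1}" for n u
      using that laplace_test_remove_bound[OF c x l i, of u] by (intro rate) auto
    have 4: "(\<lambda>n. (1 - u) powr (?a - 1) / u * (?t n (x(i := x i - u * x i)) - ?t n x)) \<longlonglongrightarrow> (1 - u) powr (?a - 1) / u * (?k (x(i := x i - u * x i)) - ?k x)"
      if "u \<in> {0<..<1}" for u by (intro tendsto_mult tendsto_diff tendsto_const kt x rem_conf i that)
    note d = set_integral_dominated_convergence_at_top[OF 1 2 _ w(1) 3 4]
    show "(\<lambda>n. LBINT u:{0<..<1}. (1 - u) powr (?a - 1) / u * (?t n (x(i := x i - u * x i)) - ?t n x))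
      \<longlonglongrightarrow> (LBINT u:{0<..<1}. (1 - u) powr (?a - 1) / u * (?k (x(i := x i - u * x i)) - ?k x))"
      by (rule d(1)) auto
    show "\<bar>LBINT u:{0<..<1}. (1 - u) powr (?a - 1) / u * (?t n (x(i := x i - u * x i)) - ?t n x)\<bar> \<le> 4 / ?a"
      unfolding w(2)[symmetric] by (rule d(3)) auto
  qed
  define K where "K = (\<lambda>i. 4 + l (i + 1) / l i + (4 + l i / l (i + 1)))"
  define B where "B = (\<lambda>f (x :: nat \<Rightarrow> real) i u. (1 - u) powr (?a - 1) / u *
    (f (x(i := x i - u * x i, i+1 := x (i+1) + u * x i)) + f (x(i+1 := x (i+1) - u * x (i+1), i := x i + u * x (i+1))) - 2 * f x :: real))"
  have bulk: "(\<lambda>n. LBINT u:{0<..<1}. B (?t n) x i u) \<longlonglongrightarrow> (LBINT u:{0<..<1}. B ?k x i u)"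
    "\<bar>LBINT u:{0<..<1}. B (?t n) x i u\<bar> \<le> K i / ?a"
    if x: "x \<in> configs N" and "i \<in> {1..<N}" for x i n
  proof -
    have i: "i \<in> {1..N}" "i + 1 \<in> {1..N}" using that by auto
    have 1: "B (?t n) x i \<in> borel_measurable (restrict_space borel {0<..<1})" for n
      unfolding B_def by (intro borel_measurable_times borel_measurable_diff borel_measurable_add tm upd2 measurable_restrict_space1) auto
    have 2: "B ?k x i \<in> borel_measurable (restrict_space borel {0<..<1})"
      unfolding B_def by (intro borel_measurable_times borel_measurable_diff borel_measurable_add km upd2 measurable_restrict_space1) auto
    have 3: "\<bar>B (?t n) x i u\<bar> \<le> K i * (1 - u) powr (?a - 1)" if "u \<in> {0<..<1}" for n u
      unfolding B_def
    proof (rule rate[OF that])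
      have u: "0 < u" "u < 1" using that by auto
      show "\<bar>?t n (x(i := x i - u * x i, i+1 := x (i+1) + u * x i)) + ?t n (x(i+1 := x (i+1) - u * x (i+1), i := x i + u * x (i+1))) - 2 * ?t n x\<bar> \<le> K i * u"
        using laplace_test_move_bound[OF c x l i(1,2) _ u, of n] laplace_test_move_bound[OF c x l i(2,1) _ u, of n]
        unfolding K_def distrib_right[of "4 + l (i + 1) / l i" "4 + l i / l (i + 1)" u] by simp
    qed
    have 4: "(\<lambda>n. B (?t n) x i u) \<longlonglongrightarrow> B ?k x i u" if "u \<in> {0<..<1}" for u
      unfolding B_def using that i by (intro tendsto_mult tendsto_diff tendsto_add tendsto_const kt x config_move) auto
    note d = set_integral_dominated_convergence_at_top[OF 1 2 _ w(1) 3 4]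
    show "(\<lambda>n. LBINT u:{0<..<1}. B (?t n) x i u) \<longlonglongrightarrow> (LBINT u:{0<..<1}. B ?k x i u)"
      by (rule d(1)) auto
    show "\<bar>LBINT u:{0<..<1}. B (?t n) x i u\<bar> \<le> K i / ?a"
      unfolding w(2)[symmetric] by (rule d(3)) auto
  qed
  have inject: "(\<lambda>n. LBINT u:{0<..}. exp (- u) / u * (?t n (x(i := x i + u * r)) - ?t n x))
      \<longlonglongrightarrow> (LBINT u:{0<..}. exp (- u) / u * (?k (x(i := x i + u * r)) - ?k x))"
    "\<bar>LBINT u:{0<..}. exp (- u) / u * (?t n (x(i := x i + u * r)) - ?t n x)\<bar>
      \<le> (LBINT u:{0<..}. \<bar>exp (- u) / u * (exp (- (l i * r * u)) - 1)\<bar>)"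
    if x: "x \<in> configs N" and i: "i \<in> {1..N}" and r: "0 \<le> r" for x i n r
  proof -
    have lr: "0 \<le> l i * r" using l i r by (auto simp: less_imp_le)
    have 1: "(\<lambda>u. exp (- u) / u * (?t n (x(i := x i + u * r)) - ?t n x)) \<in> borel_measurable (restrict_space borel {0<..})" for n
      by (intro borel_measurable_times borel_measurable_diff tm upd measurable_restrict_space1) auto
    have 2: "(\<lambda>u. exp (- u) / u * (?k (x(i := x i + u * r)) - ?k x)) \<in> borel_measurable (restrict_space borel {0<..})"
      by (intro borel_measurable_times borel_measurable_diff km upd measurable_restrict_space1) auto
    have 3: "\<bar>exp (- u) / u * (?t n (x(i := x i + u * r)) - ?t n x)\<bar> \<le> \<bar>exp (- u) / u * (exp (- (l i * r * u)) - 1)\<bar>"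
      if "u \<in> {0<..}" for n u
      unfolding abs_mult using laplace_test_inject_bound[OF c x l(1) i _ r, of u n] that
      by (intro mult_left_mono) auto
    have 4: "(\<lambda>n. exp (- u) / u * (?t n (x(i := x i + u * r)) - ?t n x)) \<longlonglongrightarrow> exp (- u) / u * (?k (x(i := x i + u * r)) - ?k x)"
      if "u \<in> {0<..}" for u by (intro tendsto_mult tendsto_diff tendsto_const kt x inj_conf i that r)
    note d = set_integral_dominated_convergence_at_top[OF 1 2 _ set_integrable_abs[OF set_integrable_frullani[OF lr]] 3 4]
    show "(\<lambda>n. LBINT u:{0<..}. exp (- u) / u * (?t n (x(i := x i + u * r)) - ?t n x))
      \<longlonglongrightarrow> (LBINT u:{0<..}. exp (- u) / u * (?k (x(i := x i + u * r)) - ?k x))"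
      by (rule d(1)) auto
    show "\<bar>LBINT u:{0<..}. exp (- u) / u * (?t n (x(i := x i + u * r)) - ?t n x)\<bar>
      \<le> (LBINT u:{0<..}. \<bar>exp (- u) / u * (exp (- (l i * r * u)) - 1)\<bar>)"
      by (rule d(3)) auto
  qed
  have N1: "1 \<in> {1..N}" "N \<in> {1..N}" using N by auto
  have e: "harmonic_generator s N r r' f x =
     (LBINT u:{0<..<1}. (1 - u) powr (2 * s - 1) / u * (f (x(1 := x 1 - u * x 1)) - f x))
   + (LBINT u:{0<..}. exp (- u) / u * (f (x(1 := x 1 + u * r)) - f x))
   + (\<Sum>i=1..<N. LBINT u:{0<..<1}. B f x i u)
   + (LBINT u:{0<..<1}. (1 - u) powr (2 * s - 1) / u * (f (x(N := x N - u * x N)) - f x))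
   + (LBINT u:{0<..}. exp (- u) / u * (f (x(N := x N + u * r')) - f x))" for f x
    by (simp only: harmonic_generator_def B_def)
  show "(\<lambda>n. harmonic_generator s N r r' (?t n) x) \<longlonglongrightarrow> harmonic_generator s N r r' ?k x" if "x \<in> configs N" for x
    unfolding e by (intro tendsto_add tendsto_sum remove bulk inject that N1 r)
  show "\<exists>K. \<forall>n. \<forall>x\<in>configs N. \<bar>harmonic_generator s N r r' (?t n) x\<bar> \<le> K"
  proof (intro exI allI ballI)
    fix n x assume x: "x \<in> configs N"
    have "\<bar>\<Sum>i=1..<N. LBINT u:{0<..<1}. B (?t n) x i u\<bar> \<le> (\<Sum>i=1..<N. K i / ?a)"
      by (rule order_trans[OF sum_abs sum_mono]) (rule bulk(2)[OF x])
    then show "\<bar>harmonic_generator s N r r' (?t n) x\<bar> \<le> 4 / ?a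
      + (LBINT u:{0<..}. \<bar>exp (- u) / u * (exp (- (l 1 * r * u)) - 1)\<bar>) + (\<Sum>i=1..<N. K i / ?a) + 4 / ?a
      + (LBINT u:{0<..}. \<bar>exp (- u) / u * (exp (- (l N * r' * u)) - 1)\<bar>)"
      unfolding e
      using remove(2)[OF x N1(1), of n] remove(2)[OF x N1(2), of n] inject(2)[OF x N1(1) r(1), of n] inject(2)[OF x N1(2) r(2), of n]
      by linarith
  qed
qed

section \<open>The mixing measure\<close>

abbreviation half_line :: "real measure" where
  "half_line \<equiv> restrict_space lborel {0..}"

definition gap_weight :: "real \<Rightarrow> real \<Rightarrow> real" where
  "gap_weight a t = (if 0 < t then t powr (a - 1) else 0)"

definition gap_density :: "real \<Rightarrow> nat \<Rightarrow> real \<Rightarrow> real \<Rightarrow> (nat \<Rightarrow> real) \<Rightarrow> real" where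
  "gap_density a N l r x = (\<Prod>i=1..N+1. gap_weight a (boundary N l r x i - boundary N l r x (i - 1)))"

lemma gap_weight_nonneg: "0 \<le> gap_weight a t"
  by (simp add: gap_weight_def)

lemma gap_weight_measurable [measurable]: "gap_weight a \<in> borel_measurable borel"
  unfolding gap_weight_def by measurable

lemma gap_density_nonneg: "0 \<le> gap_density a N l r x"
  unfolding gap_density_def by (intro prod_nonneg) (simp add: gap_weight_nonneg)

interpretation half_line: product_sigma_finite "\<lambda>_::nat. half_line"
  by (intro product_sigma_finite.intro sigma_finite_measure_restrict_space sigma_finite_lborel) simp

lemma sets_half_line_PiM: "sets (PiM {1..N} (\<lambda>_. half_line)) = sets (config_space N)"
  unfolding config_space_def by (intro sets_PiM_cong refl) (simp add: sets_restrict_space)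

lemma half_line_PiM_measurable:
  "f \<in> borel_measurable (config_space N) \<Longrightarrow> f \<in> borel_measurable (PiM {1..N} (\<lambda>_. half_line))"
  by (simp only: measurable_cong_sets[OF sets_half_line_PiM refl])

lemma half_line_measurable: "f \<in> borel_measurable borel \<Longrightarrow> f \<in> borel_measurable half_line"
  by (rule measurable_restrict_space1) simp

lemma boundary_measurable: "(\<lambda>x. boundary N l r x i) \<in> borel_measurable (config_space N)" if "i \<le> N + 1"
  using that measurable_coordinate[of i N] by (cases "i \<in> {1..N}") (auto simp: boundary_def)

lemma gap_density_measurable: "gap_density a N l r \<in> borel_measurable (config_space N)"
  unfolding gap_density_def
  by (intro borel_measurable_prod measurable_compose[OF _ gap_weight_measurable] borel_measurable_diff boundary_measurable) auto

lemma gap_density_increasing: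
  assumes "gap_density a N l r x \<noteq> 0" "i < j" "j \<le> N + 1"
  shows "boundary N l r x i < boundary N l r x j"
  using assms(2,3)
proof (induction j)
  case (Suc j)
  have "\<forall>i\<in>{1..N+1}. gap_weight a (boundary N l r x i - boundary N l r x (i - 1)) \<noteq> 0"
    using assms(1) unfolding gap_density_def by (subst (asm) prod_zero_iff) auto
  then have "gap_weight a (boundary N l r x (Suc j) - boundary N l r x (Suc j - 1)) \<noteq> 0"
    by (rule bspec) (use Suc.prems in auto)
  then have "boundary N l r x j < boundary N l r x (Suc j)" by (auto simp: gap_weight_def split: if_splits)
  then show ?case using Suc by (cases "i = j") auto
qed simp

lemma gap_density_eq_0: "r \<le> l \<Longrightarrow> gap_density a N l r x = 0"
  using gap_density_increasing[of a N l r x 0 "N + 1"] by (auto simp: boundary_def)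

lemma nn_integral_beta:
  fixes p q l r :: real assumes p: "0 < p" and q: "0 < q" and lr: "l < r"
  shows "(\<integral>\<^sup>+y. ennreal (gap_weight p (y - l) * gap_weight q (r - y)) \<partial>lborel) = ennreal (Beta p q * (r - l) powr (p + q - 1))"
proof -
  define k where "k = r - l"
  have k: "0 < k" using lr by (simp add: k_def)
  have sc: "gap_weight p (k * t) = k powr (p - 1) * gap_weight p t" for p t
    using k by (auto simp: gap_weight_def powr_mult zero_less_mult_iff)
  have "(\<integral>\<^sup>+y. ennreal (gap_weight p (y - l) * gap_weight q (r - y)) \<partial>lborel)
      = ennreal k * (\<integral>\<^sup>+t. ennreal (gap_weight p (l + k * t - l) * gap_weight q (r - (l + k * t))) \<partial>lborel)"
    using k by (subst nn_integral_real_affine[of _ k l]) auto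
  also have "(\<integral>\<^sup>+t. ennreal (gap_weight p (l + k * t - l) * gap_weight q (r - (l + k * t))) \<partial>lborel)
      = (\<integral>\<^sup>+t. ennreal (k powr (p - 1) * k powr (q - 1)) * (ennreal (t powr (p - 1) * (1 - t) powr (q - 1)) * indicator {0..1} t) \<partial>lborel)"
  proof (intro nn_integral_cong)
    fix t
    have e: "l + k * t - l = k * t" "r - (l + k * t) = k * (1 - t)" by (auto simp: k_def algebra_simps)
    have "ennreal (gap_weight p t * gap_weight q (1 - t)) = ennreal (t powr (p - 1) * (1 - t) powr (q - 1)) * indicator {0..1} t"
      by (auto simp: gap_weight_def indicator_def)
    moreover have "gap_weight p (k * t) * gap_weight q (k * (1 - t))
        = (k powr (p - 1) * k powr (q - 1)) * (gap_weight p t * gap_weight q (1 - t))"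
      unfolding sc by (simp add: mult_ac)
    ultimately show "ennreal (gap_weight p (l + k * t - l) * gap_weight q (r - (l + k * t)))
        = ennreal (k powr (p - 1) * k powr (q - 1)) * (ennreal (t powr (p - 1) * (1 - t) powr (q - 1)) * indicator {0..1} t)"
      unfolding e by (simp add: ennreal_mult gap_weight_nonneg)
  qed
  also have "\<dots> = ennreal (k powr (p - 1) * k powr (q - 1)) * ennreal (Beta p q)"
    by (subst nn_integral_cmult, simp, subst nn_integral_has_integral_lebesgue'[OF _ has_integral_Beta_real[OF p q]]) auto
  also have "ennreal k * (ennreal (k powr (p - 1) * k powr (q - 1)) * ennreal (Beta p q))
      = ennreal (k * (k powr (p - 1) * k powr (q - 1)) * Beta p q)"
    using k p q by (simp add: ennreal_mult[symmetric] Beta_def Gamma_real_pos less_imp_le mult.assoc)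
  also have "k * (k powr (p - 1) * k powr (q - 1)) = k powr (p + q - 1)"
    using k by (simp add: powr_add powr_diff field_simps)
  finally show ?thesis by (simp add: k_def mult.commute)
qed

lemma dirichlet_integral:
  assumes a: "0 < a" and l: "0 \<le> l" and "l < r"
  shows "(\<integral>\<^sup>+x. ennreal (gap_density a N l r x) \<partial>PiM {1..N} (\<lambda>_. half_line))
    = ennreal (Gamma a ^ (N + 1) / Gamma (a * real (N + 1)) * (r - l) powr (a * real (N + 1) - 1))"
  using \<open>l < r\<close>
proof (induction N arbitrary: r)
  case 0
  have "gap_density a 0 l r x = (r - l) powr (a - 1)" for x
    using 0 by (simp add: gap_density_def boundary_def gap_weight_def)
  then show ?case
    using a by (simp add: space_PiM_empty Gamma_real_pos less_imp_neq[symmetric])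
next
  case (Suc N)
  define c where "c = Gamma a ^ (N + 1) / Gamma (a * real (N + 1))"
  have c: "0 \<le> c" using a by (simp add: c_def Gamma_real_pos less_imp_le)
  have D: "gap_density a (Suc N) l r (x(Suc N := y)) = gap_density a N l y x * gap_weight a (r - y)" for x y
  proof -
    let ?b = "boundary (Suc N) l r (x(Suc N := y))"
    have b: "?b i = boundary N l y x i" if "i \<le> Suc N" for i using that by (auto simp: boundary_def)
    have "?b (Suc (Suc N)) = r" "?b (Suc N) = y" by (auto simp: boundary_def)
    then have "gap_density a (Suc N) l r (x(Suc N := y)) = (\<Prod>i=1..N+1. gap_weight a (?b i - ?b (i - 1))) * gap_weight a (r - y)"
      unfolding gap_density_def by (simp add: prod.nat_ivl_Suc')
    also have "(\<Prod>i=1..N+1. gap_weight a (?b i - ?b (i - 1))) = gap_density a N l y x"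
      unfolding gap_density_def
    proof (intro prod.cong refl)
      fix i assume "i \<in> {1..N+1}"
      then have "?b i = boundary N l y x i" "?b (i - 1) = boundary N l y x (i - 1)" by (auto intro!: b)
      then show "gap_weight a (?b i - ?b (i - 1)) = gap_weight a (boundary N l y x i - boundary N l y x (i - 1))" by simp
    qed
    finally show ?thesis .
  qed
  have ins: "{1..Suc N} = insert (Suc N) {1..N}" by auto
  have m: "(\<lambda>x. ennreal (gap_density a (Suc N) l r x)) \<in> borel_measurable (PiM (insert (Suc N) {1..N}) (\<lambda>_. half_line))"
    unfolding ins[symmetric]
    by (intro measurable_compose[OF _ measurable_ennreal] half_line_PiM_measurable gap_density_measurable)
  have "(\<integral>\<^sup>+x. ennreal (gap_density a (Suc N) l r x) \<partial>PiM {1..Suc N} (\<lambda>_. half_line))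
     = (\<integral>\<^sup>+y. \<integral>\<^sup>+x. ennreal (gap_density a (Suc N) l r (x(Suc N := y))) \<partial>PiM {1..N} (\<lambda>_. half_line) \<partial>half_line)"
    unfolding ins by (rule half_line.product_nn_integral_insert_rev[OF _ _ m]) auto
  also have "\<dots> = (\<integral>\<^sup>+y. ennreal c * ennreal (gap_weight (a * real (N + 1)) (y - l) * gap_weight a (r - y)) \<partial>half_line)"
  proof (intro nn_integral_cong)
    fix y
    have m': "(\<lambda>x. ennreal (gap_density a N l y x)) \<in> borel_measurable (PiM {1..N} (\<lambda>_. half_line))"
      by (intro measurable_compose[OF _ measurable_ennreal] half_line_PiM_measurable gap_density_measurable)
    have "(\<integral>\<^sup>+x. ennreal (gap_density a (Suc N) l r (x(Suc N := y))) \<partial>PiM {1..N} (\<lambda>_. half_line))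
        = (\<integral>\<^sup>+x. ennreal (gap_density a N l y x) \<partial>PiM {1..N} (\<lambda>_. half_line)) * ennreal (gap_weight a (r - y))"
      unfolding D by (subst nn_integral_multc[OF m', symmetric])
        (simp add: ennreal_mult gap_density_nonneg gap_weight_nonneg)
    also have "(\<integral>\<^sup>+x. ennreal (gap_density a N l y x) \<partial>PiM {1..N} (\<lambda>_. half_line)) = ennreal (c * gap_weight (a * real (N + 1)) (y - l))"
    proof (cases "l < y")
      case True
      then show ?thesis using Suc.IH[of y] by (simp add: c_def gap_weight_def)
    qed (simp add: gap_density_eq_0 gap_weight_def)
    also have "ennreal (c * gap_weight (a * real (N + 1)) (y - l)) * ennreal (gap_weight a (r - y))
        = ennreal c * ennreal (gap_weight (a * real (N + 1)) (y - l) * gap_weight a (r - y))"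
      using c by (simp only: ennreal_mult gap_weight_nonneg mult.assoc)
    finally show "(\<integral>\<^sup>+x. ennreal (gap_density a (Suc N) l r (x(Suc N := y))) \<partial>PiM {1..N} (\<lambda>_. half_line))
        = ennreal c * ennreal (gap_weight (a * real (N + 1)) (y - l) * gap_weight a (r - y))" .
  qed
  also have "\<dots> = (\<integral>\<^sup>+y. ennreal c * ennreal (gap_weight (a * real (N + 1)) (y - l) * gap_weight a (r - y)) \<partial>lborel)"
    using l by (subst nn_integral_restrict_space) (auto intro!: nn_integral_cong simp: gap_weight_def split: split_indicator)
  also have "\<dots> = ennreal c * ennreal (Beta (a * real (N + 1)) a * (r - l) powr (a * real (N + 1) + a - 1))"
    using a Suc.prems by (subst nn_integral_cmult) (auto simp: nn_integral_beta)
  also have "\<dots> = ennreal (c * Beta (a * real (N + 1)) a * (r - l) powr (a * real (N + 1) + a - 1))"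
    using c by (simp add: ennreal_mult'[symmetric] mult.assoc)
  also have "c * Beta (a * real (N + 1)) a = Gamma a ^ (Suc N + 1) / Gamma (a * real (Suc N + 1))"
  proof -
    have "0 < Gamma (a * real (N + 1))" using a by (intro Gamma_real_pos) simp
    moreover have "a * real (N + 1) + a = a * real (Suc N + 1)" by (simp add: algebra_simps)
    ultimately show ?thesis unfolding c_def Beta_def by (simp only:) simp
  qed
  also have "a * real (N + 1) + a - 1 = a * real (Suc N + 1) - 1" by (simp add: algebra_simps)
  finally show ?case .
qed

lemma Lambda_eq_density:
  "Lambda s N r r' = density (PiM {1..N} (\<lambda>_. half_line)) (\<lambda>x. ennreal (Lambda_const s N r r' * gap_density (2 * s) N r r' x))"
proof -
  have "(\<Prod>i=1..N+1. (b i - b (i-1)) powr (2 * s - 1)) * of_bool (\<forall>i\<in>{1..N+1}. b (i-1) \<le> b i)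
      = (\<Prod>i=1..N+1. gap_weight (2 * s) (b i - b (i - 1)))" for b :: "nat \<Rightarrow> real"
  proof (cases "\<forall>i\<in>{1..N+1}. b (i-1) \<le> b i")
    case True
    have "(\<Prod>i=1..N+1. (b i - b (i-1)) powr (2 * s - 1)) = (\<Prod>i=1..N+1. gap_weight (2 * s) (b i - b (i - 1)))"
    proof (intro prod.cong refl)
      fix i assume "i \<in> {1..N+1}"
      then have "b (i - 1) \<le> b i" using True by blast
      then show "(b i - b (i-1)) powr (2 * s - 1) = gap_weight (2 * s) (b i - b (i - 1))" by (simp add: gap_weight_def)
    qed
    then show ?thesis using True by simp
  next
    case False
    then obtain i where "i \<in> {1..N+1}" "b i < b (i - 1)" by force
    then have "(\<Prod>i=1..N+1. gap_weight (2 * s) (b i - b (i - 1))) = 0"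
      by (intro prod_zero bexI[of _ i]) (auto simp: gap_weight_def)
    then show ?thesis using False by (simp only: of_bool_def if_False mult_zero_right)
  qed
  note e = this
  show ?thesis
    unfolding Lambda_def Let_def mult.assoc e boundary_def[symmetric] gap_density_def[symmetric] ..
qed

lemma Lambda_const_pos: "0 < s \<Longrightarrow> r < r' \<Longrightarrow> 0 < Lambda_const s N r r'"
  by (simp add: Lambda_const_def Gamma_real_pos)

lemma sets_Lambda: "sets (Lambda s N r r') = sets (config_space N)"
  by (simp only: Lambda_eq_density sets_density sets_half_line_PiM)

lemma Lambda_prob:
  assumes s: "0 < s" and r: "0 \<le> r" "r < r'"
  shows "Lambda s N r r' \<in> space (prob_algebra (config_space N))"
proof -
  let ?a = "2 * s"
  have m: "(\<lambda>x. ennreal (gap_density ?a N r r' x)) \<in> borel_measurable (PiM {1..N} (\<lambda>_. half_line))"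
    by (intro measurable_compose[OF _ measurable_ennreal] half_line_PiM_measurable gap_density_measurable)
  have C: "0 < Lambda_const s N r r'" by (rule Lambda_const_pos[OF s r(2)])
  have "emeasure (Lambda s N r r') (space (Lambda s N r r'))
      = (\<integral>\<^sup>+x. ennreal (Lambda_const s N r r') * ennreal (gap_density ?a N r r' x) \<partial>PiM {1..N} (\<lambda>_. half_line))"
    unfolding Lambda_eq_density using m C
    by (subst emeasure_density) (auto simp: ennreal_mult gap_density_nonneg less_imp_le intro!: nn_integral_cong)
  also have "\<dots> = ennreal (Lambda_const s N r r') * ennreal (Gamma ?a ^ (N + 1) / Gamma (?a * real (N + 1)) * (r' - r) powr (?a * real (N + 1) - 1))"
  proof -
    have "0 < ?a" using s by simp
    then show ?thesis by (simp only: nn_integral_cmult[OF m] dirichlet_integral[OF _ r])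
  qed
  also have "\<dots> = ennreal (Lambda_const s N r r' * (Gamma ?a ^ (N + 1) / Gamma (?a * real (N + 1)) * (r' - r) powr (?a * real (N + 1) - 1)))"
    using C by (intro ennreal_mult'[symmetric]) simp
  also have "Lambda_const s N r r' * (Gamma ?a ^ (N + 1) / Gamma (?a * real (N + 1)) * (r' - r) powr (?a * real (N + 1) - 1)) = 1"
  proof -
    have "0 < Gamma ?a" "0 < Gamma (?a * real (N + 1))" using s by (auto intro!: Gamma_real_pos)
    moreover have "0 < (r' - r) powr (?a * real (N + 1) - 1)" using r by simp
    ultimately show ?thesis unfolding Lambda_const_def by (simp add: field_simps)
  qed
  finally have "prob_space (Lambda s N r r')" by (intro prob_spaceI) simp
  then show ?thesis by (simp add: space_prob_algebra sets_Lambda)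
qed

lemma AE_Lambda_increasing:
  "AE x in Lambda s N r r'. \<forall>i j. i < j \<longrightarrow> j \<le> N + 1 \<longrightarrow> boundary N r r' x i < boundary N r r' x j"
proof -
  have m: "(\<lambda>x. ennreal (Lambda_const s N r r' * gap_density (2 * s) N r r' x)) \<in> borel_measurable (PiM {1..N} (\<lambda>_. half_line))"
    by (intro measurable_compose[OF _ measurable_ennreal] half_line_PiM_measurable borel_measurable_times
        borel_measurable_const gap_density_measurable)
  show ?thesis
    unfolding Lambda_eq_density by (subst AE_density[OF m]) (auto intro!: AE_I2 gap_density_increasing[where a = "2 * s"])
qed

context stieltjes
begin

lemma Lambda_site_balance:
  assumes s: "a = 2 * s" and r: "0 \<le> r" "r < r'" and i: "i \<in> {1..N}" and l: "l \<in> configs N" "0 < l i"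
  defines "g \<equiv> \<lambda>x. 2 * ln (1 + l i * x i) - ln (1 + l i * boundary N r r' x (i - 1)) - ln (1 + l i * boundary N r r' x (i + 1))"
  shows "integrable (Lambda s N r r') (\<lambda>x. g x * kern N l x)" "(\<integral>x. g x * kern N l x \<partial>Lambda s N r r') = 0"
proof -
  let ?L = "Lambda s N r r'" and ?B = "PiM {1..N} (\<lambda>_. half_line)" and ?b = "boundary N r r'"
  have s0: "0 < s" using a s by simp
  note P = Lambda_prob[OF s0 r, of N]
  interpret prob_space ?L by (rule M_prob[OF P])
  have gm: "(\<lambda>x. g x * kern N l x) \<in> borel_measurable (config_space N)"
    unfolding g_def using i boundary_measurable[of "i - 1" N r r'] boundary_measurable[of "i + 1" N r r'] measurable_coordinate[OF i]
    by (intro borel_measurable_times kern_measurable measurable_coordinate) auto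
  define K where "K = 4 * ln (1 + l i * r')"
  show int: "integrable ?L (\<lambda>x. g x * kern N l x)"
  proof (rule integrable_const_bound[where B = K])
    show "(\<lambda>x. g x * kern N l x) \<in> borel_measurable ?L"
      using gm by (simp only: measurable_cong_sets[OF sets_Lambda refl])
    show "AE x in ?L. norm (g x * kern N l x) \<le> K"
    proof (rule AE_mp[OF AE_Lambda_increasing], rule AE_I2, intro impI)
      fix x assume "x \<in> space ?L" and inc: "\<forall>i j. i < j \<longrightarrow> j \<le> N + 1 \<longrightarrow> ?b x i < ?b x j"
      then have x: "x \<in> configs N" using M_space[OF P] by simp
      have b01: "?b x 0 = r" "?b x (N + 1) = r'" by (auto simp: boundary_def)
      have bb: "0 \<le> ln (1 + l i * ?b x j) \<and> ln (1 + l i * ?b x j) \<le> ln (1 + l i * r')" if "j \<le> N + 1" for j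
      proof -
        have "r \<le> ?b x j" "?b x j \<le> r'"
          using inc[rule_format, of 0 j] inc[rule_format, of j "N + 1"] that b01 by (cases "j = 0"; cases "j = N + 1"; force)+
        then have "0 \<le> l i * ?b x j" "l i * ?b x j \<le> l i * r'" using l r by (auto intro!: mult_left_mono)
        then show ?thesis by simp
      qed
      have xi: "?b x i = x i" using i by (auto simp: boundary_def)
      have "i \<le> N + 1" "i - 1 \<le> N + 1" "i + 1 \<le> N + 1" using i by auto
      note bb3 = bb[OF this(1), unfolded xi] bb[OF this(2)] bb[OF this(3)]
      have "\<bar>g x\<bar> \<le> K"
        unfolding g_def K_def using bb3 by linarith
      moreover have "0 \<le> kern N l x" "kern N l x \<le> 1" using kern_bounds[OF x l(1)] by auto
      ultimately have "\<bar>g x\<bar> * \<bar>kern N l x\<bar> \<le> K * 1" by (intro mult_mono) auto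
      then show "norm (g x * kern N l x) \<le> K" by (simp add: abs_mult)
    qed
  qed
  define C where "C = Lambda_const s N r r'"
  have C: "0 < C" unfolding C_def by (rule Lambda_const_pos[OF s0 r(2)])
  define F where "F = (\<lambda>x. (C * gap_density a N r r' x) * (g x * kern N l x))"
  have meas: "(\<lambda>x. C * gap_density a N r r' x) \<in> borel_measurable ?B" "(\<lambda>x. g x * kern N l x) \<in> borel_measurable ?B"
    by (intro half_line_PiM_measurable borel_measurable_times borel_measurable_const gap_density_measurable gm)+
  have F: "integrable ?B F" "(\<integral>x. g x * kern N l x \<partial>?L) = (\<integral>x. F x \<partial>?B)"
    using int C meas unfolding Lambda_eq_density F_def C_def s[symmetric]
    by (simp_all add: integrable_density integral_density gap_density_nonneg)
  let ?I = "{1..N} - {i}"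
  have ins: "{1..N} = insert i ?I" using i by auto
  have "(\<integral>x. F x \<partial>?B) = (\<integral>x. (\<integral>y. F (x(i := y)) \<partial>half_line) \<partial>PiM ?I (\<lambda>_. half_line))"
    by (subst ins, rule half_line.product_integral_insert) (use F(1) ins in auto)
  also have "\<dots> = (\<integral>x. 0 \<partial>PiM ?I (\<lambda>_. half_line))"
  proof (intro Bochner_Integration.integral_cong refl)
    fix x assume "x \<in> space (PiM ?I (\<lambda>_. half_line))"
    then have x: "0 \<le> x j" if "j \<in> ?I" for j using that by (auto simp: space_PiM PiE_iff space_restrict_space)
    define p where "p = ?b x (i - 1)"
    define q where "q = ?b x (i + 1)"
    have p: "0 \<le> p"
    proof (cases "i = 1")
      case True
      then show ?thesis using r by (simp add: p_def boundary_def)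
    next
      case False
      then have "i - 1 \<in> ?I" using i by auto
      from x[OF this] show ?thesis using False i by (auto simp: p_def boundary_def)
    qed
    have bu: "?b (x(i := y)) j = (if j = i then y else ?b x j)" for y j using i by (auto simp: boundary_def)
    define c where "c = C * (\<Prod>j\<in>{1..N+1} - {i} - {i + 1}. gap_weight a (?b x j - ?b x (j - 1))) * (\<Prod>j\<in>?I. (1 + l j * x j) powr - a)"
    have "F (x(i := y)) = c * (gap_weight a (y - p) * gap_weight a (q - y) * (1 + l i * y) powr - a *
        (2 * ln (1 + l i * y) - ln (1 + l i * p) - ln (1 + l i * q)))" for y
    proof -
      have "gap_density a N r r' (x(i := y)) = gap_weight a (y - p) * (gap_weight a (q - y) *
          (\<Prod>j\<in>{1..N+1} - {i} - {i + 1}. gap_weight a (?b (x(i := y)) j - ?b (x(i := y)) (j - 1))))"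
        unfolding gap_density_def
        by (subst prod.remove[of _ i], simp, use i in simp, subst prod.remove[of _ "i + 1"])
          (use i in \<open>auto simp: bu p_def q_def\<close>)
      also have "(\<Prod>j\<in>{1..N+1} - {i} - {i + 1}. gap_weight a (?b (x(i := y)) j - ?b (x(i := y)) (j - 1)))
          = (\<Prod>j\<in>{1..N+1} - {i} - {i + 1}. gap_weight a (?b x j - ?b x (j - 1)))"
        by (intro prod.cong refl) (auto simp: bu)
      finally have 1: "gap_density a N r r' (x(i := y)) = gap_weight a (y - p) * (gap_weight a (q - y) *
          (\<Prod>j\<in>{1..N+1} - {i} - {i + 1}. gap_weight a (?b x j - ?b x (j - 1))))" .
      have 2: "kern N l (x(i := y)) = (1 + l i * y) powr - a * (\<Prod>j\<in>?I. (1 + l j * x j) powr - a)"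
        unfolding kern_split[OF i] by (intro arg_cong2[where f = "(*)"] prod.cong) auto
      have 3: "g (x(i := y)) = 2 * ln (1 + l i * y) - ln (1 + l i * p) - ln (1 + l i * q)"
      proof -
        have "i - 1 \<noteq> i" "i + 1 \<noteq> i" using i by (cases i; simp)+
        then show ?thesis unfolding g_def bu p_def q_def by (simp only: fun_upd_same if_False)
      qed
      show ?thesis unfolding F_def 1 2 3 c_def by (simp only: mult_ac)
    qed
    then have "(\<integral>y. F (x(i := y)) \<partial>half_line) = c * (\<integral>y. gap_weight a (y - p) * gap_weight a (q - y) * (1 + l i * y) powr - a *
        (2 * ln (1 + l i * y) - ln (1 + l i * p) - ln (1 + l i * q)) \<partial>half_line)"
      by simp
    also have "(\<integral>y. gap_weight a (y - p) * gap_weight a (q - y) * (1 + l i * y) powr - a *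
        (2 * ln (1 + l i * y) - ln (1 + l i * p) - ln (1 + l i * q)) \<partial>half_line)
      = (LBINT y:{p<..<q}. (y - p) powr (a - 1) * (q - y) powr (a - 1) * (1 + l i * y) powr - a *
        (2 * ln (1 + l i * y) - ln (1 + l i * p) - ln (1 + l i * q)))"
      unfolding set_lebesgue_integral_def using p
      by (subst integral_restrict_space) (auto intro!: Bochner_Integration.integral_cong simp: gap_weight_def split: split_indicator)
    also have "\<dots> = 0" by (rule set_integral_log_antisymmetric[OF p l(2)])
    finally show "(\<integral>y. F (x(i := y)) \<partial>half_line) = 0" by (simp only: mult_zero_right)
  qed
  finally show "(\<integral>x. g x * kern N l x \<partial>?L) = 0" using F(2) by simp
qed

lemma Lambda_hidden_generator:
  assumes s: "a = 2 * s" and N: "1 \<le> N" and r: "0 \<le> r" "r < r'" and l: "l \<in> configs N" "\<forall>i\<in>{1..N}. 0 < l i"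
  shows "(\<integral>x. hidden_generator s N r r' (kern N l) x \<partial>Lambda s N r r') = 0"
proof -
  have s0: "0 < s" using a s by simp
  let ?g = "\<lambda>i x. 2 * ln (1 + l i * x i) - ln (1 + l i * boundary N r r' x (i - 1)) - ln (1 + l i * boundary N r r' x (i + 1))"
  have "(\<integral>x. hidden_generator s N r r' (kern N l) x \<partial>Lambda s N r r') = (\<integral>x. (\<Sum>i=1..N. ?g i x * kern N l x) \<partial>Lambda s N r r')"
    using r M_space[OF Lambda_prob[OF s0 r]]
    by (intro Bochner_Integration.integral_cong refl) (simp add: hidden_generator_kern[OF N _ l(1) _ _ s] sum_distrib_right)
  also have "\<dots> = (\<Sum>i=1..N. \<integral>x. ?g i x * kern N l x \<partial>Lambda s N r r')"
    by (rule Bochner_Integration.integral_sum, rule Lambda_site_balance(1)[OF s r _ l(1)]) (use l in auto)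
  also have "\<dots> = 0"
    by (intro sum.neutral ballI Lambda_site_balance(2)[OF s r _ l(1)]) (use l in auto)
  finally show ?thesis .
qed

end

section \<open>Mixtures of Gamma distributions\<close>

lemma space_gamma_measure [simp]: "space (gamma_measure s t) = {0..}"
  by (simp add: gamma_measure_def space_restrict_space)

lemma sets_gamma_measure [simp, measurable_cong]: "sets (gamma_measure s t) = sets (restrict_space borel {0..})"
  by (simp add: gamma_measure_def sets_restrict_space)

lemma gamma_density_measurable:
  "(\<lambda>x. ennreal (x powr (2 * s - 1) / (Gamma (2 * s) * t powr (2 * s)) * exp (- x / t))) \<in> borel_measurable half_line"
  by (intro half_line_measurable) simp

lemma nn_integral_gamma_measure_exp:
  assumes s: "0 < s" and t: "0 < t" and c: "0 \<le> c"
  shows "(\<integral>\<^sup>+x. ennreal (exp (- (c * x))) \<partial>gamma_measure s t) = ennreal ((1 + c * t) powr - (2 * s))"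
proof -
  define a where "a = 2 * s"
  have a: "0 < a" using s by (simp add: a_def)
  have G: "0 < Gamma a" using a by (rule Gamma_real_pos)
  define k where "k = t / (1 + c * t)"
  have ct: "0 < 1 + c * t" using c t by (simp add: add_pos_nonneg)
  have k: "0 < k" using ct t by (simp add: k_def)
  have k1: "k * x / t + c * (k * x) = x" for x
  proof -
    have "k * (1 + c * t) = t" using ct by (simp add: k_def)
    moreover have "k * x / t + c * (k * x) = (k * (1 + c * t)) * x / t" using t by (simp add: field_simps)
    ultimately show ?thesis using t by simp
  qed
  define A where "A = k powr (a - 1) / (Gamma a * t powr a)"
  have A: "0 \<le> A" using G by (simp add: A_def)
  have "(\<integral>\<^sup>+x. ennreal (exp (- (c * x))) \<partial>gamma_measure s t)
      = (\<integral>\<^sup>+x. ennreal (x powr (a - 1) / (Gamma a * t powr a) * exp (- x / t)) * ennreal (exp (- (c * x))) \<partial>half_line)"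
    unfolding gamma_measure_def a_def
    by (rule nn_integral_density[OF gamma_density_measurable]) (intro half_line_measurable, simp)
  also have "\<dots> = (\<integral>\<^sup>+x. ennreal (indicator {0..} x * (x powr (a - 1) / (Gamma a * t powr a) * exp (- x / t) * exp (- (c * x)))) \<partial>lborel)"
    using G by (subst nn_integral_restrict_space)
      (auto intro!: nn_integral_cong simp: ennreal_mult[symmetric] split: split_indicator)
  also have "\<dots> = ennreal k * (\<integral>\<^sup>+x. ennreal (indicator {0..} (0 + k * x) * ((0 + k * x) powr (a - 1) / (Gamma a * t powr a)
      * exp (- (0 + k * x) / t) * exp (- (c * (0 + k * x))))) \<partial>lborel)"
    using k by (subst nn_integral_real_affine[of _ k 0]) auto
  also have "(\<integral>\<^sup>+x. ennreal (indicator {0..} (0 + k * x) * ((0 + k * x) powr (a - 1) / (Gamma a * t powr a)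
      * exp (- (0 + k * x) / t) * exp (- (c * (0 + k * x))))) \<partial>lborel)
      = (\<integral>\<^sup>+x. ennreal A * ennreal (indicator {0..} x * x powr (a - 1) / exp x) \<partial>lborel)"
  proof (intro nn_integral_cong)
    fix x :: real
    have "exp (- (k * x) / t) * exp (- (c * (k * x))) = exp (- x)"
      using k1[of x] by (simp add: exp_add[symmetric])
    then have "(k * x) powr (a - 1) / (Gamma a * t powr a) * exp (- (k * x) / t) * exp (- (c * (k * x)))
        = A * (x powr (a - 1) / exp x)" if "0 \<le> x"
      using that k by (simp add: A_def powr_mult exp_minus field_simps)
    moreover have "indicator {0..} (k * x) = (indicator {0..} x :: real)"
      using k by (auto simp: indicator_def zero_le_mult_iff)
    ultimately show "ennreal (indicator {0..} (0 + k * x) * ((0 + k * x) powr (a - 1) / (Gamma a * t powr a)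
      * exp (- (0 + k * x) / t) * exp (- (c * (0 + k * x))))) = ennreal A * ennreal (indicator {0..} x * x powr (a - 1) / exp x)"
      using A by (auto simp: ennreal_mult[symmetric] split: split_indicator)
  qed
  also have "\<dots> = ennreal A * ennreal (Gamma a)"
    by (subst nn_integral_cmult) (auto simp: Gamma_conv_nn_integral_real[OF a])
  also have "ennreal k * (ennreal A * ennreal (Gamma a)) = ennreal (k * (A * Gamma a))"
    using k A G by (simp add: ennreal_mult)
  also have "k * (A * Gamma a) = (1 + c * t) powr - a"
  proof -
    have "k * (A * Gamma a) = k powr a / t powr a"
      using k G by (simp add: A_def powr_diff)
    also have "\<dots> = (k / t) powr a" using k t by (simp add: powr_divide)
    also have "k / t = 1 / (1 + c * t)" using t by (simp add: k_def)
    also have "(1 / (1 + c * t)) powr a = (1 + c * t) powr - a"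
      using ct by (metis divide_powr_uminus inverse_eq_divide powr_minus powr_one_eq_one less_imp_le inverse_powr)
    finally show ?thesis .
  qed
  finally show ?thesis by (simp add: a_def)
qed

lemma emeasure_gamma_measure_space:
  assumes "0 < s"
  shows "0 < t \<Longrightarrow> emeasure (gamma_measure s t) {0..} = 1" "0 \<le> t \<Longrightarrow> emeasure (gamma_measure s t) {0..} \<le> 1"
proof -
  show 1: "emeasure (gamma_measure s t) {0..} = 1" if "0 < t" for t
    using nn_integral_gamma_measure_exp[OF assms that, of 0] by simp
  show "emeasure (gamma_measure s t) {0..} \<le> 1" if "0 \<le> t"
  proof (cases "t = 0")
    case True
    have "emeasure (gamma_measure s t) {0..} = 0"
      unfolding gamma_measure_def True using gamma_density_measurable[of s 0]
      by (subst emeasure_density) (auto simp: sets_restrict_space)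
    then show ?thesis by simp
  qed (use that 1[of t] in auto)
qed

lemma emeasure_gamma_measure_measurable:
  assumes A: "A \<in> sets (restrict_space borel {0..})"
  shows "(\<lambda>t. emeasure (gamma_measure s t) A) \<in> borel_measurable borel"
proof -
  have A': "A \<in> sets half_line" using A by (simp add: sets_restrict_space)
  have [measurable]: "(\<lambda>x. x) \<in> borel_measurable half_line" by (rule half_line_measurable) simp
  have e: "emeasure (gamma_measure s t) A
      = (\<integral>\<^sup>+x. ennreal (x powr (2 * s - 1) / (Gamma (2 * s) * t powr (2 * s)) * exp (- x / t)) * indicator A x \<partial>half_line)" for t
    unfolding gamma_measure_def by (rule emeasure_density[OF gamma_density_measurable A'])
  have H: "sigma_finite_measure half_line"
    by (rule sigma_finite_measure_restrict_space[OF sigma_finite_lborel]) simp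
  have [measurable]: "fst \<in> borel_measurable (borel \<Otimes>\<^sub>M half_line)" "snd \<in> borel_measurable (borel \<Otimes>\<^sub>M half_line)"
    using measurable_compose[OF measurable_snd half_line_measurable[of "\<lambda>x. x"]] by (auto simp: measurable_fst)
  have [measurable]: "(\<lambda>p. indicator A (snd p) :: ennreal) \<in> borel_measurable (borel \<Otimes>\<^sub>M half_line)"
    by (rule measurable_compose[OF measurable_snd borel_measurable_indicator[OF A']])
  show ?thesis
    unfolding e by (rule sigma_finite_measure.borel_measurable_nn_integral[OF H]) (simp add: case_prod_beta')
qed

lemma gamma_product_emeasure:
  assumes s: "0 < s" and t: "t \<in> configs N"
    and A: "\<And>i. i \<in> {1..N} \<Longrightarrow> A i \<in> sets (restrict_space borel {0..})"
  shows "emeasure (PiM {1..N} (\<lambda>i. gamma_measure s (t i))) (PiE {1..N} A) = (\<Prod>i=1..N. emeasure (gamma_measure s (t i)) (A i))"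
    and "(\<And>i. i \<in> {1..N} \<Longrightarrow> f i \<in> borel_measurable (restrict_space borel {0..})) \<Longrightarrow>
      (\<integral>\<^sup>+x. (\<Prod>i=1..N. f i (x i)) \<partial>PiM {1..N} (\<lambda>i. gamma_measure s (t i))) = (\<Prod>i=1..N. \<integral>\<^sup>+x. f i x \<partial>gamma_measure s (t i))"
proof -
  have e: "PiM {1..N} (\<lambda>i. gamma_measure s (t i)) = PiM {1..N} (\<lambda>i. gamma_measure s (max 0 (t i)))"
    using t by (intro PiM_cong refl) (auto simp: PiE_iff max_def)
  have t': "max 0 (t i) = t i" if "i \<in> {1..N}" for i using t that by (auto simp: PiE_iff)
  have "sigma_finite_measure (gamma_measure s (max 0 (t i)))" for i
  proof -
    have "finite_measure (gamma_measure s (max 0 (t i)))"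
      using emeasure_gamma_measure_space(2)[OF s, of "max 0 (t i)"] by (intro finite_measureI) (auto simp: top_unique)
    then show ?thesis by (simp add: finite_measure_def)
  qed
  then interpret product_sigma_finite "\<lambda>i. gamma_measure s (max 0 (t i))"
    by (rule product_sigma_finite.intro)
  show "emeasure (PiM {1..N} (\<lambda>i. gamma_measure s (t i))) (PiE {1..N} A) = (\<Prod>i=1..N. emeasure (gamma_measure s (t i)) (A i))"
    unfolding e using A t' by (subst emeasure_PiM) (auto intro!: prod.cong)
  show "(\<integral>\<^sup>+x. (\<Prod>i=1..N. f i (x i)) \<partial>PiM {1..N} (\<lambda>i. gamma_measure s (t i))) = (\<Prod>i=1..N. \<integral>\<^sup>+x. f i x \<partial>gamma_measure s (t i))"
    if f: "\<And>i. i \<in> {1..N} \<Longrightarrow> f i \<in> borel_measurable (restrict_space borel {0..})"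
  proof -
    have "f i \<in> borel_measurable (gamma_measure s (max 0 (t i)))" if "i \<in> {1..N}" for i
      using f[OF that] by (simp only: measurable_cong_sets[OF sets_gamma_measure refl])
    then show ?thesis
      unfolding e using t' by (subst product_nn_integral_prod) (auto intro!: prod.cong)
  qed
qed

lemma gamma_product_space:
  assumes s: "0 < s" and t: "t \<in> configs N"
  shows "emeasure (PiM {1..N} (\<lambda>i. gamma_measure s (t i))) (configs N) \<le> 1"
    and "(\<And>i. i \<in> {1..N} \<Longrightarrow> 0 < t i) \<Longrightarrow> emeasure (PiM {1..N} (\<lambda>i. gamma_measure s (t i))) (configs N) = 1"
proof -
  have e: "emeasure (PiM {1..N} (\<lambda>i. gamma_measure s (t i))) (configs N) = (\<Prod>i=1..N. emeasure (gamma_measure s (t i)) {0..})"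
    by (rule gamma_product_emeasure(1)[OF s t]) (auto simp: sets_restrict_space)
  show "emeasure (PiM {1..N} (\<lambda>i. gamma_measure s (t i))) (configs N) \<le> 1"
    unfolding e using t by (intro prod_le_1 conjI emeasure_gamma_measure_space(2)[OF s]) (auto simp: PiE_iff)
  show "emeasure (PiM {1..N} (\<lambda>i. gamma_measure s (t i))) (configs N) = 1" if "\<And>i. i \<in> {1..N} \<Longrightarrow> 0 < t i"
    unfolding e using that by (intro prod.neutral ballI emeasure_gamma_measure_space(1)[OF s]) auto
qed

lemma sets_gamma_product: "sets (PiM {1..N} (\<lambda>i. gamma_measure s (t i))) = sets (config_space N)"
  unfolding config_space_def by (intro sets_PiM_cong refl) simp

lemma gamma_product_kernel:
  assumes s: "0 < s"
  shows "(\<lambda>t. PiM {1..N} (\<lambda>i. gamma_measure s (t i))) \<in> config_space N \<rightarrow>\<^sub>M subprob_algebra (config_space N)"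
proof (rule measurable_subprob_algebra_generated)
  show "sets (config_space N) = sigma_sets (\<Pi>\<^sub>E i\<in>{1..N}. space (restrict_space borel {0..})) (prod_algebra {1..N} (\<lambda>_. restrict_space borel {0..}))"
    unfolding config_space_def by (rule sets_PiM)
  show "Int_stable (prod_algebra {1..N} (\<lambda>_. restrict_space borel {0..} :: real measure))" by (rule Int_stable_prod_algebra)
  show "prod_algebra {1..N} (\<lambda>_. restrict_space borel {0..}) \<subseteq> Pow (\<Pi>\<^sub>E i\<in>{1..N}. space (restrict_space borel {0..}))"
    by (rule prod_algebra_sets_into_space)
  have box: "(\<lambda>t. emeasure (PiM {1..N} (\<lambda>i. gamma_measure s (t i))) (PiE {1..N} A)) \<in> borel_measurable (config_space N)"
    if A: "\<And>i. i \<in> {1..N} \<Longrightarrow> A i \<in> sets (restrict_space borel {0..})" for A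
  proof (subst measurable_cong)
    show "emeasure (PiM {1..N} (\<lambda>i. gamma_measure s (t i))) (PiE {1..N} A) = (\<Prod>i=1..N. emeasure (gamma_measure s (t i)) (A i))"
      if "t \<in> space (config_space N)" for t
      using that A by (intro gamma_product_emeasure(1)[OF s]) auto
    show "(\<lambda>t. \<Prod>i=1..N. emeasure (gamma_measure s (t i)) (A i)) \<in> borel_measurable (config_space N)"
      by (rule borel_measurable_prod_ennreal)
        (rule measurable_compose[OF measurable_coordinate emeasure_gamma_measure_measurable[OF A]])
  qed
  fix B assume "B \<in> prod_algebra {1..N} (\<lambda>_. restrict_space borel {0..} :: real measure)"
  then obtain A where "B = PiE {1..N} A" "A \<in> {1..N} \<rightarrow> sets (restrict_space borel {0..})"
    by (auto simp: prod_algebra_eq_finite)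
  then show "(\<lambda>t. emeasure (PiM {1..N} (\<lambda>i. gamma_measure s (t i))) B) \<in> borel_measurable (config_space N)"
    using box[of A] by (simp only: Pi_iff)
next
  have "(\<Pi>\<^sub>E i\<in>{1..N}. space (restrict_space borel {0..})) = PiE {1..N} (\<lambda>_. {0..} :: real set)"
    by (simp add: space_restrict_space)
  moreover have "(\<lambda>t. emeasure (PiM {1..N} (\<lambda>i. gamma_measure s (t i))) (PiE {1..N} (\<lambda>_. {0..}))) \<in> borel_measurable (config_space N)"
  proof (subst measurable_cong)
    show "emeasure (PiM {1..N} (\<lambda>i. gamma_measure s (t i))) (configs N) = (\<Prod>i=1..N. emeasure (gamma_measure s (t i)) {0..})"
      if "t \<in> space (config_space N)" for t
      using that by (intro gamma_product_emeasure(1)[OF s]) (auto simp: sets_restrict_space)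
    show "(\<lambda>t. \<Prod>i=1..N. emeasure (gamma_measure s (t i)) {0..}) \<in> borel_measurable (config_space N)"
      by (intro borel_measurable_prod_ennreal measurable_compose[OF measurable_coordinate emeasure_gamma_measure_measurable])
        (auto simp: sets_restrict_space)
  qed
  ultimately show "(\<lambda>t. emeasure (PiM {1..N} (\<lambda>i. gamma_measure s (t i))) (\<Pi>\<^sub>E i\<in>{1..N}. space (restrict_space borel {0..})))
      \<in> borel_measurable (config_space N)" by simp
next
  fix t assume t: "t \<in> space (config_space N)"
  show sets: "sets (PiM {1..N} (\<lambda>i. gamma_measure s (t i))) = sets (config_space N)" by (rule sets_gamma_product)
  have sp: "space (PiM {1..N} (\<lambda>i. gamma_measure s (t i))) = configs N"
    using sets_eq_imp_space_eq[OF sets] by simp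
  show "subprob_space (PiM {1..N} (\<lambda>i. gamma_measure s (t i)))"
  proof (rule subprob_spaceI)
    show "emeasure (PiM {1..N} (\<lambda>i. gamma_measure s (t i))) (space (PiM {1..N} (\<lambda>i. gamma_measure s (t i)))) \<le> 1"
      unfolding sp using gamma_product_space(1)[OF s, of t N] t by simp
    show "space (PiM {1..N} (\<lambda>i. gamma_measure s (t i))) \<noteq> {}"
      unfolding sp using t by auto
  qed
qed

lemma
  assumes s: "0 < s" and r: "0 \<le> r" "r < r'"
  shows gamma_mixture_prob: "gamma_mixture s N r r' \<in> space (prob_algebra (config_space N))"
    and gamma_mixture_transform: "l \<in> configs N \<Longrightarrow>
      laplace.transform N (gamma_mixture s N r r') l = (\<integral>t. (\<Prod>i=1..N. (1 + l i * t i) powr - (2 * s)) \<partial>Lambda s N r r')"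
proof -
  interpret st: stieltjes "2 * s" by standard (use s in simp)
  let ?L = "Lambda s N r r'" and ?K = "\<lambda>t. PiM {1..N} (\<lambda>i. gamma_measure s (t i))"
  note P = Lambda_prob[OF s r, of N]
  interpret L: prob_space ?L by (rule st.M_prob[OF P])
  have sp: "space ?L = configs N" by (rule st.M_space[OF P])
  have K: "?K \<in> ?L \<rightarrow>\<^sub>M subprob_algebra (config_space N)"
    using gamma_product_kernel[OF s, of N] by (simp only: measurable_cong_sets[OF sets_Lambda refl])
  have ne: "space ?L \<noteq> {}" by (rule L.not_empty)
  have sets: "sets (gamma_mixture s N r r') = sets (config_space N)"
    unfolding gamma_mixture_def by (rule sets_bind_measurable[OF K ne])
  have spm: "space (gamma_mixture s N r r') = configs N"
    using sets_eq_imp_space_eq[OF sets] by simp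
  have AEpos: "AE t in ?L. \<forall>i\<in>{1..N}. 0 < t i"
  proof (rule AE_mp[OF AE_Lambda_increasing], rule AE_I2, intro impI ballI)
    fix t i assume inc: "\<forall>i j. i < j \<longrightarrow> j \<le> N + 1 \<longrightarrow> boundary N r r' t i < boundary N r r' t j" and i: "i \<in> {1..N}"
    have "boundary N r r' t 0 < boundary N r r' t i" using inc i by auto
    then show "0 < t i" using i r by (auto simp: boundary_def)
  qed
  have "emeasure (gamma_mixture s N r r') (space (gamma_mixture s N r r')) = (\<integral>\<^sup>+t. emeasure (?K t) (configs N) \<partial>?L)"
    unfolding spm unfolding gamma_mixture_def
    by (rule emeasure_bind[OF ne K]) (metis sets.top space_config_space)
  also have "\<dots> = (\<integral>\<^sup>+t. 1 \<partial>?L)"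
  proof (rule nn_integral_cong_AE, rule AE_mp[OF AEpos], rule AE_I2, rule impI)
    fix t assume t: "t \<in> space ?L" "\<forall>i\<in>{1..N}. 0 < t i"
    from t(1) have "t \<in> configs N" by (simp only: sp)
    then show "emeasure (?K t) (configs N) = 1" by (rule gamma_product_space(2)[OF s]) (rule bspec[OF t(2)])
  qed
  also have "\<dots> = 1" using L.emeasure_space_1 by simp
  finally have "prob_space (gamma_mixture s N r r')" by (rule prob_spaceI)
  then show prob: "gamma_mixture s N r r' \<in> space (prob_algebra (config_space N))"
    by (simp add: space_prob_algebra sets)
  show "laplace.transform N (gamma_mixture s N r r') l = (\<integral>t. (\<Prod>i=1..N. (1 + l i * t i) powr - (2 * s)) \<partial>?L)"
    if l: "l \<in> configs N"
  proof -
    have R: "(\<integral>t. (\<Prod>i=1..N. (1 + l i * t i) powr - (2 * s)) \<partial>?L) = st.transform N ?L l"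
      by (simp add: st.transform_def st.kern_def)
    have km: "(\<lambda>x. ennreal (laplace.kern N l x)) \<in> borel_measurable (config_space N)"
      by (intro measurable_compose[OF _ measurable_ennreal] laplace.kern_measurable measurable_coordinate) auto
    have "ennreal (laplace.transform N (gamma_mixture s N r r') l) = (\<integral>\<^sup>+x. ennreal (laplace.kern N l x) \<partial>gamma_mixture s N r r')"
      unfolding laplace.transform_def using laplace.kern_bounds[OF _ l] spm
      by (intro nn_integral_eq_integral[symmetric] laplace.kern_integrable[OF prob l] AE_I2) auto
    also have "\<dots> = (\<integral>\<^sup>+t. \<integral>\<^sup>+x. ennreal (laplace.kern N l x) \<partial>?K t \<partial>?L)"
      unfolding gamma_mixture_def by (rule nn_integral_bind[OF km K])
    also have "\<dots> = (\<integral>\<^sup>+t. ennreal (st.kern N l t) \<partial>?L)"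
    proof (rule nn_integral_cong_AE, rule AE_mp[OF AEpos], rule AE_I2, intro impI)
      fix t assume t: "t \<in> space ?L" "\<forall>i\<in>{1..N}. 0 < t i"
      have "(\<integral>\<^sup>+x. ennreal (laplace.kern N l x) \<partial>?K t) = (\<integral>\<^sup>+x. (\<Prod>i=1..N. ennreal (exp (- (l i * x i)))) \<partial>?K t)"
        by (simp add: laplace.kern_def prod_ennreal)
      also have "\<dots> = (\<Prod>i=1..N. \<integral>\<^sup>+x. ennreal (exp (- (l i * x))) \<partial>gamma_measure s (t i))"
        using t sp by (intro gamma_product_emeasure(2)[OF s, where A = "\<lambda>_. {0..}" and f = "\<lambda>i x. ennreal (exp (- (l i * x)))"])
          (auto intro!: measurable_restrict_space1 simp: sets_restrict_space)
      also have "\<dots> = (\<Prod>i=1..N. ennreal ((1 + l i * t i) powr - (2 * s)))"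
        using t l by (intro prod.cong refl nn_integral_gamma_measure_exp[OF s]) (auto simp: PiE_iff)
      also have "\<dots> = ennreal (st.kern N l t)"
        by (simp add: st.kern_def prod_ennreal)
      finally show "(\<integral>\<^sup>+x. ennreal (laplace.kern N l x) \<partial>?K t) = ennreal (st.kern N l t)" .
    qed
    also have "\<dots> = ennreal (st.transform N ?L l)"
      unfolding st.transform_def using st.kern_bounds[OF _ l] sp
      by (intro nn_integral_eq_integral st.kern_integrable[OF P l] AE_I2) auto
    finally have e: "ennreal (laplace.transform N (gamma_mixture s N r r') l) = ennreal (st.transform N ?L l)" .
    have "0 \<le> laplace.transform N (gamma_mixture s N r r') l"
      unfolding laplace.transform_def by (rule Bochner_Integration.integral_nonneg) (use laplace.kern_bounds[OF _ l] spm in force)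
    moreover have "0 \<le> st.transform N ?L l"
      unfolding st.transform_def by (rule Bochner_Integration.integral_nonneg) (use st.kern_bounds[OF _ l] sp in force)
    ultimately show ?thesis using e by (simp only: R ennreal_inj)
  qed
qed

lemma hidden_generator_cong:
  assumes N: "1 \<le> N" and fg: "\<And>x. x \<in> configs N \<Longrightarrow> f x = g x" and x: "x \<in> configs N"
  shows "hidden_generator s N 0 0 f x = hidden_generator s N 0 0 g x"
proof -
  have m: "f (x(i := x i - u * x i + u * v)) = g (x(i := x i - u * x i + u * v))"
    if "i \<in> {1..N}" "0 \<le> v" "u \<in> {0<..<1}" for i v u
    using that by (intro fg jump_config[OF x]) auto
  have m0: "f (x(i := x i - u * x i)) = g (x(i := x i - u * x i))" if "i \<in> {1..N}" "u \<in> {0<..<1}" for i u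
    using m[OF that(1) order_refl that(2)] by simp
  have xi: "0 \<le> x i" if "i \<in> {1..N}" for i using x that by (auto simp: PiE_iff)
  show ?thesis
    unfolding hidden_generator_def
    using N by (intro arg_cong2[where f = "(+)"] sum.cong set_lebesgue_integral_cong allI impI refl)
      (simp_all add: m m0 xi fg[OF x] del: fun_upd_apply)
qed

section \<open>Characterisation of the invariant measures\<close>

context profile
begin

lemma law_unique:
  assumes s: "0 < s" and N: "1 \<le> N" and \<kappa>: "0 \<le> \<kappa>"
    and M: "M \<in> space (prob_algebra (config_space N))" "M' \<in> space (prob_algebra (config_space N))"
    and V: "\<And>l. l \<in> configs N \<Longrightarrow> 0 \<le> V l"
    and eq: "\<And>f. f \<in> C1c N \<Longrightarrow> \<kappa> * ((\<integral>x. f x \<partial>M) - (\<integral>x. f x \<partial>M')) = (\<integral>x. L f x \<partial>M)"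
    and meas: "\<And>f. f \<in> C1c N \<Longrightarrow> L f \<in> borel_measurable (config_space N)"
    and lim: "\<And>l x. l \<in> configs N \<Longrightarrow> \<forall>i\<in>{1..N}. 0 < l i \<Longrightarrow> x \<in> configs N \<Longrightarrow>
      (\<lambda>n. L (test N (1 / Suc n) l) x) \<longlonglongrightarrow> L (kern N l) x"
    and bound: "\<And>l. l \<in> configs N \<Longrightarrow> \<forall>i\<in>{1..N}. 0 < l i \<Longrightarrow> \<exists>K. \<forall>n. \<forall>x\<in>configs N. \<bar>L (test N (1 / Suc n) l) x\<bar> \<le> K"
    and dual: "\<And>l x. l \<in> configs N \<Longrightarrow> x \<in> configs N \<Longrightarrow>
      L (kern N l) x = hidden_generator s N 0 0 (kern N x) l - V l * kern N l x"
    and stationary: "\<And>l. l \<in> configs N \<Longrightarrow> \<forall>i\<in>{1..N}. 0 < l i \<Longrightarrow>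
      hidden_generator s N 0 0 (transform N M') l = V l * transform N M' l"
    and step: "\<And>i G A. i \<in> {1..N} \<Longrightarrow> G \<in> borel_measurable (config_space N) \<Longrightarrow>
      (\<And>x. x \<in> configs N \<Longrightarrow> G x \<in> {0..1}) \<Longrightarrow>
      (\<And>l. 0 < l \<Longrightarrow> (\<integral>x. G x * q (l * x i) \<partial>M) = (\<integral>x. G x * q (l * x i) \<partial>M')) \<Longrightarrow>
      A \<in> sets borel \<Longrightarrow> (\<integral>x. G x * indicator A (x i) \<partial>M) = (\<integral>x. G x * indicator A (x i) \<partial>M')"
  shows "M = M'"
proof (rule transform_determines_measure[where q = q])
  fix l :: "nat \<Rightarrow> real" assume "\<forall>i\<in>{1..N}. 0 < l i"
  define l' where "l' = (\<lambda>i\<in>{1..N}. l i)"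
  have l': "l' \<in> configs N" "\<forall>i\<in>{1..N}. 0 < l' i"
    using \<open>\<forall>i\<in>{1..N}. 0 < l i\<close> by (auto simp: l'_def less_imp_le)
  have "transform N M l' = transform N M' l'"
  proof (rule transform_unique[OF s N \<kappa> M V _ stationary l'])
    fix l assume l: "l \<in> configs N" "\<forall>i\<in>{1..N}. 0 < l i"
    obtain K where K: "\<And>n x. x \<in> configs N \<Longrightarrow> \<bar>L (test N (1 / Suc n) l) x\<bar> \<le> K" using bound[OF l] by blast
    have "\<kappa> * (transform N M l - transform N M' l) = (\<integral>x. L (kern N l) x \<partial>M)"
      by (rule kern_equation[OF M eq meas l lim[OF l] K])
    also have "\<dots> = (\<integral>x. hidden_generator s N 0 0 (kern N x) l - V l * kern N l x \<partial>M)"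
      using dual[OF l(1)] M_space[OF M(1)] by (intro Bochner_Integration.integral_cong) auto
    also have "\<dots> = hidden_generator s N 0 0 (transform N M) l - V l * transform N M l"
      using hidden_generator_transform[OF s N M(1) l] kern_integrable[OF M(1) l(1)] by (simp add: transform_def)
    finally show "\<kappa> * (transform N M l - transform N M' l) = hidden_generator s N 0 0 (transform N M) l - V l * transform N M l" .
  qed
  moreover have "kern N l' x = (\<Prod>i=1..N. q (l i * x i))" for x
    unfolding kern_def by (intro prod.cong) (auto simp: l'_def)
  ultimately show "(\<integral>x. (\<Prod>i=1..N. q (l i * x i)) \<partial>M) = (\<integral>x. (\<Prod>i=1..N. q (l i * x i)) \<partial>M')"
    by (simp add: transform_def)
next
  show "q z \<in> {0..1}" if "0 \<le> z" for z using q_pos[OF that] q_le_1[OF that] by simp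
  show "prob_space M" by (rule M_prob[OF M(1)])
  show "prob_space M'" by (rule M_prob[OF M(2)])
  show "sets M = sets (config_space N)" by (rule M_sets[OF M(1)])
  show "sets M' = sets (config_space N)" by (rule M_sets[OF M(2)])
  show "q \<in> borel_measurable borel" by (rule q_meas)
qed (rule step)

lemma invariant_iff:
  assumes s: "0 < s" and N: "1 \<le> N" and P: "feller_with_generator N L P"
    and M': "M' \<in> space (prob_algebra (config_space N))"
    and V: "\<And>l. l \<in> configs N \<Longrightarrow> 0 \<le> V l"
    and lim: "\<And>l x. l \<in> configs N \<Longrightarrow> \<forall>i\<in>{1..N}. 0 < l i \<Longrightarrow> x \<in> configs N \<Longrightarrow>
      (\<lambda>n. L (test N (1 / Suc n) l) x) \<longlonglongrightarrow> L (kern N l) x"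
    and bound: "\<And>l. l \<in> configs N \<Longrightarrow> \<forall>i\<in>{1..N}. 0 < l i \<Longrightarrow> \<exists>K. \<forall>n. \<forall>x\<in>configs N. \<bar>L (test N (1 / Suc n) l) x\<bar> \<le> K"
    and dual: "\<And>l x. l \<in> configs N \<Longrightarrow> x \<in> configs N \<Longrightarrow>
      L (kern N l) x = hidden_generator s N 0 0 (kern N x) l - V l * kern N l x"
    and stationary: "\<And>l. l \<in> configs N \<Longrightarrow> \<forall>i\<in>{1..N}. 0 < l i \<Longrightarrow>
      hidden_generator s N 0 0 (transform N M') l = V l * transform N M' l"
    and step: "\<And>M i G A. M \<in> space (prob_algebra (config_space N)) \<Longrightarrow> i \<in> {1..N} \<Longrightarrow> G \<in> borel_measurable (config_space N) \<Longrightarrow>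
      (\<And>x. x \<in> configs N \<Longrightarrow> G x \<in> {0..1}) \<Longrightarrow>
      (\<And>l. 0 < l \<Longrightarrow> (\<integral>x. G x * q (l * x i) \<partial>M) = (\<integral>x. G x * q (l * x i) \<partial>M')) \<Longrightarrow>
      A \<in> sets borel \<Longrightarrow> (\<integral>x. G x * indicator A (x i) \<partial>M) = (\<integral>x. G x * indicator A (x i) \<partial>M')"
  shows "invariant_measure N P \<mu> \<longleftrightarrow> \<mu> = M'"
proof -
  have F: "feller_semigroup N P" and gen: "\<And>f. f \<in> C1c N \<Longrightarrow> (f, L f) \<in> inf_generator N P"
    using P by (simp_all add: feller_with_generator_def)
  have meas: "L f \<in> borel_measurable (config_space N)" if "f \<in> C1c N" for f
  proof (rule C0_measurable)
    show "L f \<in> C0 N" using gen[OF that] by (simp add: inf_generator_def)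
  qed
  have unique: "M = M'"
    if M: "M \<in> space (prob_algebra (config_space N))" and \<kappa>: "0 \<le> \<kappa>"
      and eq: "\<And>f. f \<in> C1c N \<Longrightarrow> \<kappa> * ((\<integral>x. f x \<partial>M) - (\<integral>x. f x \<partial>M')) = (\<integral>x. L f x \<partial>M)" for M \<kappa>
    by (rule law_unique[OF s N \<kappa> M M' V eq meas lim bound dual stationary step[OF M]])
  show ?thesis
  proof
    assume inv: "invariant_measure N P \<mu>"
    then have \<mu>: "\<mu> \<in> space (prob_algebra (config_space N))" by (simp add: invariant_measure_def)
    show "\<mu> = M'"
    proof (rule unique[OF \<mu> order_refl])
      fix f assume "f \<in> C1c N"
      from invariant_equation[OF F \<mu> inv gen[OF this]]
      show "0 * ((\<integral>x. f x \<partial>\<mu>) - (\<integral>x. f x \<partial>M')) = (\<integral>x. L f x \<partial>\<mu>)" by simp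
    qed
  next
    assume "\<mu> = M'"
    show "invariant_measure N P \<mu>"
      unfolding \<open>\<mu> = M'\<close>
    proof (rule invariant_if_resolvent_laws_constant[OF F M'])
      fix \<kappa> :: real assume \<kappa>: "0 < \<kappa>"
      show "resolvent_law P M' \<kappa> = M'"
        by (rule unique[OF resolvent_law[OF F M' \<kappa>] less_imp_le[OF \<kappa>]]) (rule resolvent_law_equation[OF F M' gen \<kappa>])
    qed
  qed
qed

end

lemma stationary_transform:
  assumes s: "0 < s" and N: "1 \<le> N" and r: "0 \<le> r" "r < r'" and l: "l \<in> configs N" "\<forall>i\<in>{1..N}. 0 < l i"
  shows "hidden_generator s N 0 0 (\<lambda>l. \<integral>t. (\<Prod>i=1..N. (1 + l i * t i) powr - (2 * s)) \<partial>Lambda s N r r') l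
    = (ln (1 + l 1 * r) + ln (1 + l N * r')) * (\<integral>t. (\<Prod>i=1..N. (1 + l i * t i) powr - (2 * s)) \<partial>Lambda s N r r')"
proof -
  interpret st: stieltjes "2 * s" by standard (use s in simp)
  let ?M = "Lambda s N r r'" and ?V = "ln (1 + l 1 * r) + ln (1 + l N * r')"
  note P = Lambda_prob[OF s r, of N]
  have r': "0 \<le> r'" using r by simp
  have tr: "st.transform N ?M = (\<lambda>l. \<integral>t. (\<Prod>i=1..N. (1 + l i * t i) powr - (2 * s)) \<partial>?M)"
    by (simp add: fun_eq_iff st.transform_def st.kern_def)
  have "0 = (\<integral>x. hidden_generator s N r r' (st.kern N l) x \<partial>?M)"
    by (rule st.Lambda_hidden_generator[OF refl N r l, symmetric])
  also have "\<dots> = (\<integral>x. hidden_generator s N 0 0 (st.kern N x) l - ?V * st.kern N l x \<partial>?M)"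
    by (rule Bochner_Integration.integral_cong[OF refl])
      (simp only: st.M_space[OF P] st.hidden_generator_kern_dual[OF N _ l(1) r(1) r' refl])
  also have "\<dots> = hidden_generator s N 0 0 (st.transform N ?M) l - ?V * st.transform N ?M l"
    using st.hidden_generator_transform[OF s N P l] st.kern_integrable[OF P l(1)] by (simp add: st.transform_def)
  finally show ?thesis unfolding tr by simp
qed

lemma coordinate_law_facts:
  assumes M: "M \<in> space (prob_algebra (config_space N))" and i: "i \<in> {1..N}"
  shows "finite_measure M" "sets M = sets (config_space N)" "(\<lambda>x. x i) \<in> borel_measurable M"
    "f \<in> borel_measurable (config_space N) \<Longrightarrow> f \<in> borel_measurable M" "x \<in> space M \<longleftrightarrow> x \<in> configs N" "x \<in> space M \<Longrightarrow> 0 \<le> x i"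
proof -
  show "finite_measure M" by (rule prob_space.finite_measure[OF laplace.M_prob[OF M]])
  show sets: "sets M = sets (config_space N)" by (rule laplace.M_sets[OF M])
  show "(\<lambda>x. x i) \<in> borel_measurable M"
    using measurable_coordinate[OF i] by (simp only: measurable_cong_sets[OF sets refl])
  show "f \<in> borel_measurable (config_space N) \<Longrightarrow> f \<in> borel_measurable M"
    by (simp only: measurable_cong_sets[OF sets refl])
  show sp: "x \<in> space M \<longleftrightarrow> x \<in> configs N" by (simp only: laplace.M_space[OF M])
  show "x \<in> space M \<Longrightarrow> 0 \<le> x i" using i sp by (auto simp: PiE_iff)
qed

lemma ln_boundary_nonneg:
  fixes l :: "nat \<Rightarrow> real"
  assumes "1 \<le> N" "l \<in> configs N" "0 \<le> r" "0 \<le> r'"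
  shows "0 \<le> ln (1 + l 1 * r) + ln (1 + l N * r')"
proof -
  have "0 \<le> l 1" "0 \<le> l N" using assms by (auto simp: PiE_iff)
  then show ?thesis using assms by simp
qed

lemma hidden_invariant_iff:
  assumes s: "0 < s" and N: "1 \<le> N" and r: "0 \<le> r" "r < r'"
    and P: "feller_with_generator N (hidden_generator s N r r') P"
  shows "invariant_measure N P \<mu> \<longleftrightarrow> \<mu> = Lambda s N r r'"
proof -
  interpret st: stieltjes "2 * s" by standard (use s in simp)
  note \<Lambda> = Lambda_prob[OF s r, of N]
  have r': "0 \<le> r'" using r by simp
  have tr: "st.transform N (Lambda s N r r') = (\<lambda>l. \<integral>t. (\<Prod>i=1..N. (1 + l i * t i) powr - (2 * s)) \<partial>Lambda s N r r')"
    by (simp add: fun_eq_iff st.transform_def st.kern_def)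
  show ?thesis
  proof (rule st.invariant_iff[OF s N P \<Lambda>, where V = "\<lambda>l. ln (1 + l 1 * r) + ln (1 + l N * r')"])
    show "0 \<le> ln (1 + l 1 * r) + ln (1 + l N * r')" if "l \<in> configs N" for l
      by (rule ln_boundary_nonneg[OF N that r(1) r'])
    show "hidden_generator s N r r' (st.kern N l) x
      = hidden_generator s N 0 0 (st.kern N x) l - (ln (1 + l 1 * r) + ln (1 + l N * r')) * st.kern N l x"
      if "l \<in> configs N" "x \<in> configs N" for l x
      by (rule st.hidden_generator_kern_dual[OF N that(2) that(1) r(1) r' refl])
    show "(\<lambda>n. hidden_generator s N r r' (st.test N (1 / Suc n) l) x) \<longlonglongrightarrow> hidden_generator s N r r' (st.kern N l) x"
      if "l \<in> configs N" "\<forall>i\<in>{1..N}. 0 < l i" "x \<in> configs N" for l x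
      by (rule st.hidden_generator_test(1)[OF N that(1,2) r(1) r' refl that(3)])
    show "\<exists>K. \<forall>n. \<forall>x\<in>configs N. \<bar>hidden_generator s N r r' (st.test N (1 / Suc n) l) x\<bar> \<le> K"
      if "l \<in> configs N" "\<forall>i\<in>{1..N}. 0 < l i" for l
      by (rule st.hidden_generator_test(2)[OF N that r(1) r' refl])
    show "hidden_generator s N 0 0 (st.transform N (Lambda s N r r')) l
      = (ln (1 + l 1 * r) + ln (1 + l N * r')) * st.transform N (Lambda s N r r') l"
      if "l \<in> configs N" "\<forall>i\<in>{1..N}. 0 < l i" for l
      unfolding tr by (rule stationary_transform[OF s N r that])
    show "(\<integral>x. G x * indicator A (x i) \<partial>M) = (\<integral>x. G x * indicator A (x i) \<partial>Lambda s N r r')"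
      if M: "M \<in> space (prob_algebra (config_space N))" and i: "i \<in> {1..N}"
        and G: "G \<in> borel_measurable (config_space N)" "\<And>x. x \<in> configs N \<Longrightarrow> G x \<in> {0..1}"
        and eq: "\<And>l. 0 < l \<Longrightarrow> (\<integral>x. G x * (1 + l * x i) powr - (2 * s) \<partial>M) = (\<integral>x. G x * (1 + l * x i) powr - (2 * s) \<partial>Lambda s N r r')"
        and A: "A \<in> sets borel" for M i G and A :: "real set"
    proof (rule stieltjes_determines_law[where X = "\<lambda>x. x i" and G = G and \<mu> = M and \<pi> = "Lambda s N r r'" and a = "2 * s"])
      show "0 < 2 * s" by (rule st.a)
      show "finite_measure M" by (rule coordinate_law_facts(1)[OF M i])
      show "finite_measure (Lambda s N r r')" by (rule coordinate_law_facts(1)[OF \<Lambda> i])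
      show "(\<lambda>x. x i) \<in> borel_measurable (Lambda s N r r')" by (rule coordinate_law_facts(3)[OF \<Lambda> i])
      show "0 \<le> x i" if "x \<in> space (Lambda s N r r')" for x by (rule coordinate_law_facts(6)[OF \<Lambda> i that])
      show "G \<in> borel_measurable (Lambda s N r r')" by (rule coordinate_law_facts(4)[OF \<Lambda> i G(1)])
      show "(\<integral>x. G x * (1 + l * x i) powr - (2 * s) \<partial>M) = (\<integral>x. G x * (1 + l * x i) powr - (2 * s) \<partial>Lambda s N r r')" if "0 < l" for l by (rule eq[OF that])
      show "A \<in> sets borel" by (rule A)
      show "sets M = sets (Lambda s N r r')" by (simp only: coordinate_law_facts(2)[OF M i] coordinate_law_facts(2)[OF \<Lambda> i])
      show "G x \<in> {0..1}" if "x \<in> space (Lambda s N r r')" for x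
        by (rule G(2)[OF that[unfolded coordinate_law_facts(5)[OF \<Lambda> i]]])
    qed
  qed
qed

lemma harmonic_invariant_iff:
  assumes s: "0 < s" and N: "1 \<le> N" and r: "0 \<le> r" "r < r'"
    and P: "feller_with_generator N (harmonic_generator s N r r') P"
  shows "invariant_measure N P \<mu> \<longleftrightarrow> \<mu> = gamma_mixture s N r r'"
proof -
  let ?M = "gamma_mixture s N r r'"
  note M' = gamma_mixture_prob[OF s r, of N]
  have r': "0 \<le> r'" using r by simp
  note tr = gamma_mixture_transform[OF s r, of _ N]
  show ?thesis
  proof (rule laplace.invariant_iff[OF s N P M', where V = "\<lambda>l. ln (1 + l 1 * r) + ln (1 + l N * r')"])
    show "0 \<le> ln (1 + l 1 * r) + ln (1 + l N * r')" if "l \<in> configs N" for l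
      by (rule ln_boundary_nonneg[OF N that r(1) r'])
    show "harmonic_generator s N r r' (laplace.kern N l) x
      = hidden_generator s N 0 0 (laplace.kern N x) l - (ln (1 + l 1 * r) + ln (1 + l N * r')) * laplace.kern N l x"
      if "l \<in> configs N" "x \<in> configs N" for l x
      by (rule harmonic_generator_laplace_kern[OF N that(1) r(1) r'])
    show "(\<lambda>n. harmonic_generator s N r r' (laplace.test N (1 / Suc n) l) x) \<longlonglongrightarrow> harmonic_generator s N r r' (laplace.kern N l) x"
      if "l \<in> configs N" "\<forall>i\<in>{1..N}. 0 < l i" "x \<in> configs N" for l x
      by (rule harmonic_generator_test(1)[OF s N that(1,2) r(1) r' that(3)])
    show "\<exists>K. \<forall>n. \<forall>x\<in>configs N. \<bar>harmonic_generator s N r r' (laplace.test N (1 / Suc n) l) x\<bar> \<le> K"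
      if "l \<in> configs N" "\<forall>i\<in>{1..N}. 0 < l i" for l
      by (rule harmonic_generator_test(2)[OF s N that r(1) r'])
    show "hidden_generator s N 0 0 (laplace.transform N ?M) l = (ln (1 + l 1 * r) + ln (1 + l N * r')) * laplace.transform N ?M l"
      if l: "l \<in> configs N" "\<forall>i\<in>{1..N}. 0 < l i" for l
      by (simp only: hidden_generator_cong[OF N tr l(1)] stationary_transform[OF s N r l] tr[OF l(1)])
    show "(\<integral>x. G x * indicator A (x i) \<partial>M) = (\<integral>x. G x * indicator A (x i) \<partial>?M)"
      if M: "M \<in> space (prob_algebra (config_space N))" and i: "i \<in> {1..N}"
        and G: "G \<in> borel_measurable (config_space N)" "\<And>x. x \<in> configs N \<Longrightarrow> G x \<in> {0..1}"
        and eq: "\<And>l. 0 < l \<Longrightarrow> (\<integral>x. G x * exp (- (l * x i)) \<partial>M) = (\<integral>x. G x * exp (- (l * x i)) \<partial>?M)"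
        and A: "A \<in> sets borel" for M i G and A :: "real set"
    proof (rule laplace_determines_law[where X = "\<lambda>x. x i" and G = G and \<mu> = M and \<pi> = "?M"])
      show "finite_measure M" by (rule coordinate_law_facts(1)[OF M i])
      show "finite_measure (?M)" by (rule coordinate_law_facts(1)[OF M' i])
      show "(\<lambda>x. x i) \<in> borel_measurable (?M)" by (rule coordinate_law_facts(3)[OF M' i])
      show "0 \<le> x i" if "x \<in> space (?M)" for x by (rule coordinate_law_facts(6)[OF M' i that])
      show "G \<in> borel_measurable (?M)" by (rule coordinate_law_facts(4)[OF M' i G(1)])
      show "(\<integral>x. G x * exp (- (l * x i)) \<partial>M) = (\<integral>x. G x * exp (- (l * x i)) \<partial>?M)" if "0 < l" for l by (rule eq[OF that])
      show "A \<in> sets borel" by (rule A)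
      show "sets M = sets ?M" by (simp only: coordinate_law_facts(2)[OF M i] coordinate_law_facts(2)[OF M' i])
      show "G x \<in> {0..1}" if "x \<in> space ?M" for x
        by (rule G(2)[OF that[unfolded coordinate_law_facts(5)[OF M' i]]])
    qed
  qed
qed

theorem theorem3p5:
  fixes s \<theta>L \<theta>R :: real and N :: nat
  assumes "s > 0" and "N \<ge> 1" and "0 \<le> \<theta>L" and "\<theta>L < \<theta>R"
  shows "(\<forall>P. feller_with_generator N (hidden_generator s N \<theta>L \<theta>R) P \<longrightarrow>
            (\<forall>\<mu>. invariant_measure N P \<mu> \<longleftrightarrow> \<mu> = Lambda s N \<theta>L \<theta>R))
       \<and> (\<forall>P. feller_with_generator N (harmonic_generator s N \<theta>L \<theta>R) P \<longrightarrow>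
            (\<forall>\<mu>. invariant_measure N P \<mu> \<longleftrightarrow> \<mu> = gamma_mixture s N \<theta>L \<theta>R))"
  by (intro conjI allI impI hidden_invariant_iff[OF assms] harmonic_invariant_iff[OF assms])

end
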